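(* Let $X$ be a locally compact, connected, separable Hausdorff space, $m$ a nonnegative Radon measure on $X$ with support $X$, and $\mathscr E$ a regular, strongly local Dirichlet form on $L^2(X,m)$ with domain $\mathbb D$, energy measure $\Gamma$ and intrinsic distance $d$, such that the topology induced by $d$ coincides with the original topology of $X$. Suppose that $(X,d,m)$ satisfies a doubling property. Then $\mathrm{Lip}(X)\subset\mathbb D_{\mathrm{loc}}$, and for every $u\in \mathrm{Lip}(X)$ one has $\Gamma(u,u)\le (\mathrm{Lip}\,u)^2\, m$; that is, $\Gamma(u,u)$ is absolutely continuous with respect to $m$ and $$\frac{d}{dm}\Gamma(u,u)\le (\mathrm{Lip}\,u)^2$$ $m$-almost everywhere.
   Context: A Dirichlet form $\mathscr E$ on $L^2(X)=L^2(X,m)$ is a closed, nonnegative definite, symmetric bilinear form on a dense linear subspace $\mathbb D\subset L^2(X)$ with the Markov property. It is strongly local if $\mathscr E(u,v)=0$ whenever $u,v\in\mathbb D$ and $u$ is constant on a neighborhood of the support of $v$; regular if some subset of $\mathbb D\cap \mathscr C_0(X)$ is dense both in $\mathscr C_0(X)$ (continuous functions with compact support, uniform norm) and in $\mathbb D$ with norm $\|u\|_{\mathbb D}=[\|u\|_{L^2(X)}^2+\mathscr E(u,u)]^{1/2}$. Then $\mathscr E(u,v)=\int_X d\Gamma(u,v)$, where the energy measure $\Gamma$ is the signed-Radon-measure-valued, nonnegative definite, symmetric bilinear form determined by $\int_X\phi\,d\Gamma(u,v)=\frac12[\mathscr E(u,\phi v)+\mathscr E(v,\phi u)-\mathscr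 E(uv,\phi)]$ for $u,v\in\mathbb D\cap L^\infty(X)$, $\phi\in\mathbb D\cap\mathscr C_0(X)$. By locality $\Gamma(u,v)$ is also defined for $u,v\in\mathbb D_{\mathrm{loc}}$, the set of $u\in L^2_{\mathrm{loc}}(X)$ such that for each relatively compact $K\subset X$ there is $w\in\mathbb D$ with $u=w$ a.e. on $K$. The intrinsic distance is $d(x,y)=\sup\{u(x)-u(y): u\in\mathbb D_{\mathrm{loc}}\cap\mathscr C(X),\ \Gamma(u,u)\le m\}$, where $\Gamma(u,u)\le m$ means that $\Gamma(u,u)$ is absolutely continuous with respect to $m$ with density $\le1$ a.e. $\mathrm{Lip}(X)$ is the set of functions $u$ with $\sup_{x\neq y}|u(x)-u(y)|/d(x,y)<\infty$, and $\mathrm{Lip}\,u(x)=\limsup_{y\to x}\frac{|u(x)-u(y)|}{d(x,y)}$ is the pointwise Lipschitz constant. Doubling property: there is $C_0>1$ with $m(B(x,2r))\le C_0\,m(B(x,r))<\infty$ for all $x\in X$, $r>0$ (balls with respect to $d$). *)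

theory Defs
  imports "HOL-Analysis.Analysis"
begin

section \<open>Radon measures and signed Radon measures\<close>

definition relatively_compact :: "'a::t2_space set \<Rightarrow> bool" where
  "relatively_compact K \<longleftrightarrow> compact (closure K)"

definition radon_measure :: "'a::t2_space measure \<Rightarrow> bool" where
  "radon_measure \<mu> \<longleftrightarrow>
     sets \<mu> = sets borel \<and>
     (\<forall>K. compact K \<longrightarrow> emeasure \<mu> K < \<infinity>) \<and>
     (\<forall>B\<in>sets borel. emeasure \<mu> B = (INF U\<in>{U. open U \<and> B \<subseteq> U}. emeasure \<mu> U)) \<and>
     (\<forall>U. open U \<longrightarrow> emeasure \<mu> U = (SUP K\<in>{K. compact K \<and> K \<subseteq> U}. emeasure \<mu> K))"

definition measure_support :: "'a::t2_space measure \<Rightarrow> 'a set" where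
  "measure_support \<mu> = {x. \<forall>U. open U \<longrightarrow> x \<in> U \<longrightarrow> emeasure \<mu> U > 0}"

text \<open>A signed Radon measure of finite total variation is a real set function (only its values on
  Borel sets matter) that is a difference of two finite Radon measures.\<close>

definition radon_decomposition ::
  "('a::t2_space set \<Rightarrow> real) \<Rightarrow> 'a measure \<Rightarrow> 'a measure \<Rightarrow> bool" where
  "radon_decomposition \<nu> \<mu>1 \<mu>2 \<longleftrightarrow>
     radon_measure \<mu>1 \<and> finite_measure \<mu>1 \<and> radon_measure \<mu>2 \<and> finite_measure \<mu>2 \<and>
     (\<forall>B\<in>sets borel. \<nu> B = measure \<mu>1 B - measure \<mu>2 B)"

definition signed_radon_measure :: "('a::t2_space set \<Rightarrow> real) \<Rightarrow> bool" where
  "signed_radon_measure \<nu> \<longleftrightarrow> (\<exists>\<mu>1 \<mu>2. radon_decomposition \<nu> \<mu>1 \<mu>2)"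

text \<open>For bounded Borel functions the value below does not depend on the decomposition.\<close>

definition signed_integral :: "('a::t2_space set \<Rightarrow> real) \<Rightarrow> ('a \<Rightarrow> real) \<Rightarrow> real" where
  "signed_integral \<nu> \<phi> =
     (THE c. \<exists>\<mu>1 \<mu>2. radon_decomposition \<nu> \<mu>1 \<mu>2 \<and>
        c = (\<integral>x. \<phi> x \<partial>\<mu>1) - (\<integral>x. \<phi> x \<partial>\<mu>2))"

section \<open>Function spaces\<close>

text \<open>Elements of $L^2$ are represented by measurable functions. Subspaces of $L^2$ are
  represented by sets of functions that are closed under equality almost everywhere.\<close>

definition L2 :: "'a measure \<Rightarrow> ('a \<Rightarrow> real) set" where
  "L2 m = {u. u \<in> borel_measurable m \<and> integrable m (\<lambda>x. (u x)\<^sup>2)}"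

definition L2_loc :: "'a::t2_space measure \<Rightarrow> ('a \<Rightarrow> real) set" where
  "L2_loc m = {u. u \<in> borel_measurable m \<and>
     (\<forall>K. compact K \<longrightarrow> set_integrable m K (\<lambda>x. (u x)\<^sup>2))}"

definition ess_bounded :: "'a measure \<Rightarrow> ('a \<Rightarrow> real) set" where
  "ess_bounded m = {u. u \<in> borel_measurable m \<and> (\<exists>M. AE x in m. \<bar>u x\<bar> \<le> M)}"

definition C0 :: "('a::t2_space \<Rightarrow> real) set" where
  "C0 = {\<phi>. continuous_on UNIV \<phi> \<and> compact (closure {x. \<phi> x \<noteq> 0})}"

definition ae_support :: "'a::t2_space measure \<Rightarrow> ('a \<Rightarrow> real) \<Rightarrow> 'a set" where
  "ae_support m v = - \<Union>{U. open U \<and> (AE x in m. x \<in> U \<longrightarrow> v x = 0)}"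

section \<open>Dirichlet forms\<close>

definition form_norm ::
  "'a measure \<Rightarrow> (('a \<Rightarrow> real) \<Rightarrow> ('a \<Rightarrow> real) \<Rightarrow> real) \<Rightarrow> ('a \<Rightarrow> real) \<Rightarrow> real" where
  "form_norm m E u = sqrt ((\<integral>x. (u x)\<^sup>2 \<partial>m) + E u u)"

definition dense_L2_subspace :: "'a measure \<Rightarrow> ('a \<Rightarrow> real) set \<Rightarrow> bool" where
  "dense_L2_subspace m D \<longleftrightarrow>
     D \<subseteq> L2 m \<and>
     (\<forall>u\<in>D. \<forall>v\<in>borel_measurable m. (AE x in m. u x = v x) \<longrightarrow> v \<in> D) \<and>
     (\<lambda>x. 0) \<in> D \<and>
     (\<forall>u\<in>D. \<forall>v\<in>D. (\<lambda>x. u x + v x) \<in> D) \<and>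
     (\<forall>c. \<forall>u\<in>D. (\<lambda>x. c * u x) \<in> D) \<and>
     (\<forall>f\<in>L2 m. \<forall>\<epsilon>>0. \<exists>u\<in>D. sqrt (\<integral>x. (f x - u x)\<^sup>2 \<partial>m) < \<epsilon>)"

definition symmetric_form ::
  "'a measure \<Rightarrow> ('a \<Rightarrow> real) set \<Rightarrow> (('a \<Rightarrow> real) \<Rightarrow> ('a \<Rightarrow> real) \<Rightarrow> real) \<Rightarrow> bool" where
  "symmetric_form m D E \<longleftrightarrow>
     (\<forall>u\<in>D. \<forall>u'\<in>D. \<forall>v\<in>D. (AE x in m. u x = u' x) \<longrightarrow> E u v = E u' v) \<and>
     (\<forall>u\<in>D. \<forall>v\<in>D. E u v = E v u) \<and>
     (\<forall>u\<in>D. \<forall>u'\<in>D. \<forall>v\<in>D. E (\<lambda>x. u x + u' x) v = E u v + E u' v) \<and>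
     (\<forall>c. \<forall>u\<in>D. \<forall>v\<in>D. E (\<lambda>x. c * u x) v = c * E u v)"

text \<open>Closedness is completeness of the domain for the form norm.\<close>

definition closed_form ::
  "'a measure \<Rightarrow> ('a \<Rightarrow> real) set \<Rightarrow> (('a \<Rightarrow> real) \<Rightarrow> ('a \<Rightarrow> real) \<Rightarrow> real) \<Rightarrow> bool" where
  "closed_form m D E \<longleftrightarrow>
     (\<forall>w :: nat \<Rightarrow> 'a \<Rightarrow> real.
        (\<forall>n. w n \<in> D) \<longrightarrow>
        (\<forall>\<epsilon>>0. \<exists>N. \<forall>i\<ge>N. \<forall>j\<ge>N. form_norm m E (\<lambda>x. w i x - w j x) < \<epsilon>) \<longrightarrow>
        (\<exists>u\<in>D. (\<lambda>n. form_norm m E (\<lambda>x. w n x - u x)) \<longlonglongrightarrow> 0))"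

definition markov_form ::
  "('a \<Rightarrow> real) set \<Rightarrow> (('a \<Rightarrow> real) \<Rightarrow> ('a \<Rightarrow> real) \<Rightarrow> real) \<Rightarrow> bool" where
  "markov_form D E \<longleftrightarrow>
     (\<forall>u\<in>D. (\<lambda>x. min (max (u x) 0) 1) \<in> D \<and>
        E (\<lambda>x. min (max (u x) 0) 1) (\<lambda>x. min (max (u x) 0) 1) \<le> E u u)"

definition dirichlet_form ::
  "'a measure \<Rightarrow> ('a \<Rightarrow> real) set \<Rightarrow> (('a \<Rightarrow> real) \<Rightarrow> ('a \<Rightarrow> real) \<Rightarrow> real) \<Rightarrow> bool" where
  "dirichlet_form m D E \<longleftrightarrow>
     dense_L2_subspace m D \<and> symmetric_form m D E \<and> (\<forall>u\<in>D. 0 \<le> E u u) \<and>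
     closed_form m D E \<and> markov_form D E"

definition strongly_local :: "'a::t2_space measure \<Rightarrow> ('a \<Rightarrow> real) set \<Rightarrow>
    (('a \<Rightarrow> real) \<Rightarrow> ('a \<Rightarrow> real) \<Rightarrow> real) \<Rightarrow> bool" where
  "strongly_local m D E \<longleftrightarrow>
     (\<forall>u\<in>D. \<forall>v\<in>D.
        (\<exists>U c. open U \<and> ae_support m v \<subseteq> U \<and> (AE x in m. x \<in> U \<longrightarrow> u x = c)) \<longrightarrow> E u v = 0)"

definition regular_form :: "'a::t2_space measure \<Rightarrow> ('a \<Rightarrow> real) set \<Rightarrow>
    (('a \<Rightarrow> real) \<Rightarrow> ('a \<Rightarrow> real) \<Rightarrow> real) \<Rightarrow> bool" where
  "regular_form m D E \<longleftrightarrow>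
     (\<exists>A \<subseteq> D \<inter> C0.
        (\<forall>f\<in>C0. \<forall>\<epsilon>>0. \<exists>\<phi>\<in>A. \<forall>x. \<bar>f x - \<phi> x\<bar> < \<epsilon>) \<and>
        (\<forall>u\<in>D. \<forall>\<epsilon>>0. \<exists>\<phi>\<in>A. form_norm m E (\<lambda>x. u x - \<phi> x) < \<epsilon>))"

section \<open>Energy measures\<close>

text \<open>The values of \<open>\<Gamma>\<close> outside the domain of the form are irrelevant. The conditions determine
  \<open>\<Gamma> u v B\<close> for all \<open>u\<close>, \<open>v\<close> in the domain and all Borel sets \<open>B\<close>: for essentially bounded
  functions by the integral identity and regularity, and then in general by truncation, the
  Cauchy-Schwarz inequality and the identity for the total mass.\<close>

definition energy_measure :: "'a::t2_space measure \<Rightarrow> ('a \<Rightarrow> real) set \<Rightarrow>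
    (('a \<Rightarrow> real) \<Rightarrow> ('a \<Rightarrow> real) \<Rightarrow> real) \<Rightarrow>
    (('a \<Rightarrow> real) \<Rightarrow> ('a \<Rightarrow> real) \<Rightarrow> 'a set \<Rightarrow> real) \<Rightarrow> bool" where
  "energy_measure m D E \<Gamma> \<longleftrightarrow>
     (\<forall>u\<in>D. \<forall>v\<in>D. signed_radon_measure (\<Gamma> u v)) \<and>
     (\<forall>B\<in>sets borel. symmetric_form m D (\<lambda>u v. \<Gamma> u v B) \<and> (\<forall>u\<in>D. 0 \<le> \<Gamma> u u B)) \<and>
     (\<forall>u\<in>D. \<forall>v\<in>D. E u v = \<Gamma> u v UNIV) \<and>
     (\<forall>u\<in>D \<inter> ess_bounded m. \<forall>v\<in>D \<inter> ess_bounded m. \<forall>\<phi>\<in>D \<inter> C0.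
        signed_integral (\<Gamma> u v) \<phi> =
          1/2 * (E u (\<lambda>x. \<phi> x * v x) + E v (\<lambda>x. \<phi> x * u x) - E (\<lambda>x. u x * v x) \<phi>))"

definition D_loc ::
  "'a::t2_space measure \<Rightarrow> ('a \<Rightarrow> real) set \<Rightarrow> ('a \<Rightarrow> real) set" where
  "D_loc m D = {u \<in> L2_loc m.
     \<forall>K. relatively_compact K \<longrightarrow> (\<exists>w\<in>D. AE x in m. x \<in> K \<longrightarrow> u x = w x)}"

text \<open>For \<open>u\<close>, \<open>v\<close> in \<^const>\<open>D_loc\<close> the signed measure \<open>\<Gamma>(u,v)\<close> may have infinite total variation, so
  it is a set function on relatively compact Borel sets \<open>B\<close>. Its value at \<open>B\<close> is the common value
  of \<open>\<Gamma>(w,w')(B)\<close> over all \<open>w\<close>, \<open>w'\<close> in the domain that agree with \<open>u\<close>, \<open>v\<close> almost everywhere on some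
  relatively compact neighborhood of \<open>B\<close>. Openness of the neighborhood \<open>U\<close> is essential: \<open>\<Gamma>\<close> may
  charge \<open>m\<close>-null sets.\<close>

definition energy_loc :: "'a::t2_space measure \<Rightarrow> ('a \<Rightarrow> real) set \<Rightarrow>
    (('a \<Rightarrow> real) \<Rightarrow> ('a \<Rightarrow> real) \<Rightarrow> 'a set \<Rightarrow> real) \<Rightarrow>
    ('a \<Rightarrow> real) \<Rightarrow> ('a \<Rightarrow> real) \<Rightarrow> 'a set \<Rightarrow> real" where
  "energy_loc m D \<Gamma> u v B =
     (THE c. \<forall>U. \<forall>w\<in>D. \<forall>w'\<in>D.
        open U \<longrightarrow> relatively_compact U \<longrightarrow> B \<subseteq> U \<longrightarrow>
        (AE x in m. x \<in> U \<longrightarrow> u x = w x) \<longrightarrow> (AE x in m. x \<in> U \<longrightarrow> v x = w' x) \<longrightarrow>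
        \<Gamma> w w' B = c)"

text \<open>The diagonal \<open>\<Gamma>(u,u)\<close> is nonnegative, so it is a Borel measure, possibly of infinite mass.\<close>

definition energy_loc_measure :: "'a::t2_space measure \<Rightarrow> ('a \<Rightarrow> real) set \<Rightarrow>
    (('a \<Rightarrow> real) \<Rightarrow> ('a \<Rightarrow> real) \<Rightarrow> 'a set \<Rightarrow> real) \<Rightarrow> ('a \<Rightarrow> real) \<Rightarrow> 'a measure" where
  "energy_loc_measure m D \<Gamma> u =
     measure_of UNIV (sets borel)
       (\<lambda>B. SUP K\<in>{K. compact K}. ennreal (energy_loc m D \<Gamma> u u (B \<inter> K)))"

definition dominated_by ::
  "'a measure \<Rightarrow> 'a measure \<Rightarrow> ('a \<Rightarrow> ennreal) \<Rightarrow> bool" where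
  "dominated_by m \<mu> g \<longleftrightarrow> absolutely_continuous m \<mu> \<and> (AE x in m. RN_deriv m \<mu> x \<le> g x)"

section \<open>Intrinsic distance and Lipschitz functions\<close>

text \<open>The distance is allowed to be infinite. Since \<^const>\<open>ennreal\<close> truncates negative reals to 0 and
  the function 0 is admissible, the truncation does not affect the supremum.\<close>

definition intrinsic_dist :: "'a::t2_space measure \<Rightarrow> ('a \<Rightarrow> real) set \<Rightarrow>
    (('a \<Rightarrow> real) \<Rightarrow> ('a \<Rightarrow> real) \<Rightarrow> 'a set \<Rightarrow> real) \<Rightarrow> 'a \<Rightarrow> 'a \<Rightarrow> ennreal" where
  "intrinsic_dist m D \<Gamma> x y =
     (SUP u\<in>{u \<in> D_loc m D. continuous_on UNIV u \<and>
               dominated_by m (energy_loc_measure m D \<Gamma> u) (\<lambda>_. 1)}.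
        ennreal (u x - u y))"

definition dball :: "('a \<Rightarrow> 'a \<Rightarrow> ennreal) \<Rightarrow> 'a \<Rightarrow> real \<Rightarrow> 'a set" where
  "dball d x r = {y. d x y < ennreal r}"

definition induces_topology :: "('a::t2_space \<Rightarrow> 'a \<Rightarrow> ennreal) \<Rightarrow> bool" where
  "induces_topology d \<longleftrightarrow> (\<forall>U. open U \<longleftrightarrow> (\<forall>x\<in>U. \<exists>r>0. dball d x r \<subseteq> U))"

definition doubling :: "'a measure \<Rightarrow> ('a \<Rightarrow> 'a \<Rightarrow> ennreal) \<Rightarrow> bool" where
  "doubling m d \<longleftrightarrow>
     (\<exists>C>1. \<forall>x. \<forall>r>0.
        emeasure m (dball d x (2 * r)) \<le> ennreal C * emeasure m (dball d x r) \<and>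
        ennreal C * emeasure m (dball d x r) < \<infinity>)"

definition Lip :: "('a \<Rightarrow> 'a \<Rightarrow> ennreal) \<Rightarrow> ('a \<Rightarrow> real) set" where
  "Lip d = {u. (SUP (x, y)\<in>{(x, y). x \<noteq> y}. ennreal \<bar>u x - u y\<bar> / d x y) < \<infinity>}"

text \<open>The upper limit is over \<open>y \<noteq> x\<close>. It is 0 if \<open>x\<close> is an isolated point.\<close>

definition lip_const ::
  "('a::t2_space \<Rightarrow> 'a \<Rightarrow> ennreal) \<Rightarrow> ('a \<Rightarrow> real) \<Rightarrow> 'a \<Rightarrow> ennreal" where
  "lip_const d u x = Limsup (at x) (\<lambda>y. ennreal \<bar>u x - u y\<bar> / d x y)"

end

theory Submission
  imports Defs
begin

text \<open>
  The closedness of the form replaces the chain rule: functions in the domain that are bounded in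
  energy and converge in \<open>L\<^sup>2\<close> converge in the form norm after passing to convex combinations.
  Applied to truncations this shows that \<open>\<Gamma>(v,v)\<close> does not charge the zero set of a continuous
  function \<open>v\<close>, so the energy measures of two continuous functions agree on the set where the
  functions coincide. In particular the continuous functions \<open>f\<close> with \<open>\<Gamma>(f,f) \<le> c m\<close> form a
  lattice. By the definition of \<open>d\<close>, every \<open>L\<close>-Lipschitz function is interpolated at any two points by
  multiples of admissible functions, hence is by the Kakutani-Stone argument a locally uniform limit
  of functions with \<open>\<Gamma>(f,f) \<le> L\<^sup>2 m\<close>, and closedness carries the bound over to the limit.

  For the pointwise constant, fix \<open>l\<close> and \<open>r\<close> and consider the closed set of points \<open>x\<close> with
  \<open>\<bar>u(x) - u(y)\<bar> \<le> l d(x,y)\<close> whenever \<open>d(x,y) < r\<close>. On a piece of diameter less than \<open>r\<close> of this set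
  \<open>u\<close> coincides with its McShane extension, which is globally \<open>l\<close>-Lipschitz, so
  \<open>\<Gamma>(u,u) \<le> l\<^sup>2 m\<close> there. Countably many such pieces, with rational \<open>l\<close> tending to \<open>Lip u(x)\<close>, suffice.
\<close>

section \<open>Nonnegative quadratic forms\<close>

text \<open>The obstacle is that \<open>\<Gamma>\<close> is known only through an identity for
  bounded functions tested against \<open>D \<inter> C0\<close>, that elements of \<open>D\<close>
  are determined only up to null sets, and that \<open>\<Gamma>\<close> may charge
  \<open>m\<close>-null sets. Hence equality almost everywhere on a Borel set says nothing about
  energies there. Every comparison passes through an open set, where strong locality applies, or
  through continuous versions, whose coincidence is pointwise.

  Two facts make closedness usable. First, \<open>\<Gamma> u u B \<le> E u u\<close>, so convergence
  in the form norm controls all Borel sets at once. Second, for fixed \<open>B\<close> a bound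
  \<open>\<Gamma> v v B \<le> b\<close> is stable under midpoints, so it can be imposed on the
  approximants and survives convexification.

  A cutoff by multiplication would call for a Leibniz rule. The cutoff used here is the minimum with
  a multiple of a plateau function: on each of the two sets where one of the functions is the
  smaller, the minimum has the energy of that function.\<close>

definition nonneg_form ::
  "'a measure \<Rightarrow> ('a \<Rightarrow> real) set \<Rightarrow> (('a \<Rightarrow> real) \<Rightarrow> ('a \<Rightarrow> real) \<Rightarrow> real) \<Rightarrow> bool" where
  "nonneg_form m D F \<longleftrightarrow> symmetric_form m D F \<and> (\<forall>u\<in>D. 0 \<le> F u u)"

text \<open>The calculus of quadratic forms is done once for an arbitrary form because it is applied
  to \<open>E\<close>, to the \<open>L2\<close> product, to their sum, and to
  \<open>\<lambda>u v. \<Gamma> u v B\<close> for each fixed Borel set \<open>B\<close>.\<close>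

locale form_domain =
  fixes m :: "'a measure" and D :: "('a \<Rightarrow> real) set"
  assumes domain: "dense_L2_subspace m D"
begin

lemma D_measurable: "u \<in> D \<Longrightarrow> u \<in> borel_measurable m"
  and D_square_integrable: "u \<in> D \<Longrightarrow> integrable m (\<lambda>x. (u x)\<^sup>2)"
  and D_cong: "u \<in> D \<Longrightarrow> v \<in> borel_measurable m \<Longrightarrow> AE x in m. u x = v x \<Longrightarrow> v \<in> D"
  and D_zero: "(\<lambda>x. 0) \<in> D"
  and D_add: "u \<in> D \<Longrightarrow> v \<in> D \<Longrightarrow> (\<lambda>x. u x + v x) \<in> D"
  and D_scale: "u \<in> D \<Longrightarrow> (\<lambda>x. c * u x) \<in> D"
  using domain unfolding dense_L2_subspace_def L2_def by blast+

lemma D_lin: "u \<in> D \<Longrightarrow> v \<in> D \<Longrightarrow> (\<lambda>x. a * u x + b * v x) \<in> D"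
  by (simp add: D_add D_scale)

lemma D_minus: "u \<in> D \<Longrightarrow> (\<lambda>x. - u x) \<in> D"
  using D_scale[of u "-1"] by simp

lemma D_diff: "u \<in> D \<Longrightarrow> v \<in> D \<Longrightarrow> (\<lambda>x. u x - v x) \<in> D"
  using D_lin[of u v 1 "-1"] by simp

lemma D_mid: "u \<in> D \<Longrightarrow> v \<in> D \<Longrightarrow> (\<lambda>x. (u x + v x) / 2) \<in> D"
  using D_lin[of u v "1/2" "1/2"] by (simp add: field_simps)

lemma D_mult_integrable:
  assumes "u \<in> D" "v \<in> D" shows "integrable m (\<lambda>x. u x * v x)"
proof (rule Bochner_Integration.integrable_bound)
  show "integrable m (\<lambda>x. (u x)\<^sup>2 + (v x)\<^sup>2)"
    using assms by (simp add: D_square_integrable)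
  show "(\<lambda>x. u x * v x) \<in> borel_measurable m"
    using assms by (intro borel_measurable_times D_measurable)
  have "\<bar>a * b\<bar> \<le> a\<^sup>2 + b\<^sup>2" for a b :: real
    using sum_squares_bound[of "\<bar>a\<bar>" "\<bar>b\<bar>"] abs_ge_zero[of "a * b"] abs_mult[of a b]
    unfolding power2_abs by linarith
  then show "AE x in m. norm (u x * v x) \<le> norm ((u x)\<^sup>2 + (v x)\<^sup>2)"
    by simp
qed

lemma form_add_left: "nonneg_form m D F \<Longrightarrow> u \<in> D \<Longrightarrow> u' \<in> D \<Longrightarrow> v \<in> D \<Longrightarrow>
    F (\<lambda>x. u x + u' x) v = F u v + F u' v"
  and form_scale_left: "nonneg_form m D F \<Longrightarrow> u \<in> D \<Longrightarrow> v \<in> D \<Longrightarrow> F (\<lambda>x. c * u x) v = c * F u v"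
  and form_sym: "nonneg_form m D F \<Longrightarrow> u \<in> D \<Longrightarrow> v \<in> D \<Longrightarrow> F u v = F v u"
  and form_nonneg: "nonneg_form m D F \<Longrightarrow> u \<in> D \<Longrightarrow> 0 \<le> F u u"
  and form_cong_left: "nonneg_form m D F \<Longrightarrow> u \<in> D \<Longrightarrow> u' \<in> D \<Longrightarrow> v \<in> D \<Longrightarrow>
    AE x in m. u x = u' x \<Longrightarrow> F u v = F u' v"
  unfolding nonneg_form_def symmetric_form_def by blast+

lemma form_cong:
  assumes F: "nonneg_form m D F" and "u \<in> D" "u' \<in> D" "v \<in> D" "v' \<in> D"
    and "AE x in m. u x = u' x" "AE x in m. v x = v' x"
  shows "F u v = F u' v'"
proof -
  have "F u v = F u' v" by (rule form_cong_left[OF F]) (use assms in auto)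
  also have "\<dots> = F v u'" by (rule form_sym[OF F]) (use assms in auto)
  also have "\<dots> = F v' u'" by (rule form_cong_left[OF F]) (use assms in auto)
  also have "\<dots> = F u' v'" by (rule form_sym[OF F]) (use assms in auto)
  finally show ?thesis .
qed

lemma form_zero_right: "nonneg_form m D F \<Longrightarrow> u \<in> D \<Longrightarrow> F u (\<lambda>x. 0) = 0"
  using form_scale_left[of F "\<lambda>x. 0" u 0] form_sym[of F u "\<lambda>x. 0"] D_zero by simp

lemma form_lin:
  assumes F: "nonneg_form m D F" and "u \<in> D" "v \<in> D"
  shows "F (\<lambda>x. a * u x + b * v x) (\<lambda>x. a * u x + b * v x)
    = a\<^sup>2 * F u u + 2 * a * b * F u v + b\<^sup>2 * F v v"
proof -
  let ?w = "\<lambda>x. a * u x + b * v x"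
  have D: "?w \<in> D" "(\<lambda>x. a * u x) \<in> D" "(\<lambda>x. b * v x) \<in> D"
    using assms by (auto intro: D_lin D_scale)
  have left: "F ?w z = a * F u z + b * F v z" if "z \<in> D" for z
    using form_add_left[OF F D(2,3) that] form_scale_left[OF F] assms that by simp
  have "F ?w ?w = a * F ?w u + b * F ?w v"
    using left[OF D(1)] form_sym[OF F] assms D by simp
  also have "\<dots> = a * (a * F u u + b * F v u) + b * (a * F u v + b * F v v)"
    using left assms by simp
  finally show ?thesis
    using form_sym[OF F assms(2,3)] by (simp add: power2_eq_square algebra_simps)
qed

lemma form_scale:
  assumes F: "nonneg_form m D F" and "u \<in> D"
  shows "F (\<lambda>x. c * u x) (\<lambda>x. c * u x) = c\<^sup>2 * F u u"
  using form_lin[OF F assms(2,2), of c 0] by simp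

lemma form_minus:
  assumes F: "nonneg_form m D F" and "u \<in> D"
  shows "F (\<lambda>x. - u x) (\<lambda>x. - u x) = F u u"
  using form_scale[OF F assms(2), of "-1"] by simp

lemma form_add_le:
  assumes F: "nonneg_form m D F" and "u \<in> D" "v \<in> D"
  shows "F (\<lambda>x. u x + v x) (\<lambda>x. u x + v x) \<le> 2 * F u u + 2 * F v v"
  using form_lin[OF F assms(2,3), of 1 1] form_lin[OF F assms(2,3), of 1 "-1"]
    form_nonneg[OF F D_lin[OF assms(2,3), of 1 "-1"]] by simp

lemma form_diff_le:
  assumes F: "nonneg_form m D F" and "u \<in> D" "v \<in> D"
  shows "F (\<lambda>x. u x - v x) (\<lambda>x. u x - v x) \<le> 2 * F u u + 2 * F v v"
  using form_add_le[OF F assms(2) D_minus[OF assms(3)]] form_minus[OF F assms(3)] by simp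

lemma form_parallelogram:
  assumes F: "nonneg_form m D F" and "u \<in> D" "v \<in> D"
  shows "F (\<lambda>x. u x - v x) (\<lambda>x. u x - v x)
    = 2 * F u u + 2 * F v v - 4 * F (\<lambda>x. (u x + v x) / 2) (\<lambda>x. (u x + v x) / 2)"
  using form_lin[OF F assms(2,3), of "1/2" "1/2"] form_lin[OF F assms(2,3), of 1 "-1"]
  by (simp add: add_divide_distrib power2_eq_square)

lemma form_mid_le:
  assumes F: "nonneg_form m D F" and "u \<in> D" "v \<in> D"
  shows "F (\<lambda>x. (u x + v x) / 2) (\<lambda>x. (u x + v x) / 2) \<le> (F u u + F v v) / 2"
  using form_parallelogram[OF assms] form_nonneg[OF F D_diff[OF assms(2,3)]] by simp

lemma form_Cauchy_Schwarz:
  assumes F: "nonneg_form m D F" and "u \<in> D" "v \<in> D"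
  shows "(F u v)\<^sup>2 \<le> F u u * F v v"
proof (cases "F v v = 0")
  case True
  \<comment> \<open>With \<open>F v v = 0\<close> the form at \<open>u + b v\<close> is affine in
    \<open>b\<close>; since it is nonnegative for every \<open>b\<close>, its slope
    vanishes.\<close>
  have ineq: "0 \<le> F u u + 2 * b * F u v" for b
    using form_nonneg[OF F D_lin[OF assms(2,3), of 1 b]] form_lin[OF F assms(2,3), of 1 b] True
    by simp
  have "F u v = 0"
  proof (rule ccontr)
    assume nz: "F u v \<noteq> 0"
    have "2 * (- (F u u + 1) / (2 * F u v)) * F u v = - (F u u + 1)" using nz by simp
    then show False
      using ineq[of "- (F u u + 1) / (2 * F u v)"] by linarith
  qed
  then show ?thesis using True by simp
next
  case False
  then have pos: "F v v > 0" using form_nonneg[OF F assms(3)] by simp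
  have "0 \<le> (F v v)\<^sup>2 * F u u - 2 * F v v * F u v * F u v + (F u v)\<^sup>2 * F v v"
    using form_nonneg[OF F D_lin[OF assms(2,3), of "F v v" "- F u v"]]
      form_lin[OF F assms(2,3), of "F v v" "- F u v"] by simp
  then have "0 \<le> F v v * (F v v * F u u - (F u v)\<^sup>2)"
    by (simp add: power2_eq_square algebra_simps)
  then have "0 \<le> F v v * F u u - (F u v)\<^sup>2"
    using pos by (simp add: zero_le_mult_iff)
  then show ?thesis by (simp add: mult.commute)
qed

lemma form_triangle:
  assumes F: "nonneg_form m D F" and "u \<in> D" "v \<in> D"
  shows "sqrt (F (\<lambda>x. u x + v x) (\<lambda>x. u x + v x)) \<le> sqrt (F u u) + sqrt (F v v)"
proof (rule real_le_lsqrt)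
  have "F u v \<le> sqrt (F u u * F v v)"
    using form_Cauchy_Schwarz[OF assms] by (simp add: real_le_rsqrt)
  then show "F (\<lambda>x. u x + v x) (\<lambda>x. u x + v x) \<le> (sqrt (F u u) + sqrt (F v v))\<^sup>2"
    using form_lin[OF assms, of 1 1] form_nonneg[OF F assms(2)] form_nonneg[OF F assms(3)]
    by (simp add: power2_sum real_sqrt_mult)
qed (use form_nonneg[OF F] assms in auto)

text \<open>By Cauchy-Schwarz a null vector is orthogonal to everything. This is the way energies on
  a Borel set get compared: it is enough that the difference has no energy there.\<close>

lemma form_eq_of_null_diff:
  assumes F: "nonneg_form m D F" and "u \<in> D" "v \<in> D"
    and null: "F (\<lambda>x. u x - v x) (\<lambda>x. u x - v x) = 0"
  shows "F u u = F v v"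
proof -
  let ?d = "\<lambda>x. u x - v x"
  have d: "?d \<in> D" using assms by (intro D_diff)
  have "F v ?d = 0"
    using form_Cauchy_Schwarz[OF F assms(3) d] null by simp
  then show ?thesis
    using form_lin[OF F assms(3) d, of 1 1] null by simp
qed

lemma form_null_right:
  assumes F: "nonneg_form m D F" and "u \<in> D" "v \<in> D" and "F v v = 0"
  shows "F u v = 0"
  using form_Cauchy_Schwarz[OF F assms(2,3)] assms(4) by simp

lemma L2_form: "nonneg_form m D (\<lambda>u v. \<integral>x. u x * v x \<partial>m)"
  unfolding nonneg_form_def symmetric_form_def
proof (intro conjI ballI allI impI)
  fix u u' v assume "u \<in> D" "u' \<in> D" "v \<in> D"
  show "(\<integral>x. u x * v x \<partial>m) = (\<integral>x. u' x * v x \<partial>m)" if "AE x in m. u x = u' x"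
    using that \<open>u \<in> D\<close> \<open>u' \<in> D\<close> \<open>v \<in> D\<close>
    by (intro integral_cong_AE borel_measurable_times D_measurable) auto
  show "(\<integral>x. (u x + u' x) * v x \<partial>m) = (\<integral>x. u x * v x \<partial>m) + (\<integral>x. u' x * v x \<partial>m)"
    using \<open>u \<in> D\<close> \<open>u' \<in> D\<close> \<open>v \<in> D\<close> by (simp add: distrib_right D_mult_integrable)
qed (simp_all add: mult.commute mult.left_commute)

lemma form_sum:
  assumes F: "nonneg_form m D F" and G: "nonneg_form m D G"
  shows "nonneg_form m D (\<lambda>u v. F u v + G u v)"
  unfolding nonneg_form_def symmetric_form_def
proof (intro conjI ballI allI impI)
  fix u u' v c assume D: "u \<in> D" "u' \<in> D" "v \<in> D"
  show "F u v + G u v = F u' v + G u' v" if "AE x in m. u x = u' x"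
    using form_cong_left[OF F D that] form_cong_left[OF G D that] by simp
  show "F u v + G u v = F v u + G v u"
    using form_sym[OF F D(1,3)] form_sym[OF G D(1,3)] by simp
  show "F (\<lambda>x. u x + u' x) v + G (\<lambda>x. u x + u' x) v = F u v + G u v + (F u' v + G u' v)"
    using form_add_left[OF F D] form_add_left[OF G D] by simp
  show "F (\<lambda>x. c * u x) v + G (\<lambda>x. c * u x) v = c * (F u v + G u v)"
    using form_scale_left[OF F D(1,3)] form_scale_left[OF G D(1,3)] by (simp add: distrib_left)
  show "0 \<le> F u u + G u u"
    using form_nonneg[OF F D(1)] form_nonneg[OF G D(1)] by simp
qed

end

section \<open>Completeness of the form norm and limits of functions bounded in energy\<close>

locale dirichlet = form_domain m D for m :: "'a measure" and D +
  fixes E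
  assumes dirichlet: "dirichlet_form m D E"
begin

lemma E_form: "nonneg_form m D E"
  using dirichlet unfolding dirichlet_form_def nonneg_form_def by blast

definition E1 :: "('a \<Rightarrow> real) \<Rightarrow> ('a \<Rightarrow> real) \<Rightarrow> real" where
  "E1 u v = (\<integral>x. u x * v x \<partial>m) + E u v"

lemma E1_form: "nonneg_form m D E1"
  unfolding E1_def using form_sum[OF L2_form E_form] .

lemma form_norm_E1: "form_norm m E u = sqrt (E1 u u)"
  by (simp add: form_norm_def E1_def power2_eq_square)

lemma E_le_E1: "E u u \<le> E1 u u"
  by (simp add: E1_def)

lemma L2_le_E1: "u \<in> D \<Longrightarrow> (\<integral>x. (u x)\<^sup>2 \<partial>m) \<le> E1 u u"
  using form_nonneg[OF E_form] by (simp add: E1_def power2_eq_square)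

text \<open>The argument for the projection onto a convex set, run along a decreasing sequence of
  sets. The least norms \<open>a n\<close> increase and stay below \<open>B\<close>, so they
  converge, and the parallelogram identity turns this into the Cauchy property. The sets need not be
  closed, and the limit is not claimed to lie in them.\<close>

lemma minimizing_sequence_Cauchy:
  fixes C :: "nat \<Rightarrow> ('a \<Rightarrow> real) set"
  assumes CD: "\<And>n. C n \<subseteq> D" and dec: "\<And>n k. n \<le> k \<Longrightarrow> C k \<subseteq> C n"
    and mid: "\<And>n u v. u \<in> C n \<Longrightarrow> v \<in> C n \<Longrightarrow> (\<lambda>x. (u x + v x) / 2) \<in> C n"
    and bdd: "\<And>n. \<exists>v\<in>C n. E1 v v \<le> B"
  obtains v u where "\<And>n. v n \<in> C n" "u \<in> D" "(\<lambda>n. E1 (\<lambda>x. v n x - u x) (\<lambda>x. v n x - u x)) \<longlonglongrightarrow> 0"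
proof -
  define q where "q = (\<lambda>u. E1 u u)"
  define a where "a n = Inf (q ` C n)" for n
  define b where "b n = 1 / real (Suc n)" for n
  have q0: "0 \<le> q u" if "u \<in> D" for u
    using form_nonneg[OF E1_form that] by (simp add: q_def)
  have below: "bdd_below (q ` C n)" for n
    using q0 CD by (intro bdd_belowI2[of _ 0]) blast
  have ne: "q ` C n \<noteq> {}" for n using bdd[of n] by auto
  have a_le: "a n \<le> q v" if "v \<in> C n" for n v
    unfolding a_def using below that by (intro cInf_lower) auto
  have "incseq a"
    unfolding incseq_def a_def using dec ne below by (intro allI impI cInf_superset_mono) auto
  moreover have "a n \<le> B" for n
    using bdd[of n] a_le[of _ n] by (force simp: q_def)
  ultimately have conv: "convergent a"
    by (meson incseq_convergent convergent_def)
  have "\<exists>v. v \<in> C n \<and> q v < a n + b n" for n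
  proof -
    have "Inf (q ` C n) < a n + b n" by (simp add: a_def b_def)
    from cInf_lessD[OF ne this] show ?thesis by blast
  qed
  then obtain v where v: "\<And>n. v n \<in> C n" "\<And>n. q (v n) < a n + b n" by metis
  have vD: "v n \<in> D" for n using v(1) CD by blast
  \<comment> \<open>The midpoint of \<open>v i\<close> and \<open>v j\<close> lies in the larger set
    \<open>C i\<close>, so its norm cannot fall below \<open>a i\<close>.\<close>
  have key: "q (\<lambda>x. v i x - v j x) \<le> 2 * (a j - a i) + 4 * b i" if "i \<le> j" for i j
  proof -
    have "a i \<le> q (\<lambda>x. (v i x + v j x) / 2)"
      using a_le mid v(1) dec[OF that] by blast
    moreover have "q (\<lambda>x. v i x - v j x)
        = 2 * q (v i) + 2 * q (v j) - 4 * q (\<lambda>x. (v i x + v j x) / 2)"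
      unfolding q_def by (rule form_parallelogram[OF E1_form vD vD])
    moreover have "b j \<le> b i"
      using that by (simp add: b_def frac_le)
    moreover have "X \<le> 2 * (aj - ai) + 4 * bi"
      if "ai \<le> M" "X = 2 * P + 2 * R - 4 * M" "bj \<le> bi" "P < ai + bi" "R < aj + bj"
      for ai aj bi bj M X P R :: real
      using that by argo
    ultimately show ?thesis
      using v(2)[of i] v(2)[of j] by blast
  qed
  have "\<exists>N. \<forall>i\<ge>N. \<forall>j\<ge>N. form_norm m E (\<lambda>x. v i x - v j x) < \<epsilon>" if "\<epsilon> > 0" for \<epsilon>
  proof -
    \<comment> \<open>The thresholds fit \<open>key\<close>: \<open>2 * \<epsilon>\<^sup>2 / 4 + 4 *
      \<epsilon>\<^sup>2 / 8 = \<epsilon>\<^sup>2\<close>.\<close>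
    have e2: "\<epsilon>\<^sup>2 / 4 > 0" using that by simp
    obtain N1 where N1: "\<And>i j. i \<ge> N1 \<Longrightarrow> j \<ge> N1 \<Longrightarrow> dist (a i) (a j) < \<epsilon>\<^sup>2 / 4"
      using metric_CauchyD[OF convergent_Cauchy[OF conv] e2] by blast
    have "\<epsilon>\<^sup>2 / 8 > 0" using that by simp
    then obtain N2 where N2: "b N2 < \<epsilon>\<^sup>2 / 8"
      unfolding b_def by (rule nat_approx_posE)
    have *: "form_norm m E (\<lambda>x. v i x - v j x) < \<epsilon>" if "i \<ge> max N1 N2" "i \<le> j" for i j
    proof -
      have "b i \<le> b N2" using that by (simp add: b_def frac_le)
      moreover have "a j - a i < \<epsilon>\<^sup>2 / 4" using N1[of i j] that by (simp add: dist_real_def abs_if split: if_splits)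
      ultimately have "q (\<lambda>x. v i x - v j x) < \<epsilon>\<^sup>2"
        using key[OF that(2)] N2 by simp
      then show ?thesis
        using \<open>\<epsilon> > 0\<close> by (simp add: form_norm_E1 q_def real_less_lsqrt)
    qed
    have sym: "form_norm m E (\<lambda>x. v i x - v j x) = form_norm m E (\<lambda>x. v j x - v i x)" for i j
      using form_minus[OF E1_form D_diff[OF vD[of i] vD[of j]]] by (simp add: form_norm_E1)
    show ?thesis
      using * sym by (metis linorder_le_cases order_trans)
  qed
  then obtain u where u: "u \<in> D" "(\<lambda>n. form_norm m E (\<lambda>x. v n x - u x)) \<longlonglongrightarrow> 0"
    using dirichlet vD unfolding dirichlet_form_def closed_form_def by blast
  have "(\<lambda>n. (form_norm m E (\<lambda>x. v n x - u x))\<^sup>2) \<longlonglongrightarrow> 0"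
    using tendsto_power[OF u(2), of 2] by simp
  moreover have "(form_norm m E (\<lambda>x. v n x - u x))\<^sup>2 = E1 (\<lambda>x. v n x - u x) (\<lambda>x. v n x - u x)" for n
    using form_nonneg[OF E1_form D_diff[OF vD u(1)]] by (simp add: form_norm_E1)
  ultimately show ?thesis using that[of v u] v(1) u(1) by simp
qed

lemma square_diff_le: "(a - b)\<^sup>2 \<le> 2 * (a - c)\<^sup>2 + 2 * (c - b)\<^sup>2" for a b c :: real
proof -
  have "0 \<le> ((a - c) - (c - b))\<^sup>2" by simp
  then show ?thesis by (simp add: power2_eq_square algebra_simps)
qed

text \<open>Elements of almost least norm play the role of the convex combinations in Mazur's lemma, so the
  weak compactness of bounded sets in \<open>D\<close> is not needed. The predicate \<open>P\<close> stands for a convex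
  condition that the approximants share.\<close>

lemma closure_of_bounded:
  assumes w: "w \<in> borel_measurable m" "integrable m (\<lambda>x. (w x)\<^sup>2)"
    and mid: "\<And>u v. u \<in> D \<Longrightarrow> v \<in> D \<Longrightarrow> P u \<Longrightarrow> P v \<Longrightarrow> P (\<lambda>x. (u x + v x) / 2)"
    and approx: "\<And>\<epsilon>. \<epsilon> > 0 \<Longrightarrow> \<exists>v\<in>D. P v \<and> (\<integral>x. (v x - w x)\<^sup>2 \<partial>m) \<le> \<epsilon> \<and> E v v \<le> B"
  shows "w \<in> D" "\<epsilon> > 0 \<Longrightarrow> \<exists>v\<in>D. P v \<and> E1 (\<lambda>x. v x - w x) (\<lambda>x. v x - w x) < \<epsilon>"
proof -
  define r where "r v = (\<integral>x. (v x - w x)\<^sup>2 \<partial>m)" for v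
  \<comment> \<open>These sets shrink towards \<open>w\<close> in \<open>L2\<close>, which pins down
    the limit of the minimizing sequence although nothing is yet known about the form at
    \<open>w\<close>.\<close>
  define C where "C n = {v \<in> D. P v \<and> r v \<le> 1 / real (Suc n)}" for n
  have int: "integrable m (\<lambda>x. (v x - w x)\<^sup>2)" if "v \<in> D" for v
  proof (rule Bochner_Integration.integrable_bound)
    show "integrable m (\<lambda>x. 2 * (v x)\<^sup>2 + 2 * (w x)\<^sup>2)"
      using w that by (simp add: D_square_integrable)
    show "(\<lambda>x. (v x - w x)\<^sup>2) \<in> borel_measurable m"
      using w D_measurable[OF that] by measurable
    have "(v x - w x)\<^sup>2 \<le> 2 * (v x)\<^sup>2 + 2 * (w x)\<^sup>2" for x
      using square_diff_le[of "v x" "w x" 0] by simp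
    then show "AE x in m. norm ((v x - w x)\<^sup>2) \<le> norm (2 * (v x)\<^sup>2 + 2 * (w x)\<^sup>2)"
      by simp
  qed
  have mid_r: "r (\<lambda>x. (u x + v x) / 2) \<le> c" if "u \<in> D" "v \<in> D" "r u \<le> c" "r v \<le> c" for u v c
  proof -
    have "r (\<lambda>x. (u x + v x) / 2) \<le> (\<integral>x. ((u x - w x)\<^sup>2 + (v x - w x)\<^sup>2) / 2 \<partial>m)"
      unfolding r_def
    proof (rule integral_mono)
      have "((a + b) / 2 - c)\<^sup>2 \<le> ((a - c)\<^sup>2 + (b - c)\<^sup>2) / 2" for a b c :: real
      proof -
        have "0 \<le> (a - b)\<^sup>2" by simp
        then show ?thesis by (simp add: power2_eq_square field_simps)
      qed
      then show "((u x + v x) / 2 - w x)\<^sup>2 \<le> ((u x - w x)\<^sup>2 + (v x - w x)\<^sup>2) / 2" for x .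
      show "integrable m (\<lambda>x. ((u x + v x) / 2 - w x)\<^sup>2)"
        by (intro int D_mid that)
      show "integrable m (\<lambda>x. ((u x - w x)\<^sup>2 + (v x - w x)\<^sup>2) / 2)"
        by (intro Bochner_Integration.integrable_add integrable_divide int that)
    qed
    also have "\<dots> = (r u + r v) / 2"
      using int that by (simp add: r_def)
    finally show ?thesis using that by simp
  qed
  have CD: "C n \<subseteq> D" for n by (auto simp: C_def)
  have dec: "C k \<subseteq> C n" if "n \<le> k" for n k
  proof -
    have "1 / real (Suc k) \<le> 1 / real (Suc n)" using that by (simp add: frac_le)
    then show ?thesis by (auto simp: C_def)
  qed
  have midC: "(\<lambda>x. (u x + v x) / 2) \<in> C n" if "u \<in> C n" "v \<in> C n" for n u v
    using that by (auto simp: C_def intro: D_mid mid mid_r)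
  have bddC: "\<exists>v\<in>C n. E1 v v \<le> 2 + 2 * (\<integral>x. (w x)\<^sup>2 \<partial>m) + B" for n
  proof -
    obtain v where v: "v \<in> D" "P v" "r v \<le> 1 / real (Suc n)" "E v v \<le> B"
      using approx[of "1 / real (Suc n)"] by (auto simp: r_def)
    have "(\<integral>x. (v x)\<^sup>2 \<partial>m) \<le> (\<integral>x. 2 * (v x - w x)\<^sup>2 + 2 * (w x)\<^sup>2 \<partial>m)"
    proof (rule integral_mono)
      show "(v x)\<^sup>2 \<le> 2 * (v x - w x)\<^sup>2 + 2 * (w x)\<^sup>2" for x
        using square_diff_le[of "v x" 0 "w x"] by simp
      show "integrable m (\<lambda>x. 2 * (v x - w x)\<^sup>2 + 2 * (w x)\<^sup>2)"
        by (intro Bochner_Integration.integrable_add integrable_mult_right int v(1) w(2))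
    qed (rule D_square_integrable[OF v(1)])
    also have "\<dots> = 2 * r v + 2 * (\<integral>x. (w x)\<^sup>2 \<partial>m)"
      using int[OF v(1)] w by (simp add: r_def)
    also have "r v \<le> 1" using v(3) by (rule order_trans) simp
    finally have "(\<integral>x. (v x)\<^sup>2 \<partial>m) \<le> 2 + 2 * (\<integral>x. (w x)\<^sup>2 \<partial>m)" by simp
    then show ?thesis
      using v by (intro bexI[of _ v]) (auto simp: C_def E1_def power2_eq_square)
  qed
  obtain v u where vu: "\<And>n. v n \<in> C n" "u \<in> D"
    "(\<lambda>n. E1 (\<lambda>x. v n x - u x) (\<lambda>x. v n x - u x)) \<longlonglongrightarrow> 0"
    by (rule minimizing_sequence_Cauchy[of C, OF CD dec midC bddC]) (assumption | rule that)+
  have vD: "v n \<in> D" for n using vu(1) CD by blast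
  \<comment> \<open>Form convergence implies \<open>L2\<close> convergence, so \<open>v n\<close>
    tends both to \<open>u\<close> and to \<open>w\<close> in \<open>L2\<close>.\<close>
  have uw: "r u \<le> 0"
  proof (rule LIMSEQ_le_const)
    show "(\<lambda>n. 2 * E1 (\<lambda>x. v n x - u x) (\<lambda>x. v n x - u x) + 2 * (1 / real (Suc n))) \<longlonglongrightarrow> 0"
      using tendsto_add[OF tendsto_mult_left[OF vu(3), of 2]
          tendsto_mult_left[OF LIMSEQ_Suc[OF lim_1_over_n], of 2]] by simp
    have "r u \<le> 2 * E1 (\<lambda>x. v n x - u x) (\<lambda>x. v n x - u x) + 2 * (1 / real (Suc n))" for n
    proof -
      have "r u \<le> (\<integral>x. 2 * (v n x - u x)\<^sup>2 + 2 * (v n x - w x)\<^sup>2 \<partial>m)"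
        unfolding r_def
      proof (rule integral_mono)
        show "(u x - w x)\<^sup>2 \<le> 2 * (v n x - u x)\<^sup>2 + 2 * (v n x - w x)\<^sup>2" for x
          using square_diff_le[of "u x" "w x" "v n x"] by (simp add: power2_commute)
        show "integrable m (\<lambda>x. 2 * (v n x - u x)\<^sup>2 + 2 * (v n x - w x)\<^sup>2)"
          by (intro Bochner_Integration.integrable_add integrable_mult_right int vD
              D_square_integrable D_diff vu(2))
      qed (rule int[OF vu(2)])
      also have "\<dots> = 2 * (\<integral>x. (v n x - u x)\<^sup>2 \<partial>m) + 2 * r (v n)"
        using int[OF vD] D_square_integrable[OF D_diff[OF vD vu(2)]] by (simp add: r_def)
      also have "\<dots> \<le> 2 * E1 (\<lambda>x. v n x - u x) (\<lambda>x. v n x - u x) + 2 * (1 / real (Suc n))"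
        using L2_le_E1[OF D_diff[OF vD vu(2)]] vu(1)[of n]
        by (intro add_mono mult_left_mono) (auto simp: C_def)
      finally show ?thesis .
    qed
    then show "\<exists>N. \<forall>n\<ge>N. r u \<le> 2 * E1 (\<lambda>x. v n x - u x) (\<lambda>x. v n x - u x) + 2 * (1 / real (Suc n))"
      by blast
  qed
  then have "(\<integral>x. (u x - w x)\<^sup>2 \<partial>m) = 0"
    unfolding r_def by (simp add: order_antisym)
  then have ae: "AE x in m. u x = w x"
    using integral_nonneg_eq_0_iff_AE[OF int[OF vu(2)]] by auto
  then show wD: "w \<in> D"
    using D_cong[OF vu(2) w(1)] by blast
  assume "\<epsilon> > 0"
  have "eventually (\<lambda>n. E1 (\<lambda>x. v n x - u x) (\<lambda>x. v n x - u x) < \<epsilon>) sequentially"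
    using order_tendstoD(2)[OF vu(3) \<open>\<epsilon> > 0\<close>] .
  then obtain n where n: "E1 (\<lambda>x. v n x - u x) (\<lambda>x. v n x - u x) < \<epsilon>"
    by (auto simp: eventually_sequentially)
  moreover have "E1 (\<lambda>x. v n x - u x) (\<lambda>x. v n x - u x) = E1 (\<lambda>x. v n x - w x) (\<lambda>x. v n x - w x)"
    using ae by (intro form_cong[OF E1_form] D_diff vD vu(2) wD) auto
  ultimately show "\<exists>v\<in>D. P v \<and> E1 (\<lambda>x. v x - w x) (\<lambda>x. v x - w x) < \<epsilon>"
    using vu(1)[of n] by (intro bexI[of _ "v n"]) (auto simp: C_def)
qed

end

section \<open>Lattice operations and products in the domain\<close>

text \<open>The function \<open>s\<^sup>2 - (max (s - t) 0)\<^sup>2\<close> is twice the integral of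
  \<open>min t\<close> over the interval from 0 to \<open>s\<close>. Its increment over a step of
  length \<open>\<delta>\<close> lies between the values of the increasing integrand at the two
  ends, times \<open>2 * \<delta>\<close>.\<close>

lemma min_sum_step:
  fixes s t \<delta> :: real
  assumes "0 \<le> t" "0 \<le> s" "0 \<le> \<delta>"
  shows "2 * \<delta> * min t s \<le> ((s + \<delta>)\<^sup>2 - (max (s + \<delta> - t) 0)\<^sup>2) - (s\<^sup>2 - (max (s - t) 0)\<^sup>2)"
    and "((s + \<delta>)\<^sup>2 - (max (s + \<delta> - t) 0)\<^sup>2) - (s\<^sup>2 - (max (s - t) 0)\<^sup>2) \<le> 2 * \<delta> * min t (s + \<delta>)"
proof -
  consider "t \<ge> s + \<delta>" | "s \<le> t" "t < s + \<delta>" | "t < s" by linarith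
  then have "2 * \<delta> * min t s \<le> ((s + \<delta>)\<^sup>2 - (max (s + \<delta> - t) 0)\<^sup>2) - (s\<^sup>2 - (max (s - t) 0)\<^sup>2)
    \<and> ((s + \<delta>)\<^sup>2 - (max (s + \<delta> - t) 0)\<^sup>2) - (s\<^sup>2 - (max (s - t) 0)\<^sup>2) \<le> 2 * \<delta> * min t (s + \<delta>)"
  proof cases
    case 1
    then have "max (s + \<delta> - t) 0 = 0" "max (s - t) 0 = 0" "min t s = s" "min t (s + \<delta>) = s + \<delta>"
      using assms by auto
    then show ?thesis using assms by (simp add: power2_eq_square algebra_simps)
  next
    case 2
    then have eq: "max (s + \<delta> - t) 0 = s + \<delta> - t" "max (s - t) 0 = 0" "min t s = s" "min t (s + \<delta>) = t"
      by auto
    define a where "a = t - s"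
    have a: "0 \<le> a" "a \<le> \<delta>" "t = s + a" using 2 by (auto simp: a_def)
    have "a * a \<le> \<delta> * a" using a by (intro mult_right_mono) auto
    moreover have "0 \<le> \<delta> * a" "0 \<le> a * a" using a assms(3) by auto
    ultimately have "2 * (\<delta> * s) \<le> 2 * (\<delta> * s) + 2 * (\<delta> * a) - a * a"
      "2 * (\<delta> * s) + 2 * (\<delta> * a) - a * a \<le> 2 * (\<delta> * s) + 2 * (\<delta> * a)" by linarith+
    then show ?thesis unfolding eq unfolding a(3) by (simp add: power2_eq_square algebra_simps)
  next
    case 3
    then have eq: "max (s + \<delta> - t) 0 = s + \<delta> - t" "max (s - t) 0 = s - t" "min t s = t" "min t (s + \<delta>) = t"
      using assms by auto
    show ?thesis unfolding eq by (simp add: power2_eq_square algebra_simps)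
  qed
  then show "2 * \<delta> * min t s \<le> ((s + \<delta>)\<^sup>2 - (max (s + \<delta> - t) 0)\<^sup>2) - (s\<^sup>2 - (max (s - t) 0)\<^sup>2)"
    and "((s + \<delta>)\<^sup>2 - (max (s + \<delta> - t) 0)\<^sup>2) - (s\<^sup>2 - (max (s - t) 0)\<^sup>2) \<le> 2 * \<delta> * min t (s + \<delta>)"
    by blast+
qed

text \<open>A right-endpoint Riemann sum, whose excess over the integral telescopes. The error is
  proportional to \<open>t\<close> and not merely small, so that it stays square integrable after
  substituting a function in \<open>L2\<close>, even when \<open>m\<close> is infinite.\<close>

lemma square_approx_by_min:
  fixes t :: real
  assumes t: "0 \<le> t" "t \<le> 1" and n: "n > 0"
  shows "\<bar>2 * t - 2 / real n * (\<Sum>k<n. min t (real (Suc k) / real n)) - t\<^sup>2\<bar> \<le> 2 * t / real n"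
proof -
  define \<delta> where "\<delta> = 1 / real n"
  define h where "h s = s\<^sup>2 - (max (s - t) 0)\<^sup>2" for s
  have \<delta>: "0 \<le> \<delta>" by (simp add: \<delta>_def)
  have "0 \<le> 2 * \<delta> * (\<Sum>k<j. min t (real (Suc k) * \<delta>)) - h (real j * \<delta>) \<and>
    2 * \<delta> * (\<Sum>k<j. min t (real (Suc k) * \<delta>)) - h (real j * \<delta>) \<le> 2 * \<delta> * min t (real j * \<delta>)" for j
  proof (induction j)
    case 0
    then show ?case using t by (simp add: h_def)
  next
    case (Suc j)
    define s where "s = real j * \<delta>"
    have s: "0 \<le> s" "real (Suc j) * \<delta> = s + \<delta>" using \<delta> by (auto simp: s_def algebra_simps)
    have step: "2 * \<delta> * min t s \<le> h (s + \<delta>) - h s" "h (s + \<delta>) - h s \<le> 2 * \<delta> * min t (s + \<delta>)"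
      unfolding h_def by (rule min_sum_step[OF t(1) s(1) \<delta>])+
    have "2 * \<delta> * (\<Sum>k<Suc j. min t (real (Suc k) * \<delta>))
      = 2 * \<delta> * (\<Sum>k<j. min t (real (Suc k) * \<delta>)) + 2 * \<delta> * min t (s + \<delta>)"
      by (simp only: sum.lessThan_Suc s(2) distrib_left)
    then show ?case
      using Suc step unfolding s(2) s_def[symmetric] by linarith
  qed
  from this[of n] have *: "0 \<le> 2 * \<delta> * (\<Sum>k<n. min t (real (Suc k) * \<delta>)) - h 1"
    "2 * \<delta> * (\<Sum>k<n. min t (real (Suc k) * \<delta>)) - h 1 \<le> 2 * \<delta> * t"
    using n t by (simp_all add: \<delta>_def min_def split: if_splits)
  have "h 1 = 2 * t - t\<^sup>2"
    using t by (simp add: h_def power2_eq_square algebra_simps)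
  then show ?thesis
    using * by (simp add: \<delta>_def abs_le_iff)
qed

context form_domain
begin

lemma D_sum: "finite I \<Longrightarrow> (\<And>i. i \<in> I \<Longrightarrow> f i \<in> D) \<Longrightarrow> (\<lambda>x. \<Sum>i\<in>I. f i x) \<in> D"
  by (induction I rule: finite_induct) (auto simp: D_zero D_add)

lemma form_sum_triangle:
  assumes F: "nonneg_form m D F" and "finite I" "\<And>i. i \<in> I \<Longrightarrow> f i \<in> D"
  shows "sqrt (F (\<lambda>x. \<Sum>i\<in>I. f i x) (\<lambda>x. \<Sum>i\<in>I. f i x)) \<le> (\<Sum>i\<in>I. sqrt (F (f i) (f i)))"
  using assms(2,3)
proof (induction I rule: finite_induct)
  case empty
  then show ?case using form_zero_right[OF F D_zero] by simp
next
  case (insert i I)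
  have "sqrt (F (\<lambda>x. f i x + (\<Sum>i\<in>I. f i x)) (\<lambda>x. f i x + (\<Sum>i\<in>I. f i x)))
      \<le> sqrt (F (f i) (f i)) + sqrt (F (\<lambda>x. \<Sum>i\<in>I. f i x) (\<lambda>x. \<Sum>i\<in>I. f i x))"
    by (rule form_triangle[OF F]) (use insert D_sum in auto)
  with insert show ?case by simp
qed

lemma ess_bounded_lin:
  assumes "u \<in> ess_bounded m" "v \<in> ess_bounded m"
  shows "(\<lambda>x. a * u x + b * v x) \<in> ess_bounded m"
proof -
  obtain M N where "AE x in m. \<bar>u x\<bar> \<le> M" "AE x in m. \<bar>v x\<bar> \<le> N"
    using assms by (auto simp: ess_bounded_def)
  then have "AE x in m. \<bar>a * u x + b * v x\<bar> \<le> \<bar>a\<bar> * M + \<bar>b\<bar> * N"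
  proof eventually_elim
    case (elim x)
    have "\<bar>a * u x + b * v x\<bar> \<le> \<bar>a\<bar> * \<bar>u x\<bar> + \<bar>b\<bar> * \<bar>v x\<bar>"
      using abs_triangle_ineq[of "a * u x" "b * v x"] by (simp add: abs_mult)
    also have "\<dots> \<le> \<bar>a\<bar> * M + \<bar>b\<bar> * N"
      using elim by (intro add_mono mult_left_mono) auto
    finally show ?case .
  qed
  then show ?thesis
    using assms unfolding ess_bounded_def by (auto intro: borel_measurable_add borel_measurable_times)
qed

lemma ess_bounded_mid: "u \<in> ess_bounded m \<Longrightarrow> v \<in> ess_bounded m \<Longrightarrow> (\<lambda>x. (u x + v x) / 2) \<in> ess_bounded m"
  using ess_bounded_lin[of u v "1/2" "1/2"] by (simp add: add_divide_distrib)

end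

context dirichlet
begin

lemma D_clip:
  assumes u: "u \<in> D" and M: "M > 0"
  shows "(\<lambda>x. min (max (u x) 0) M) \<in> D"
    and "E (\<lambda>x. min (max (u x) 0) M) (\<lambda>x. min (max (u x) 0) M) \<le> E u u"
proof -
  let ?v = "\<lambda>x. min (max ((1 / M) * u x) 0) 1"
  have uM: "(\<lambda>x. (1 / M) * u x) \<in> D" by (rule D_scale[OF u])
  have v: "?v \<in> D" "E ?v ?v \<le> E (\<lambda>x. (1 / M) * u x) (\<lambda>x. (1 / M) * u x)"
    using dirichlet uM unfolding dirichlet_form_def markov_form_def by (metis (no_types))+
  have eq: "(\<lambda>x. min (max (u x) 0) M) = (\<lambda>x. M * ?v x)"
    using M by (auto simp: min_def max_def field_simps)
  show "(\<lambda>x. min (max (u x) 0) M) \<in> D"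
    unfolding eq by (rule D_scale[OF v(1)])
  have "E (\<lambda>x. M * ?v x) (\<lambda>x. M * ?v x) = M\<^sup>2 * E ?v ?v"
    by (rule form_scale[OF E_form v(1)])
  also have "\<dots> \<le> M\<^sup>2 * ((1 / M)\<^sup>2 * E u u)"
    using v(2) form_scale[OF E_form u, of "1 / M"] by (intro mult_left_mono) auto
  also have "\<dots> = E u u" using M by (simp add: power2_eq_square)
  finally show "E (\<lambda>x. min (max (u x) 0) M) (\<lambda>x. min (max (u x) 0) M) \<le> E u u"
    unfolding eq .
qed

lemma clip_ess_bounded: "u \<in> D \<Longrightarrow> M > 0 \<Longrightarrow> (\<lambda>x. min (max (u x) 0) M) \<in> ess_bounded m"
  using D_measurable[OF D_clip(1)] unfolding ess_bounded_def by (auto intro!: exI[of _ M])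

text \<open>The clips at growing levels converge in \<open>L2\<close> and have energy at most
  \<open>E u u\<close>. The zero set of \<open>u\<close> is carried along because both it and
  boundedness are stable under midpoints; it later allows passing to bounded functions without
  losing that a function vanishes on an open set.\<close>

lemma truncation_approx:
  assumes u: "u \<in> D"
  shows "(\<lambda>x. max (u x) 0) \<in> D"
    and "\<epsilon> > 0 \<Longrightarrow> \<exists>v\<in>D. (v \<in> ess_bounded m \<and> (\<forall>x. u x = 0 \<longrightarrow> v x = 0)) \<and>
      E1 (\<lambda>x. v x - max (u x) 0) (\<lambda>x. v x - max (u x) 0) < \<epsilon>"
proof -
  have meas: "(\<lambda>x. max (u x) 0) \<in> borel_measurable m"
    using D_measurable[OF u] by measurable
  have int: "integrable m (\<lambda>x. (max (u x) 0)\<^sup>2)"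
    by (rule Bochner_Integration.integrable_bound[OF D_square_integrable[OF u]])
      (use meas in \<open>auto simp: max_def\<close>)
  have mid: "(\<lambda>x. (v x + w x) / 2) \<in> ess_bounded m \<and> (\<forall>x. u x = 0 \<longrightarrow> (v x + w x) / 2 = 0)"
    if "v \<in> ess_bounded m \<and> (\<forall>x. u x = 0 \<longrightarrow> v x = 0)"
      "w \<in> ess_bounded m \<and> (\<forall>x. u x = 0 \<longrightarrow> w x = 0)" for v w
    using that by (auto intro: ess_bounded_mid)
  have approx: "\<exists>v\<in>D. (v \<in> ess_bounded m \<and> (\<forall>x. u x = 0 \<longrightarrow> v x = 0)) \<and>
      (\<integral>x. (v x - max (u x) 0)\<^sup>2 \<partial>m) \<le> \<epsilon> \<and> E v v \<le> E u u" if "\<epsilon> > 0" for \<epsilon>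
  proof -
    define f where "f n x = (min (max (u x) 0) (real (Suc n)) - max (u x) 0)\<^sup>2" for n x
    have "(\<lambda>n. \<integral>x. f n x \<partial>m) \<longlonglongrightarrow> (\<integral>x. 0 \<partial>m)"
    proof (rule integral_dominated_convergence[where w = "\<lambda>x. (u x)\<^sup>2"])
      show "f n \<in> borel_measurable m" for n
        unfolding f_def using D_measurable[OF u] by measurable
      show "AE x in m. (\<lambda>n. f n x) \<longlonglongrightarrow> 0"
      proof (rule AE_I2)
        fix x
        obtain N :: nat where N: "max (u x) 0 \<le> real N" using real_arch_simple by blast
        have "f n x = 0" if "n \<ge> N" for n
          using N that by (simp add: f_def min_absorb1)
        then show "(\<lambda>n. f n x) \<longlonglongrightarrow> 0"
          by (intro tendsto_eventually) (auto simp: eventually_sequentially)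
      qed
      have "(min (max a 0) b - max a 0)\<^sup>2 \<le> a\<^sup>2" if "b > 0" for a b :: real
        using that by (intro abs_le_square_iff[THEN iffD1]) (auto simp: min_def max_def)
      then show "AE x in m. norm (f n x) \<le> (u x)\<^sup>2" for n
        by (simp add: f_def)
    qed (use u in \<open>auto simp: D_square_integrable\<close>)
    then have "eventually (\<lambda>n. (\<integral>x. f n x \<partial>m) < \<epsilon>) sequentially"
      using that by (auto dest: order_tendstoD(2))
    then obtain n where "(\<integral>x. f n x \<partial>m) < \<epsilon>" by (auto simp: eventually_sequentially)
    then show ?thesis
      using D_clip[OF u, of "real (Suc n)"] clip_ess_bounded[OF u, of "real (Suc n)"]
      by (intro bexI[of _ "\<lambda>x. min (max (u x) 0) (real (Suc n))"]) (auto simp: f_def)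
  qed
  show "(\<lambda>x. max (u x) 0) \<in> D"
    by (rule closure_of_bounded(1)[OF meas int mid approx])
  show "\<epsilon> > 0 \<Longrightarrow> \<exists>v\<in>D. (v \<in> ess_bounded m \<and> (\<forall>x. u x = 0 \<longrightarrow> v x = 0)) \<and>
      E1 (\<lambda>x. v x - max (u x) 0) (\<lambda>x. v x - max (u x) 0) < \<epsilon>"
    by (rule closure_of_bounded(2)[OF meas int mid approx])
qed

lemma D_max: assumes "u \<in> D" "v \<in> D" shows "(\<lambda>x. max (u x) (v x)) \<in> D"
proof -
  have "(\<lambda>x. u x + max (v x - u x) 0) \<in> D"
    using assms by (intro D_add truncation_approx(1) D_diff)
  moreover have "(\<lambda>x. u x + max (v x - u x) 0) = (\<lambda>x. max (u x) (v x))" by (auto simp: max_def)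
  ultimately show ?thesis by simp
qed

lemma D_min: assumes "u \<in> D" "v \<in> D" shows "(\<lambda>x. min (u x) (v x)) \<in> D"
proof -
  have "(\<lambda>x. - max (- u x) (- v x)) \<in> D" using assms by (intro D_minus D_max)
  moreover have "(\<lambda>x. - max (- u x) (- v x)) = (\<lambda>x. min (u x) (v x))" by (auto simp: max_def min_def)
  ultimately show ?thesis by simp
qed

text \<open>Positive and negative parts are treated separately. The accuracy
  \<open>\<epsilon> / 4\<close> pays for the factor 2 in \<open>form_diff_le\<close> on each of the
  two parts.\<close>

lemma bounded_approx:
  assumes u: "u \<in> D" and \<epsilon>: "\<epsilon> > 0"
  shows "\<exists>v\<in>D. v \<in> ess_bounded m \<and> (\<forall>x. u x = 0 \<longrightarrow> v x = 0) \<and>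
    E (\<lambda>x. v x - u x) (\<lambda>x. v x - u x) < \<epsilon>"
proof -
  let ?p = "\<lambda>x. max (u x) 0" and ?n = "\<lambda>x. max (- u x) 0"
  have \<epsilon>4: "\<epsilon> / 4 > 0" using \<epsilon> by simp
  obtain v where v: "v \<in> D" "v \<in> ess_bounded m" "\<forall>x. u x = 0 \<longrightarrow> v x = 0"
    "E1 (\<lambda>x. v x - ?p x) (\<lambda>x. v x - ?p x) < \<epsilon> / 4"
    using truncation_approx(2)[OF u \<epsilon>4] by blast
  obtain w where w: "w \<in> D" "w \<in> ess_bounded m" "\<forall>x. u x = 0 \<longrightarrow> w x = 0"
    "E1 (\<lambda>x. w x - ?n x) (\<lambda>x. w x - ?n x) < \<epsilon> / 4"
    using truncation_approx(2)[OF D_minus[OF u] \<epsilon>4] by auto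
  have p: "?p \<in> D" and n: "?n \<in> D"
    using truncation_approx(1) u D_minus[OF u] by blast+
  have eq: "(\<lambda>x. (v x - w x) - u x) = (\<lambda>x. (v x - ?p x) - (w x - ?n x))"
    by (auto simp: max_def)
  have "E (\<lambda>x. (v x - w x) - u x) (\<lambda>x. (v x - w x) - u x)
      \<le> 2 * E (\<lambda>x. v x - ?p x) (\<lambda>x. v x - ?p x) + 2 * E (\<lambda>x. w x - ?n x) (\<lambda>x. w x - ?n x)"
    unfolding eq by (intro form_diff_le[OF E_form] D_diff v(1) w(1) p n)
  also have "\<dots> < \<epsilon>"
    using v(4) w(4) E_le_E1[of "\<lambda>x. v x - ?p x"] E_le_E1[of "\<lambda>x. w x - ?n x"] by linarith
  finally have "E (\<lambda>x. (v x - w x) - u x) (\<lambda>x. (v x - w x) - u x) < \<epsilon>" .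
  moreover have "(\<lambda>x. v x - w x) \<in> ess_bounded m"
    using ess_bounded_lin[OF v(2) w(2), of 1 "-1"] by simp
  ultimately show ?thesis
    using D_diff[OF v(1) w(1)] v(3) w(3) by (intro bexI[of _ "\<lambda>x. v x - w x"]) auto
qed

text \<open>The square is approximated by the Riemann sums of \<open>t\<^sup>2 = 2 t - 2 \<integral>\<^sub>0\<^sup>1 min t s ds\<close>. Their energy is
  bounded by the triangle inequality alone, since truncation does not increase the energy.\<close>

lemma D_square_unit:
  assumes w: "w \<in> D" and w01: "\<And>x. 0 \<le> w x" "\<And>x. w x \<le> 1"
  shows "(\<lambda>x. (w x)\<^sup>2) \<in> D"
proof (rule closure_of_bounded(1)[where P = "\<lambda>_. True" and B = "16 * E w w"])
  show meas: "(\<lambda>x. (w x)\<^sup>2) \<in> borel_measurable m"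
    using D_measurable[OF w] by measurable
  show "integrable m (\<lambda>x. ((w x)\<^sup>2)\<^sup>2)"
  proof (rule Bochner_Integration.integrable_bound[OF D_square_integrable[OF w]])
    have "((w x)\<^sup>2)\<^sup>2 \<le> (w x)\<^sup>2" for x
      using w01[of x] mult_left_le_one_le[of "(w x)\<^sup>2" "(w x)\<^sup>2"] power_le_one[of "w x" 2]
      by (simp add: power2_eq_square[of "(w x)\<^sup>2"])
    then show "AE x in m. norm (((w x)\<^sup>2)\<^sup>2) \<le> norm ((w x)\<^sup>2)" by simp
  qed (use meas in measurable)
  fix \<epsilon> :: real assume \<epsilon>: "\<epsilon> > 0"
  define A where "A = (\<integral>x. (w x)\<^sup>2 \<partial>m)"
  have A: "0 \<le> A" by (simp add: A_def)
  obtain n :: nat where n: "n > 0" "4 * A / \<epsilon> < real n"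
    using reals_Archimedean2[of "max 0 (4 * A / \<epsilon>)"] by auto
  have "4 * A / (real n)\<^sup>2 \<le> \<epsilon>"
  proof -
    have "4 * A < \<epsilon> * real n" using n \<epsilon> by (simp add: field_simps)
    also have "\<dots> \<le> \<epsilon> * (real n)\<^sup>2"
      using n \<epsilon> by (intro mult_left_mono) (auto simp: power2_eq_square)
    finally show ?thesis using n by (simp add: field_simps)
  qed
  define g where "g k x = min (w x) (real (Suc k) / real n)" for k x
  have gclip: "g k = (\<lambda>x. min (max (w x) 0) (real (Suc k) / real n))" for k
    using w01 by (simp add: g_def[abs_def] max_absorb1)
  have g: "g k \<in> D" "E (g k) (g k) \<le> E w w" for k
    unfolding gclip using D_clip[OF w, of "real (Suc k) / real n"] n by auto
  define S where "S = (\<lambda>x. 2 * w x + (- 2 / real n) * (\<Sum>k<n. g k x))"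
  have sumD: "(\<lambda>x. \<Sum>k<n. g k x) \<in> D" using g by (intro D_sum) auto
  then have S: "S \<in> D" unfolding S_def by (intro D_lin w)
  have "sqrt (E (\<lambda>x. \<Sum>k<n. g k x) (\<lambda>x. \<Sum>k<n. g k x)) \<le> (\<Sum>k<n. sqrt (E (g k) (g k)))"
    using g by (intro form_sum_triangle[OF E_form]) auto
  also have "\<dots> \<le> (\<Sum>k<n. sqrt (E w w))" using g by (intro sum_mono) auto
  finally have "sqrt (E (\<lambda>x. \<Sum>k<n. g k x) (\<lambda>x. \<Sum>k<n. g k x)) \<le> real n * sqrt (E w w)" by simp
  then have "E (\<lambda>x. \<Sum>k<n. g k x) (\<lambda>x. \<Sum>k<n. g k x) \<le> (real n * sqrt (E w w))\<^sup>2"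
    by (rule sqrt_le_D)
  then have sumE: "E (\<lambda>x. \<Sum>k<n. g k x) (\<lambda>x. \<Sum>k<n. g k x) \<le> (real n)\<^sup>2 * E w w"
    using form_nonneg[OF E_form w] by (simp add: power_mult_distrib)
  \<comment> \<open>Each of the two terms contributes 8: the first is \<open>2 * 2\<^sup>2\<close>,
    and in the second the factor \<open>n\<^sup>2\<close> of the sum cancels against its
    coefficient. What matters is a bound independent of \<open>n\<close>.\<close>
  have "E S S \<le> 2 * (2\<^sup>2 * E w w) + 2 * ((- 2 / real n)\<^sup>2 * E (\<lambda>x. \<Sum>k<n. g k x) (\<lambda>x. \<Sum>k<n. g k x))"
    unfolding S_def form_scale[OF E_form w, symmetric] form_scale[OF E_form sumD, symmetric]
    by (intro form_add_le[OF E_form] D_scale w sumD)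
  also have "\<dots> \<le> 2 * (2\<^sup>2 * E w w) + 2 * ((- 2 / real n)\<^sup>2 * ((real n)\<^sup>2 * E w w))"
    using sumE by (intro add_mono mult_left_mono) auto
  also have "\<dots> = 16 * E w w" using n by (simp add: power2_eq_square)
  finally have SE: "E S S \<le> 16 * E w w" .
  have err: "(S x - (w x)\<^sup>2)\<^sup>2 \<le> (2 / real n)\<^sup>2 * (w x)\<^sup>2" for x
  proof -
    have "\<bar>S x - (w x)\<^sup>2\<bar> \<le> \<bar>2 / real n * w x\<bar>"
      using square_approx_by_min[OF w01(1,2)[of x] n(1)] w01(1)[of x] by (simp add: S_def g_def abs_mult)
    then show ?thesis
      unfolding power_mult_distrib[symmetric] by (rule abs_le_square_iff[THEN iffD1])
  qed
  have "(\<integral>x. (S x - (w x)\<^sup>2)\<^sup>2 \<partial>m) \<le> (\<integral>x. (2 / real n)\<^sup>2 * (w x)\<^sup>2 \<partial>m)"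
  proof (rule integral_mono)
    show int: "integrable m (\<lambda>x. (2 / real n)\<^sup>2 * (w x)\<^sup>2)"
      by (intro integrable_mult_right D_square_integrable w)
    show "integrable m (\<lambda>x. (S x - (w x)\<^sup>2)\<^sup>2)"
    proof (rule Bochner_Integration.integrable_bound[OF int])
      show "(\<lambda>x. (S x - (w x)\<^sup>2)\<^sup>2) \<in> borel_measurable m"
        using meas D_measurable[OF S] by measurable
      show "AE x in m. norm ((S x - (w x)\<^sup>2)\<^sup>2) \<le> norm ((2 / real n)\<^sup>2 * (w x)\<^sup>2)"
        using err by (auto simp: abs_of_nonneg)
    qed
  qed (rule err)
  also have "\<dots> = 4 * A / (real n)\<^sup>2" by (simp add: A_def power2_eq_square)
  also have "\<dots> \<le> \<epsilon>" by fact
  finally show "\<exists>v\<in>D. True \<and> (\<integral>x. (v x - (w x)\<^sup>2)\<^sup>2 \<partial>m) \<le> \<epsilon> \<and> E v v \<le> 16 * E w w"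
    using S SE by blast
qed simp

text \<open>The scaled positive and negative parts take values in the unit interval and are never
  nonzero together, so their squares add up to the square of \<open>w\<close>. Membership of the
  square in \<open>D\<close> gives meaning to \<open>E (\<lambda>x. w x * w x) \<phi>\<close> in the
  energy identity.\<close>

lemma D_square:
  assumes w: "w \<in> D" "w \<in> ess_bounded m"
  shows "(\<lambda>x. (w x)\<^sup>2) \<in> D"
proof -
  obtain M0 where M0: "AE x in m. \<bar>w x\<bar> \<le> M0" using w by (auto simp: ess_bounded_def)
  define M where "M = max M0 1"
  have M: "M > 0" by (simp add: M_def)
  define p where "p = (\<lambda>x. min (max (1 / M * w x) 0) 1)"
  define q where "q = (\<lambda>x. min (max (- 1 / M * w x) 0) 1)"
  have "p \<in> D" "q \<in> D"
    unfolding p_def q_def by (intro D_clip(1) D_scale w zero_less_one)+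
  then have "(\<lambda>x. (p x)\<^sup>2) \<in> D" "(\<lambda>x. (q x)\<^sup>2) \<in> D"
    by (auto intro!: D_square_unit simp: p_def q_def)
  then have D: "(\<lambda>x. M\<^sup>2 * (p x)\<^sup>2 + M\<^sup>2 * (q x)\<^sup>2) \<in> D" by (rule D_lin)
  have eq: "M\<^sup>2 * (min (max (1 / M * a) 0) 1)\<^sup>2 + M\<^sup>2 * (min (max (- 1 / M * a) 0) 1)\<^sup>2 = a\<^sup>2"
    if "\<bar>a\<bar> \<le> M0" for a
  proof -
    have a: "\<bar>a\<bar> \<le> M" using that by (simp add: M_def)
    show ?thesis
    proof (cases "a \<ge> 0")
      case True
      then have r: "min (max (1 / M * a) 0) 1 = a / M" "min (max (- 1 / M * a) 0) 1 = 0"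
        using a M by (auto simp: min_def max_def field_simps)
      show ?thesis unfolding r using M by (simp add: power_divide)
    next
      case False
      then have r: "min (max (1 / M * a) 0) 1 = 0" "min (max (- 1 / M * a) 0) 1 = - a / M"
        using a M by (auto simp: min_def max_def field_simps)
      show ?thesis unfolding r using M by (simp add: power_divide)
    qed
  qed
  show ?thesis
  proof (rule D_cong[OF D])
    show "(\<lambda>x. (w x)\<^sup>2) \<in> borel_measurable m" using D_measurable[OF w(1)] by measurable
    show "AE x in m. M\<^sup>2 * (p x)\<^sup>2 + M\<^sup>2 * (q x)\<^sup>2 = (w x)\<^sup>2"
      using M0 by eventually_elim (simp only: eq p_def q_def)
  qed
qed

text \<open>The Markov property clips only from 0 upwards, so the symmetric clip is a difference of
  two clips. Applying \<open>form_diff_le\<close> twice gives \<open>10 = 2 + 2 * (2 + 2)\<close>.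
  Later only the uniformity in \<open>\<epsilon>\<close> counts.\<close>

lemma D_symmetric_clip:
  assumes v: "v \<in> D" and \<epsilon>: "\<epsilon> > 0"
  shows "(\<lambda>x. v x - max (- \<epsilon>) (min (v x) \<epsilon>)) \<in> D"
    and "E (\<lambda>x. v x - max (- \<epsilon>) (min (v x) \<epsilon>)) (\<lambda>x. v x - max (- \<epsilon>) (min (v x) \<epsilon>)) \<le> 10 * E v v"
proof -
  let ?p = "\<lambda>x. min (max (v x) 0) \<epsilon>" and ?q = "\<lambda>x. min (max (- v x) 0) \<epsilon>"
  have p: "?p \<in> D" "E ?p ?p \<le> E v v" using D_clip[OF v \<epsilon>] by auto
  have q: "?q \<in> D" "E ?q ?q \<le> E v v"
    using D_clip[OF D_minus[OF v] \<epsilon>] form_minus[OF E_form v] by auto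
  have eq: "(\<lambda>x. v x - max (- \<epsilon>) (min (v x) \<epsilon>)) = (\<lambda>x. v x - (?p x - ?q x))"
    using \<epsilon> by (auto simp: min_def max_def)
  show "(\<lambda>x. v x - max (- \<epsilon>) (min (v x) \<epsilon>)) \<in> D"
    unfolding eq by (intro D_diff v p q)
  show "E (\<lambda>x. v x - max (- \<epsilon>) (min (v x) \<epsilon>)) (\<lambda>x. v x - max (- \<epsilon>) (min (v x) \<epsilon>)) \<le> 10 * E v v"
    unfolding eq
    using form_diff_le[OF E_form v D_diff[OF p(1) q(1)]] form_diff_le[OF E_form p(1) q(1)] p(2) q(2)
    by linarith
qed

end

section \<open>Locality of the energy measure\<close>

lemma Hausdorff_euclidean: "Hausdorff_space (euclidean :: 'a::t2_space topology)"
  unfolding Hausdorff_space_def using hausdorff by (auto simp: disjnt_def)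

lemma locally_compact_compact_nbhd:
  fixes K :: "'a::t2_space set"
  assumes lc: "locally_compact_space (euclidean :: 'a topology)" and K: "compact K"
  obtains V where "open V" "K \<subseteq> V" "compact (closure V)"
proof -
  have "Hausdorff_space (euclidean :: 'a topology)"
    by (rule Hausdorff_euclidean)
  then obtain V L where V: "open V" "compact L" "closed L" "K \<subseteq> V" "V \<subseteq> L"
    using lc K locally_compact_space_compact_closed_compact[of "euclidean :: 'a topology"]
    by (metis open_openin closed_closedin compactin_euclidean_iff)
  then have "closure V \<subseteq> L" by (simp add: closure_minimal)
  then have "compact (closure V)"
    using compact_Int_closed[OF V(2) closed_closure, of V] by (simp add: Int_absorb1)
  then show ?thesis using that V by blast
qed

lemma locally_compact_Urysohn:
  fixes K :: "'a::t2_space set"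
  assumes lc: "locally_compact_space (euclidean :: 'a topology)"
    and K: "compact K" and V: "open V" "K \<subseteq> V"
  obtains f :: "'a \<Rightarrow> real" where "continuous_on UNIV f" "\<And>x. x \<in> K \<Longrightarrow> f x = 1" "\<And>x. x \<notin> V \<Longrightarrow> f x = 0"
proof -
  have "completely_regular_space (euclidean :: 'a topology)"
    using lc Hausdorff_euclidean
    by (intro locally_compact_regular_imp_completely_regular_space disjI1)
  moreover have "compactin euclidean K" "closedin euclidean (- V)" "disjnt K (- V)"
    using K V by (auto simp: disjnt_def)
  ultimately obtain f :: "'a \<Rightarrow> real" where "continuous_map euclidean euclideanreal f"
    "f ` (- V) \<subseteq> {0}" "f ` K \<subseteq> {1}"
    using Urysohn_completely_regular_compact_closed_alt[of "euclidean :: 'a topology" K "- V" 0 1]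
    by blast
  then show ?thesis using that[of f] by auto
qed

lemma borel_measurable_sets_eq:
  "f \<in> borel_measurable M \<Longrightarrow> sets N = sets M \<Longrightarrow> f \<in> borel_measurable N"
  using measurable_cong_sets[of N M borel borel] by simp

text \<open>Equality of the signed measures \<open>\<mu>1 - \<mu>2\<close> and
  \<open>\<nu>1 - \<nu>2\<close>, rearranged into sums because subtraction in \<open>ennreal\<close>
  truncates. In this shape it passes through the induction over measurable functions.\<close>

lemma nn_integral_balanced:
  assumes sets: "sets \<mu>1 = sets \<nu>1" "sets \<mu>2 = sets \<nu>1" "sets \<nu>2 = sets \<nu>1"
    and f: "f \<in> borel_measurable \<nu>1"
    and eq: "\<And>B. B \<in> sets \<nu>1 \<Longrightarrow> emeasure \<mu>1 B + emeasure \<nu>2 B = emeasure \<nu>1 B + emeasure \<mu>2 B"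
  shows "(\<integral>\<^sup>+x. f x \<partial>\<mu>1) + (\<integral>\<^sup>+x. f x \<partial>\<nu>2) = (\<integral>\<^sup>+x. f x \<partial>\<nu>1) + (\<integral>\<^sup>+x. f x \<partial>\<mu>2)"
  using f
proof (induction rule: borel_measurable_induct)
  case (cong f g)
  have "space \<mu>1 = space \<nu>1" "space \<mu>2 = space \<nu>1" "space \<nu>2 = space \<nu>1"
    using sets by (auto dest: sets_eq_imp_space_eq)
  then have "(\<integral>\<^sup>+x. f x \<partial>\<mu>) = (\<integral>\<^sup>+x. g x \<partial>\<mu>)" if "\<mu> \<in> {\<mu>1, \<mu>2, \<nu>1, \<nu>2}" for \<mu>
    using cong(3) that by (intro nn_integral_cong) auto
  then show ?case using cong(4) by simp
next
  case (set A)
  then show ?case using eq sets by simp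
next
  case (mult u c)
  have "u \<in> borel_measurable \<mu>" if "\<mu> \<in> {\<mu>1, \<mu>2, \<nu>1, \<nu>2}" for \<mu>
    using borel_measurable_sets_eq[OF mult(2)] sets that by auto
  then show ?case using mult(4) by (simp add: nn_integral_cmult flip: distrib_left)
next
  case (add u v)
  have "u \<in> borel_measurable \<mu>" "v \<in> borel_measurable \<mu>" if "\<mu> \<in> {\<mu>1, \<mu>2, \<nu>1, \<nu>2}" for \<mu>
    using borel_measurable_sets_eq[of u \<nu>1 \<mu>] borel_measurable_sets_eq[of v \<nu>1 \<mu>] add sets that by auto
  then have "(\<integral>\<^sup>+x. v x + u x \<partial>\<mu>) = (\<integral>\<^sup>+x. v x \<partial>\<mu>) + (\<integral>\<^sup>+x. u x \<partial>\<mu>)"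
    if "\<mu> \<in> {\<mu>1, \<mu>2, \<nu>1, \<nu>2}" for \<mu>
    using that by (intro nn_integral_add) auto
  then show ?case using add.IH by (simp add: ac_simps)
next
  case (seq U)
  have meas: "U i \<in> borel_measurable \<mu>" if "\<mu> \<in> {\<mu>1, \<mu>2, \<nu>1, \<nu>2}" for \<mu> i
    using borel_measurable_sets_eq[of "U i" \<nu>1 \<mu>] seq sets that by auto
  have eqU: "(SUP i. U i) = (\<lambda>x. SUP i. U i x)"
    by (simp add: fun_eq_iff image_comp)
  have sup: "(\<integral>\<^sup>+x. (SUP i. U i x) \<partial>\<mu>) = (SUP i. \<integral>\<^sup>+x. U i x \<partial>\<mu>)"
    if "\<mu> \<in> {\<mu>1, \<mu>2, \<nu>1, \<nu>2}" for \<mu>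
    by (rule nn_integral_monotone_convergence_SUP[OF \<open>incseq U\<close> meas[OF that]])
  have inc: "incseq (\<lambda>i. \<integral>\<^sup>+x. U i x \<partial>\<mu>)" for \<mu>
    using \<open>incseq U\<close> by (auto simp: incseq_def le_fun_def intro!: nn_integral_mono)
  have "(SUP i. \<integral>\<^sup>+x. U i x \<partial>\<mu>1) + (SUP i. \<integral>\<^sup>+x. U i x \<partial>\<nu>2)
      = (SUP i. \<integral>\<^sup>+x. U i x \<partial>\<nu>1) + (SUP i. \<integral>\<^sup>+x. U i x \<partial>\<mu>2)"
    unfolding ennreal_SUP_add[OF inc inc, symmetric] using seq.IH by simp
  then show ?case
    unfolding eqU using sup by simp
qed

lemma integral_balanced:
  fixes \<phi> :: "'a \<Rightarrow> real"
  assumes sets: "sets \<mu>1 = sets \<nu>1" "sets \<mu>2 = sets \<nu>1" "sets \<nu>2 = sets \<nu>1"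
    and fin: "finite_measure \<mu>1" "finite_measure \<mu>2" "finite_measure \<nu>1" "finite_measure \<nu>2"
    and \<phi>: "\<phi> \<in> borel_measurable \<nu>1" "\<And>x. 0 \<le> \<phi> x" "\<And>x. \<phi> x \<le> M"
    and eq: "\<And>B. B \<in> sets \<nu>1 \<Longrightarrow> measure \<mu>1 B + measure \<nu>2 B = measure \<nu>1 B + measure \<mu>2 B"
  shows "(\<integral>x. \<phi> x \<partial>\<mu>1) - (\<integral>x. \<phi> x \<partial>\<mu>2) = (\<integral>x. \<phi> x \<partial>\<nu>1) - (\<integral>x. \<phi> x \<partial>\<nu>2)"
proof -
  have eq': "emeasure \<mu>1 B + emeasure \<nu>2 B = emeasure \<nu>1 B + emeasure \<mu>2 B" if "B \<in> sets \<nu>1" for B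
    using eq[OF that] fin by (simp add: finite_measure.emeasure_eq_measure flip: ennreal_plus)
  have "ennreal (\<integral>x. \<phi> x \<partial>\<mu>) = (\<integral>\<^sup>+x. ennreal (\<phi> x) \<partial>\<mu>)" if "\<mu> \<in> {\<mu>1, \<mu>2, \<nu>1, \<nu>2}" for \<mu>
  proof (rule nn_integral_eq_integral[symmetric])
    have "finite_measure \<mu>" using fin that by auto
    moreover have "\<phi> \<in> borel_measurable \<mu>"
      using borel_measurable_sets_eq[OF \<phi>(1)] sets that by auto
    ultimately show "integrable \<mu> \<phi>"
      using \<phi> by (intro finite_measure.integrable_const_bound[of _ _ M]) auto
  qed (use \<phi> in auto)
  moreover have "(\<integral>\<^sup>+x. ennreal (\<phi> x) \<partial>\<mu>1) + (\<integral>\<^sup>+x. ennreal (\<phi> x) \<partial>\<nu>2)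
      = (\<integral>\<^sup>+x. ennreal (\<phi> x) \<partial>\<nu>1) + (\<integral>\<^sup>+x. ennreal (\<phi> x) \<partial>\<mu>2)"
    by (rule nn_integral_balanced[OF sets _ eq']) (use \<phi> in measurable)
  ultimately have "ennreal (\<integral>x. \<phi> x \<partial>\<mu>1) + ennreal (\<integral>x. \<phi> x \<partial>\<nu>2)
      = ennreal (\<integral>x. \<phi> x \<partial>\<nu>1) + ennreal (\<integral>x. \<phi> x \<partial>\<mu>2)" by simp
  then have "(\<integral>x. \<phi> x \<partial>\<mu>1) + (\<integral>x. \<phi> x \<partial>\<nu>2) = (\<integral>x. \<phi> x \<partial>\<nu>1) + (\<integral>x. \<phi> x \<partial>\<mu>2)"
    using \<phi>(2) by (simp flip: ennreal_plus)
  then show ?thesis by simp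
qed

lemma radon_measure_open:
  "radon_measure \<mu> \<Longrightarrow> open U \<Longrightarrow> emeasure \<mu> U = (SUP K\<in>{K. compact K \<and> K \<subseteq> U}. emeasure \<mu> K)"
  by (simp only: radon_measure_def)

lemma radon_decomposition_sets:
  assumes "radon_decomposition \<nu> \<mu>1 \<mu>2"
  shows "sets \<mu>1 = sets borel" "sets \<mu>2 = sets borel" "finite_measure \<mu>1" "finite_measure \<mu>2"
    and "\<And>B. B \<in> sets borel \<Longrightarrow> \<nu> B = measure \<mu>1 B - measure \<mu>2 B"
proof -
  have radons: "radon_measure \<mu>1" "radon_measure \<mu>2" "finite_measure \<mu>1" "finite_measure \<mu>2"
    using assms by (simp_all only: radon_decomposition_def)
  have eq: "\<forall>B\<in>sets borel. \<nu> B = measure \<mu>1 B - measure \<mu>2 B"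
    using assms unfolding radon_decomposition_def by (elim conjE)
  show "sets \<mu>1 = sets borel" "sets \<mu>2 = sets borel" "finite_measure \<mu>1" "finite_measure \<mu>2"
    using radons by (simp_all only: radon_measure_def)
  show "\<nu> B = measure \<mu>1 B - measure \<mu>2 B" if "B \<in> sets borel" for B
    using eq that by (rule bspec)
qed

text \<open>Unfolds the definite description: any two decompositions of the same set function give
  the same integral. Nonnegative bounded integrands suffice, as only cutoff functions get
  integrated.\<close>

lemma signed_integral_eq:
  assumes dec: "radon_decomposition \<nu> \<mu>1 \<mu>2"
    and \<phi>: "\<phi> \<in> borel_measurable borel" "\<And>x. 0 \<le> \<phi> x" "\<And>x. \<phi> x \<le> M"
  shows "signed_integral \<nu> \<phi> = (\<integral>x. \<phi> x \<partial>\<mu>1) - (\<integral>x. \<phi> x \<partial>\<mu>2)"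
  unfolding signed_integral_def
proof (rule the_equality)
  show "\<exists>\<mu>1' \<mu>2'. radon_decomposition \<nu> \<mu>1' \<mu>2' \<and>
      (\<integral>x. \<phi> x \<partial>\<mu>1) - (\<integral>x. \<phi> x \<partial>\<mu>2) = (\<integral>x. \<phi> x \<partial>\<mu>1') - (\<integral>x. \<phi> x \<partial>\<mu>2')"
    using dec by blast
  fix c assume "\<exists>\<mu>1 \<mu>2. radon_decomposition \<nu> \<mu>1 \<mu>2 \<and> c = (\<integral>x. \<phi> x \<partial>\<mu>1) - (\<integral>x. \<phi> x \<partial>\<mu>2)"
  then obtain \<nu>1 \<nu>2 where dec': "radon_decomposition \<nu> \<nu>1 \<nu>2"
    and c: "c = (\<integral>x. \<phi> x \<partial>\<nu>1) - (\<integral>x. \<phi> x \<partial>\<nu>2)" by blast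
  note d = radon_decomposition_sets[OF dec] and d' = radon_decomposition_sets[OF dec']
  show "c = (\<integral>x. \<phi> x \<partial>\<mu>1) - (\<integral>x. \<phi> x \<partial>\<mu>2)"
    unfolding c
  proof (rule integral_balanced[symmetric])
    show "\<phi> \<in> borel_measurable \<nu>1"
      using borel_measurable_sets_eq[OF \<phi>(1)] d'(1) by auto
    show "measure \<mu>1 B + measure \<nu>2 B = measure \<nu>1 B + measure \<mu>2 B" if "B \<in> sets \<nu>1" for B
      using d(5)[of B] d'(5)[of B] that d'(1) by simp
  qed (use d d' \<phi> in auto)
qed

section \<open>The energy measure as a set function, cutoff functions, and strong locality\<close>

locale energy_space = dirichlet m D E
  for m :: "'a::t2_space measure" and D E +
  fixes \<Gamma> :: "('a \<Rightarrow> real) \<Rightarrow> ('a \<Rightarrow> real) \<Rightarrow> 'a set \<Rightarrow> real"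
  assumes lc: "locally_compact_space (euclidean :: 'a topology)"
    and radon: "radon_measure m"
    and regular: "regular_form m D E"
    and strongly_local: "strongly_local m D E"
    and energy: "energy_measure m D E \<Gamma>"
begin

lemma sets_m [simp, measurable_cong]: "sets m = sets borel"
  using radon by (simp add: radon_measure_def)

lemma space_m [simp]: "space m = UNIV"
  using sets_eq_imp_space_eq[OF sets_m] by simp

lemma borel_imp_measurable: "u \<in> borel_measurable borel \<Longrightarrow> u \<in> borel_measurable m"
  by (simp add: measurable_def)

lemma continuous_measurable: "continuous_on UNIV u \<Longrightarrow> u \<in> borel_measurable m"
  for u :: "'a \<Rightarrow> real"
  by (intro borel_imp_measurable borel_measurable_continuous_onI)

lemmas energy_unfolded = energy[unfolded energy_measure_def]

lemma G_form: "B \<in> sets borel \<Longrightarrow> nonneg_form m D (\<lambda>u v. \<Gamma> u v B)"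
  unfolding nonneg_form_def by (rule energy_unfolded[THEN conjunct2, THEN conjunct1, rule_format])

lemma G_total: "u \<in> D \<Longrightarrow> v \<in> D \<Longrightarrow> E u v = \<Gamma> u v UNIV"
  by (rule energy_unfolded[THEN conjunct2, THEN conjunct2, THEN conjunct1, rule_format])

lemma G_decomposition:
  assumes "u \<in> D" "v \<in> D"
  obtains \<mu>1 \<mu>2 where "radon_decomposition (\<Gamma> u v) \<mu>1 \<mu>2"
  using energy_unfolded[THEN conjunct1, rule_format, OF assms]
  unfolding signed_radon_measure_def by blast

lemma G_nonneg: "u \<in> D \<Longrightarrow> B \<in> sets borel \<Longrightarrow> 0 \<le> \<Gamma> u u B"
  using form_nonneg[OF G_form] .

lemma G_sums:
  assumes u: "u \<in> D" "v \<in> D" and A: "range A \<subseteq> sets borel" "disjoint_family A"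
  shows "(\<lambda>n. \<Gamma> u v (A n)) sums \<Gamma> u v (\<Union>n. A n)"
proof -
  obtain \<mu>1 \<mu>2 where dec: "radon_decomposition (\<Gamma> u v) \<mu>1 \<mu>2" using G_decomposition[OF u] .
  note d = radon_decomposition_sets[OF dec]
  have "(\<lambda>n. measure \<mu>1 (A n) - measure \<mu>2 (A n)) sums (measure \<mu>1 (\<Union>n. A n) - measure \<mu>2 (\<Union>n. A n))"
    using A d by (intro sums_diff finite_measure.finite_measure_UNION) auto
  moreover have "(\<Union>n. A n) \<in> sets borel" using A by blast
  ultimately show ?thesis using A(1) by (simp only: d(5) range_subsetD)
qed

lemma G_Un:
  assumes u: "u \<in> D" and A: "A \<in> sets borel" "B \<in> sets borel" "A \<inter> B = {}"
  shows "\<Gamma> u u (A \<union> B) = \<Gamma> u u A + \<Gamma> u u B"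
proof -
  obtain \<mu>1 \<mu>2 where dec: "radon_decomposition (\<Gamma> u u) \<mu>1 \<mu>2" using G_decomposition[OF u u] .
  note d = radon_decomposition_sets[OF dec]
  show ?thesis
    using A d finite_measure.finite_measure_Union[OF d(3), of A B]
      finite_measure.finite_measure_Union[OF d(4), of A B] by simp
qed

lemma G_mono:
  assumes u: "u \<in> D" and A: "A \<in> sets borel" "B \<in> sets borel" "A \<subseteq> B"
  shows "\<Gamma> u u A \<le> \<Gamma> u u B"
proof -
  have "\<Gamma> u u (A \<union> (B - A)) = \<Gamma> u u A + \<Gamma> u u (B - A)" using A by (intro G_Un u) auto
  moreover have "A \<union> (B - A) = B" using A by auto
  moreover have "0 \<le> \<Gamma> u u (B - A)" using A by (intro G_nonneg u) auto
  ultimately show ?thesis by simp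
qed

lemma G_le_E: "u \<in> D \<Longrightarrow> B \<in> sets borel \<Longrightarrow> \<Gamma> u u B \<le> E u u"
  using G_mono[of u B UNIV] G_total[of u u] by simp

lemma G_null_mono:
  "u \<in> D \<Longrightarrow> A \<in> sets borel \<Longrightarrow> B \<in> sets borel \<Longrightarrow> A \<subseteq> B \<Longrightarrow> \<Gamma> u u B = 0 \<Longrightarrow> \<Gamma> u u A = 0"
  using G_mono[of u A B] G_nonneg[of u A] by simp

text \<open>Regularity approximates a Urysohn function only uniformly, which fixes neither the
  values on \<open>K\<close> nor the support. A difference of two clips restores both and stays
  inside \<open>D\<close>.\<close>

lemma cutoff:
  assumes K: "compact K" and V: "open V" "K \<subseteq> V"
  obtains \<psi> where "\<psi> \<in> D" "\<psi> \<in> C0" "\<And>x. 0 \<le> \<psi> x" "\<And>x. \<psi> x \<le> 1" "\<And>x. x \<in> K \<Longrightarrow> \<psi> x = 1"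
    "closure {x. \<psi> x \<noteq> 0} \<subseteq> V"
proof -
  obtain W0 where W0: "open W0" "K \<subseteq> W0" "compact (closure W0)"
    using locally_compact_compact_nbhd[OF lc K] .
  define W where "W = W0 \<inter> V"
  have W: "open W" "K \<subseteq> W" "W \<subseteq> V" "W \<subseteq> closure W0"
    using W0 V closure_subset[of W0] by (auto simp: W_def)
  obtain f :: "'a \<Rightarrow> real" where f: "continuous_on UNIV f" "\<And>x. x \<in> K \<Longrightarrow> f x = 1" "\<And>x. x \<notin> W \<Longrightarrow> f x = 0"
    by (rule locally_compact_Urysohn[OF lc K W(1,2)]) (assumption | rule that)+
  have compact_sub: "compact (closure S)" if "S \<subseteq> closure W0" for S
  proof -
    have "closure S \<subseteq> closure W0" using that by (simp add: closure_minimal)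
    then show ?thesis
      using compact_Int_closed[OF W0(3) closed_closure, of S] by (simp add: Int_absorb1)
  qed
  have "{x. 4 * f x \<noteq> 0} \<subseteq> closure W0" using f(3) W(4) by auto
  then have "compact (closure {x. 4 * f x \<noteq> 0})" by (rule compact_sub)
  moreover have "continuous_on UNIV (\<lambda>x. 4 * f x)" by (intro continuous_intros f(1))
  ultimately have C0: "(\<lambda>x. 4 * f x) \<in> C0" by (simp only: C0_def mem_Collect_eq)
  obtain A where A: "A \<subseteq> D \<inter> C0" "\<forall>f\<in>C0. \<forall>\<epsilon>>0. \<exists>\<phi>\<in>A. \<forall>x. \<bar>f x - \<phi> x\<bar> < \<epsilon>"
    using regular unfolding regular_form_def by (elim exE conjE)
  obtain g where "g \<in> A" "\<forall>x. \<bar>4 * f x - g x\<bar> < 1"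
    using A(2)[rule_format, OF C0 zero_less_one] by (elim bexE)
  then have g: "g \<in> D" "g \<in> C0" "\<And>x. \<bar>4 * f x - g x\<bar> < 1"
    using A(1) by auto
  \<comment> \<open>This rises from 0 to 1 while \<open>g\<close> runs from 2 to 3. As
    \<open>g\<close> is within 1 of \<open>4 * f\<close>, it exceeds 3 on \<open>K\<close>, and
    \<open>g x > 2\<close> forces \<open>f x > 1 / 4\<close>; the factor 4 leaves exactly this
    room.\<close>
  define \<psi> where "\<psi> = (\<lambda>x. min (max (g x) 0) 3 - min (max (g x) 0) 2)"
  have cg: "continuous_on UNIV g" using g(2) by (simp add: C0_def)
  have sub: "{x. \<psi> x \<noteq> 0} \<subseteq> {x. 1 / 4 \<le> f x}"
  proof
    fix x assume "x \<in> {x. \<psi> x \<noteq> 0}"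
    then have "g x > 2" by (auto simp: \<psi>_def min_def max_def split: if_splits)
    then show "x \<in> {x. 1 / 4 \<le> f x}" using g(3)[of x] by simp
  qed
  have "closed {x. 1 / 4 \<le> f x}"
    using f(1) by (intro closed_Collect_le) auto
  then have cl: "closure {x. \<psi> x \<noteq> 0} \<subseteq> {x. 1 / 4 \<le> f x}"
    using sub by (simp add: closure_minimal)
  have fW: "{x. 1 / 4 \<le> f x} \<subseteq> W"
  proof
    fix x assume "x \<in> {x. 1 / 4 \<le> f x}"
    then have "f x \<noteq> 0" by auto
    then show "x \<in> W" using f(3) by blast
  qed
  show ?thesis
  proof
    show "\<psi> \<in> D" unfolding \<psi>_def using g(1) by (intro D_diff D_clip) auto
    have "compact (closure {x. \<psi> x \<noteq> 0})" using sub fW W(4) by (intro compact_sub) blast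
    moreover have "continuous_on UNIV \<psi>" unfolding \<psi>_def by (intro continuous_intros cg)
    ultimately show "\<psi> \<in> C0" by (simp add: C0_def)
    show "0 \<le> \<psi> x" "\<psi> x \<le> 1" for x by (auto simp: \<psi>_def min_def max_def)
    show "\<psi> x = 1" if "x \<in> K" for x
    proof -
      have "g x > 3" using g(3)[of x] f(2)[OF that] by simp
      then show ?thesis by (simp add: \<psi>_def min_def max_def)
    qed
    show "closure {x. \<psi> x \<noteq> 0} \<subseteq> V" using cl fW W(3) by blast
  qed
qed

lemma ae_support_subset: "ae_support m \<phi> \<subseteq> closure {x. \<phi> x \<noteq> 0}"
proof -
  have "open (- closure {x. \<phi> x \<noteq> 0})" by (simp add: open_Compl)
  moreover have "AE x in m. x \<in> - closure {x. \<phi> x \<noteq> 0} \<longrightarrow> \<phi> x = 0"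
    using closure_subset[of "{x. \<phi> x \<noteq> 0}"] by (intro AE_I2) blast
  ultimately have "- closure {x. \<phi> x \<noteq> 0} \<subseteq> \<Union>{U. open U \<and> (AE x in m. x \<in> U \<longrightarrow> \<phi> x = 0)}"
    by blast
  then show ?thesis unfolding ae_support_def by blast
qed

lemma E_local:
  assumes "u \<in> D" "v \<in> D" "open U" "ae_support m v \<subseteq> U" "AE x in m. x \<in> U \<longrightarrow> u x = c"
  shows "E u v = 0"
proof (rule strongly_local[unfolded strongly_local_def, rule_format])
  show "\<exists>U c. open U \<and> ae_support m v \<subseteq> U \<and> (AE x in m. x \<in> U \<longrightarrow> u x = c)"
    by (intro exI conjI) (rule assms)+
qed (rule assms)+

lemma G_identity:
  assumes "u \<in> D" "u \<in> ess_bounded m" "\<phi> \<in> D" "\<phi> \<in> C0"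
  shows "signed_integral (\<Gamma> u u) \<phi> = E u (\<lambda>x. \<phi> x * u x) - E (\<lambda>x. u x * u x) \<phi> / 2"
  using energy_unfolded[THEN conjunct2, THEN conjunct2, THEN conjunct2, rule_format, of u u \<phi>] assms
  by simp

text \<open>For a cutoff \<open>\<phi>\<close> supported in \<open>U\<close> all three terms of the
  energy identity vanish: \<open>\<phi> w\<close> is \<open>c \<phi>\<close>, and both
  \<open>w\<close> and its square are constant near the support of \<open>\<phi>\<close>. Since
  \<open>\<phi>\<close> dominates the indicator of \<open>K\<close> and the energy measure is
  nonnegative, \<open>K\<close> carries no mass.\<close>

lemma G_compact_zero:
  assumes w: "w \<in> D" "w \<in> ess_bounded m" and U: "open U" "AE x in m. x \<in> U \<longrightarrow> w x = c"
    and K: "compact K" "K \<subseteq> U"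
  shows "\<Gamma> w w K = 0"
proof -
  obtain \<phi> where \<phi>: "\<phi> \<in> D" "\<phi> \<in> C0" "\<And>x. 0 \<le> \<phi> x" "\<And>x. \<phi> x \<le> 1" "\<And>x. x \<in> K \<Longrightarrow> \<phi> x = 1"
    "closure {x. \<phi> x \<noteq> 0} \<subseteq> U"
    using cutoff[OF K(1) U(1) K(2)] by metis
  have supp: "ae_support m \<phi> \<subseteq> U" using ae_support_subset \<phi>(6) by blast
  have \<phi>U: "\<phi> x = 0" if "x \<notin> U" for x
    using that \<phi>(6) closure_subset[of "{x. \<phi> x \<noteq> 0}"] by blast
  have \<phi>B: "\<phi> \<in> borel_measurable borel"
    using \<phi>(2) by (intro borel_measurable_continuous_onI) (simp add: C0_def)
  have ae: "AE x in m. \<phi> x * w x = c * \<phi> x"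
    using U(2) by eventually_elim (metis \<phi>U mult.commute mult_zero_left)
  have c\<phi>: "(\<lambda>x. c * \<phi> x) \<in> D" by (rule D_scale[OF \<phi>(1)])
  have \<phi>w: "(\<lambda>x. \<phi> x * w x) \<in> D"
  proof (rule D_cong[OF c\<phi>])
    show "(\<lambda>x. \<phi> x * w x) \<in> borel_measurable m"
      using D_measurable[OF w(1)] D_measurable[OF \<phi>(1)] by measurable
    show "AE x in m. c * \<phi> x = \<phi> x * w x" using ae by eventually_elim (rule sym)
  qed
  have Ew: "E w \<phi> = 0"
    by (rule E_local[OF w(1) \<phi>(1) U(1) supp U(2)])
  have "E w (\<lambda>x. \<phi> x * w x) = E w (\<lambda>x. c * \<phi> x)"
    using w \<phi>w c\<phi> ae by (intro form_cong[OF E_form]) auto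
  also have "\<dots> = c * E w \<phi>"
    using form_sym[OF E_form w(1)] form_scale_left[OF E_form \<phi>(1) w(1)] c\<phi> \<phi>(1) by simp
  finally have 1: "E w (\<lambda>x. \<phi> x * w x) = 0" using Ew by simp
  have w2: "(\<lambda>x. w x * w x) \<in> D" using D_square[OF w] by (simp add: power2_eq_square)
  have ae2: "AE x in m. x \<in> U \<longrightarrow> w x * w x = c * c" using U(2) by eventually_elim auto
  have "E (\<lambda>x. w x * w x) \<phi> = 0"
    by (rule E_local[OF w2 \<phi>(1) U(1) supp ae2])
  then have zero: "signed_integral (\<Gamma> w w) \<phi> = 0"
    using 1 G_identity[OF w \<phi>(1,2)] by simp
  obtain \<mu>1 \<mu>2 where dec: "radon_decomposition (\<Gamma> w w) \<mu>1 \<mu>2" using G_decomposition[OF w(1) w(1)] .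
  note d = radon_decomposition_sets[OF dec]
  have KB: "K \<in> sets borel" using K(1) by (simp add: borel_closed compact_imp_closed)
  \<comment> \<open>The nonnegative remainder of \<open>\<phi>\<close> above the indicator of
    \<open>K\<close>. Comparing it under the two parts of the decomposition replaces integration
    against the set function itself.\<close>
  define \<psi> where "\<psi> x = \<phi> x - indicator K x" for x
  have \<psi>B: "\<psi> \<in> borel_measurable borel"
    unfolding \<psi>_def using \<phi>B KB by measurable
  have \<psi>: "0 \<le> \<psi> x" "\<psi> x \<le> 1" for x
    using \<phi>(3-5)[of x] by (auto simp: \<psi>_def indicator_def)
  have int: "integrable \<mu> \<psi>" "integrable \<mu> (indicator K :: 'a \<Rightarrow> real)" if "\<mu> \<in> {\<mu>1, \<mu>2}" for \<mu>
  proof -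
    have \<mu>: "finite_measure \<mu>" "sets \<mu> = sets borel" using d that by auto
    then have "\<psi> \<in> borel_measurable \<mu>"
      using borel_measurable_sets_eq[OF \<psi>B] by auto
    then show "integrable \<mu> \<psi>"
      using \<psi> by (intro finite_measure.integrable_const_bound[OF \<mu>(1), of _ 1]) auto
    show "integrable \<mu> (indicator K :: 'a \<Rightarrow> real)"
      using KB \<mu> by (intro finite_measure.integrable_const_bound[OF \<mu>(1), of _ 1]) (auto simp: indicator_def)
  qed
  have split: "(\<integral>x. \<phi> x \<partial>\<mu>) = (\<integral>x. \<psi> x \<partial>\<mu>) + measure \<mu> K" if "\<mu> \<in> {\<mu>1, \<mu>2}" for \<mu>
  proof -
    have "(\<integral>x. \<phi> x \<partial>\<mu>) = (\<integral>x. \<psi> x + indicator K x \<partial>\<mu>)" by (simp add: \<psi>_def)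
    also have "\<dots> = (\<integral>x. \<psi> x \<partial>\<mu>) + (\<integral>x. indicator K x \<partial>\<mu>)"
      using int[OF that] by (rule Bochner_Integration.integral_add)
    finally show ?thesis
      using that d(1,2) KB by (auto dest: sets_eq_imp_space_eq)
  qed
  \<comment> \<open>For a decomposition, nonnegativity of \<open>\<Gamma> w w\<close> means that the
    subtracted measure is the smaller one.\<close>
  have le: "\<mu>2 \<le> \<mu>1"
  proof -
    have "measure \<mu>2 B \<le> measure \<mu>1 B" if "B \<in> sets borel" for B
      using d(5)[OF that] G_nonneg[OF w(1) that] by simp
    then show ?thesis
      using d by (subst le_measure) (auto simp: finite_measure.emeasure_eq_measure)
  qed
  have "(\<integral>x. \<psi> x \<partial>\<mu>2) \<le> (\<integral>x. \<psi> x \<partial>\<mu>1)"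
  proof -
    have "ennreal (\<integral>x. \<psi> x \<partial>\<mu>2) = (\<integral>\<^sup>+x. ennreal (\<psi> x) \<partial>\<mu>2)"
      using int \<psi> by (intro nn_integral_eq_integral[symmetric]) auto
    also have "\<dots> \<le> (\<integral>\<^sup>+x. ennreal (\<psi> x) \<partial>\<mu>1)"
      using le d by (intro nn_integral_mono_measure) auto
    also have "\<dots> = ennreal (\<integral>x. \<psi> x \<partial>\<mu>1)"
      using int \<psi> by (intro nn_integral_eq_integral) auto
    finally show ?thesis using \<psi> by (simp add: integral_nonneg_AE)
  qed
  moreover have "(\<integral>x. \<phi> x \<partial>\<mu>1) - (\<integral>x. \<phi> x \<partial>\<mu>2) = 0"
    using signed_integral_eq[OF dec \<phi>B \<phi>(3,4)] zero by simp
  ultimately have "\<Gamma> w w K \<le> 0" using split[of \<mu>1] split[of \<mu>2] d(5)[OF KB] by simp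
  then show ?thesis using G_nonneg[OF w(1) KB] by simp
qed

text \<open>Inner regularity is available for the two Radon measures separately: they agree on
  compact subsets of \<open>U\<close>, hence on \<open>U\<close>.\<close>

lemma G_open_zero_bounded:
  assumes w: "w \<in> D" "w \<in> ess_bounded m" and U: "open U" "AE x in m. x \<in> U \<longrightarrow> w x = c"
  shows "\<Gamma> w w U = 0"
proof -
  obtain \<mu>1 \<mu>2 where dec: "radon_decomposition (\<Gamma> w w) \<mu>1 \<mu>2" using G_decomposition[OF w(1) w(1)] .
  note d = radon_decomposition_sets[OF dec]
  have "emeasure \<mu>1 K = emeasure \<mu>2 K" if "compact K" "K \<subseteq> U" for K
  proof -
    have "K \<in> sets borel" using that by (simp add: borel_closed compact_imp_closed)
    then have "measure \<mu>1 K = measure \<mu>2 K"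
      using G_compact_zero[OF w U that] d(5) by simp
    then show ?thesis using d by (simp add: finite_measure.emeasure_eq_measure)
  qed
  then have "(SUP K\<in>{K. compact K \<and> K \<subseteq> U}. emeasure \<mu>1 K) = (SUP K\<in>{K. compact K \<and> K \<subseteq> U}. emeasure \<mu>2 K)"
    by (intro SUP_cong) auto
  moreover have "radon_measure \<mu>1" "radon_measure \<mu>2"
    using dec by (simp_all add: radon_decomposition_def)
  ultimately have "emeasure \<mu>1 U = emeasure \<mu>2 U"
    using radon_measure_open[OF _ U(1)] by simp
  then have "measure \<mu>1 U = measure \<mu>2 U" by (simp add: measure_def)
  then show ?thesis using d(5)[of U] U(1) by simp
qed

lemma G_zero_by_approx:
  assumes w: "w \<in> D" and B: "B \<in> sets borel"
    and approx: "\<And>\<epsilon>. \<epsilon> > 0 \<Longrightarrow> \<exists>v\<in>D. \<Gamma> v v B = 0 \<and> E (\<lambda>x. v x - w x) (\<lambda>x. v x - w x) < \<epsilon>"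
  shows "\<Gamma> w w B = 0"
proof -
  have "\<Gamma> w w B \<le> 0 + \<epsilon>" if \<epsilon>: "\<epsilon> > 0" for \<epsilon>
  proof -
    obtain v where v: "v \<in> D" "\<Gamma> v v B = 0" "E (\<lambda>x. v x - w x) (\<lambda>x. v x - w x) < \<epsilon> / 2"
      using approx[OF half_gt_zero[OF \<epsilon>]] by blast
    have d: "(\<lambda>x. v x - w x) \<in> D" by (intro D_diff v w)
    have "\<Gamma> (\<lambda>x. v x - (v x - w x)) (\<lambda>x. v x - (v x - w x)) B
        \<le> 2 * \<Gamma> v v B + 2 * \<Gamma> (\<lambda>x. v x - w x) (\<lambda>x. v x - w x) B"
      by (rule form_diff_le[OF G_form[OF B] v(1) d])
    then show ?thesis using v G_le_E[OF d B] by simp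
  qed
  then have "\<Gamma> w w B \<le> 0" by (rule field_le_epsilon)
  then show ?thesis using G_nonneg[OF w B] by simp
qed

text \<open>The bounded approximants keep the zero set of \<open>w\<close>, and no other level set;
  therefore the constant is 0 here, while it was arbitrary for bounded functions.\<close>

lemma G_open_zero:
  assumes w: "w \<in> D" and U: "open U" "AE x in m. x \<in> U \<longrightarrow> w x = 0"
  shows "\<Gamma> w w U = 0"
proof (rule G_zero_by_approx[OF w])
  fix \<epsilon> :: real assume "\<epsilon> > 0"
  then obtain v where v: "v \<in> D" "v \<in> ess_bounded m" "\<forall>x. w x = 0 \<longrightarrow> v x = 0"
    "E (\<lambda>x. v x - w x) (\<lambda>x. v x - w x) < \<epsilon>"
    using bounded_approx[OF w] by blast
  have "AE x in m. x \<in> U \<longrightarrow> v x = 0" using U(2) by eventually_elim (use v(3) in auto)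
  then show "\<exists>v\<in>D. \<Gamma> v v U = 0 \<and> E (\<lambda>x. v x - w x) (\<lambda>x. v x - w x) < \<epsilon>"
    using v G_open_zero_bounded[OF v(1,2) U(1)] by blast
qed (simp add: U(1))

text \<open>\<open>\<Gamma>(v,v)\<close> does not charge the zero set of \<open>v\<close>: the functions \<open>v\<close> minus its truncation at level
  \<open>\<epsilon>\<close> vanish on the open set \<open>{\<bar>v\<bar> < \<epsilon>}\<close>, are bounded in energy and converge to \<open>v\<close> in \<open>L\<^sup>2\<close>.\<close>

lemma G_zero_set:
  assumes v: "v \<in> D" and U: "open U" and f: "continuous_on UNIV f"
    and ae: "AE x in m. x \<in> U \<longrightarrow> v x = f x"
  shows "\<Gamma> v v (U \<inter> {x. f x = 0}) = 0"
proof -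
  define N where "N = U \<inter> {x. f x = 0}"
  have "closed {x. f x = 0}" using f by (intro closed_Collect_eq) auto
  then have N: "N \<in> sets borel" using U by (auto simp: N_def)
  \<comment> \<open>Having no energy on \<open>N\<close> is a convex condition, so it may be imposed
    on the convexified approximants.\<close>
  have mid: "\<Gamma> (\<lambda>x. (u x + w x) / 2) (\<lambda>x. (u x + w x) / 2) N = 0"
    if "u \<in> D" "w \<in> D" "\<Gamma> u u N = 0" "\<Gamma> w w N = 0" for u w
    using form_mid_le[OF G_form[OF N] that(1,2)] G_nonneg[OF D_mid[OF that(1,2)] N] that(3,4) by simp
  have approx: "\<exists>u\<in>D. \<Gamma> u u N = 0 \<and> (\<integral>x. (u x - v x)\<^sup>2 \<partial>m) \<le> \<epsilon> \<and> E u u \<le> 10 * E v v"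
    if \<epsilon>: "\<epsilon> > 0" for \<epsilon>
  proof -
    define h where "h n x = v x - max (- (1 / real (Suc n))) (min (v x) (1 / real (Suc n)))" for n x
    have h: "h n \<in> D" "E (h n) (h n) \<le> 10 * E v v" for n
      unfolding h_def using D_symmetric_clip[OF v, of "1 / real (Suc n)"] by auto
    have "(\<lambda>n. \<integral>x. (h n x - v x)\<^sup>2 \<partial>m) \<longlonglongrightarrow> (\<integral>x. 0 \<partial>m)"
    proof (rule integral_dominated_convergence[where w = "\<lambda>x. (v x)\<^sup>2"])
      show "(\<lambda>x. (h n x - v x)\<^sup>2) \<in> borel_measurable m" for n
        using D_measurable[OF v] D_measurable[OF h(1)] by measurable
      have hv: "\<bar>h n x - v x\<bar> \<le> 1 / real (Suc n)" "\<bar>h n x - v x\<bar> \<le> \<bar>v x\<bar>" for n x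
      proof -
        have "\<bar>- max (- b) (min a b)\<bar> \<le> b" "\<bar>- max (- b) (min a b)\<bar> \<le> \<bar>a\<bar>" if "b > 0" for a b :: real
          using that by (auto simp: min_def max_def)
        from this[of "1 / real (Suc n)" "v x"]
        show "\<bar>h n x - v x\<bar> \<le> 1 / real (Suc n)" "\<bar>h n x - v x\<bar> \<le> \<bar>v x\<bar>"
          unfolding h_def by auto
      qed
      show "AE x in m. (\<lambda>n. (h n x - v x)\<^sup>2) \<longlonglongrightarrow> 0"
      proof (rule AE_I2)
        fix x
        have "(\<lambda>n. h n x - v x) \<longlonglongrightarrow> 0"
          by (rule Lim_null_comparison[OF _ LIMSEQ_Suc[OF lim_1_over_n]]) (use hv(1) in auto)
        from tendsto_power[OF this, of 2] show "(\<lambda>n. (h n x - v x)\<^sup>2) \<longlonglongrightarrow> 0" by simp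
      qed
      have "(h n x - v x)\<^sup>2 \<le> (v x)\<^sup>2" for n x
        by (rule abs_le_square_iff[THEN iffD1]) (rule hv(2))
      then show "AE x in m. norm ((h n x - v x)\<^sup>2) \<le> (v x)\<^sup>2" for n by simp
    qed (use v in \<open>auto simp: D_square_integrable\<close>)
    then have "eventually (\<lambda>n. (\<integral>x. (h n x - v x)\<^sup>2 \<partial>m) < \<epsilon>) sequentially"
      using \<epsilon> by (auto dest: order_tendstoD(2))
    then obtain n where n: "(\<integral>x. (h n x - v x)\<^sup>2 \<partial>m) < \<epsilon>" by (auto simp: eventually_sequentially)
    \<comment> \<open>Continuity of the version \<open>f\<close> enters here: \<open>S\<close> is
      open and contains \<open>N\<close>, and on \<open>S\<close> the clipped difference vanishes
      almost everywhere. The zero set of \<open>v\<close> itself would depend on the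
      representative.\<close>
    define S where "S = U \<inter> {x. \<bar>f x\<bar> < 1 / real (Suc n)}"
    have "open {x. \<bar>f x\<bar> < 1 / real (Suc n)}"
      using f by (intro open_Collect_less continuous_intros) auto
    then have S: "open S" using U by (auto simp: S_def)
    have "AE x in m. x \<in> S \<longrightarrow> h n x = 0"
      using ae
    proof eventually_elim
      case (elim x)
      have clip: "a - max (- b) (min a b) = 0" if "\<bar>a\<bar> < b" for a b :: real
        using that by (auto simp: min_def max_def)
      show ?case using elim clip[of "v x" "1 / real (Suc n)"] unfolding h_def S_def by auto
    qed
    then have "\<Gamma> (h n) (h n) S = 0" by (rule G_open_zero[OF h(1) S])
    moreover have "N \<subseteq> S" by (auto simp: N_def S_def)
    ultimately have "\<Gamma> (h n) (h n) N = 0" using S by (intro G_null_mono[OF h(1) N, of S]) auto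
    then show ?thesis using h n by (intro bexI[of _ "h n"]) auto
  qed
  have "\<Gamma> v v N = 0"
  proof (rule G_zero_by_approx[OF v N])
    fix \<epsilon> :: real assume "\<epsilon> > 0"
    then obtain u where u: "u \<in> D" "\<Gamma> u u N = 0" "E1 (\<lambda>x. u x - v x) (\<lambda>x. u x - v x) < \<epsilon>"
      using closure_of_bounded(2)[OF D_measurable[OF v] D_square_integrable[OF v] mid approx] by blast
    then show "\<exists>u\<in>D. \<Gamma> u u N = 0 \<and> E (\<lambda>x. u x - v x) (\<lambda>x. u x - v x) < \<epsilon>"
      using E_le_E1[of "\<lambda>x. u x - v x"] by (intro bexI[of _ u]) auto
  qed
  then show ?thesis by (simp add: N_def)
qed

text \<open>The difference \<open>w - w'\<close> has the continuous version \<open>f - f'\<close> on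
  \<open>U\<close>, and \<open>B\<close> lies in the zero set of that version. Here \<open>B\<close>
  need not be open, which is what allows a set to be split along \<open>f \<le> g\<close>
  later.\<close>

lemma G_eq_on_coincidence_set:
  assumes w: "w \<in> D" "w' \<in> D" and U: "open U" and f: "continuous_on UNIV f" "continuous_on UNIV f'"
    and ae: "AE x in m. x \<in> U \<longrightarrow> f x = w x" "AE x in m. x \<in> U \<longrightarrow> f' x = w' x"
    and B: "B \<in> sets borel" "B \<subseteq> U" "\<And>x. x \<in> B \<Longrightarrow> f x = f' x"
  shows "\<Gamma> w w B = \<Gamma> w' w' B"
proof (rule form_eq_of_null_diff[OF G_form[OF B(1)] w])
  have d: "(\<lambda>x. w x - w' x) \<in> D" by (intro D_diff w)
  have cont: "continuous_on UNIV (\<lambda>x. f x - f' x)" by (intro continuous_intros f)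
  have "AE x in m. x \<in> U \<longrightarrow> w x - w' x = f x - f' x"
    using ae by eventually_elim auto
  from G_zero_set[OF d U cont this]
  have "\<Gamma> (\<lambda>x. w x - w' x) (\<lambda>x. w x - w' x) (U \<inter> {x. f x - f' x = 0}) = 0" .
  moreover have "closed {x. f x - f' x = 0}" using cont by (intro closed_Collect_eq) auto
  ultimately show "\<Gamma> (\<lambda>x. w x - w' x) (\<lambda>x. w x - w' x) B = 0"
    using U B by (intro G_null_mono[OF d B(1), of "U \<inter> {x. f x - f' x = 0}"]) auto
qed

text \<open>Equality almost everywhere on an open set suffices without continuous versions. The
  mixed term is included because \<open>energy_loc\<close> ranges over pairs of
  representatives.\<close>

lemma G_eq_on_open:
  assumes w: "w \<in> D" "w' \<in> D" and U: "open U" "AE x in m. x \<in> U \<longrightarrow> w x = w' x"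
    and B: "B \<in> sets borel" "B \<subseteq> U"
  shows "\<Gamma> w w B = \<Gamma> w' w' B" "\<Gamma> w w' B = \<Gamma> w w B"
proof -
  have d: "(\<lambda>x. w x - w' x) \<in> D" by (intro D_diff w)
  have "AE x in m. x \<in> U \<longrightarrow> w x - w' x = 0" using U(2) by eventually_elim auto
  then have "\<Gamma> (\<lambda>x. w x - w' x) (\<lambda>x. w x - w' x) U = 0" by (rule G_open_zero[OF d U(1)])
  then have null: "\<Gamma> (\<lambda>x. w x - w' x) (\<lambda>x. w x - w' x) B = 0"
    using G_null_mono[OF d B(1), of U] U B by auto
  show "\<Gamma> w w B = \<Gamma> w' w' B" by (rule form_eq_of_null_diff[OF G_form[OF B(1)] w null])
  have "\<Gamma> (\<lambda>x. (w x - w' x) + w' x) w B = \<Gamma> (\<lambda>x. w x - w' x) w B + \<Gamma> w' w B"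
    by (rule form_add_left[OF G_form[OF B(1)] d w(2,1)])
  moreover have "\<Gamma> (\<lambda>x. w x - w' x) w B = 0"
    using form_null_right[OF G_form[OF B(1)] w(1) d null] form_sym[OF G_form[OF B(1)] d w(1)] by simp
  ultimately show "\<Gamma> w w' B = \<Gamma> w w B"
    using form_sym[OF G_form[OF B(1)] w] by simp
qed

end

section \<open>Energy measures of functions that are locally in the domain\<close>

text \<open>Let \<open>S\<close> be the part of \<open>A\<close> where the density exceeds
  \<open>c\<close>. The bound on \<open>S\<close> says that the larger integrand has no larger
  integral; as \<open>S\<close> has finite measure, the integrands agree almost everywhere, so
  \<open>S\<close> is null.\<close>

lemma AE_RN_deriv_le:
  assumes m: "sigma_finite_measure m" and ac: "absolutely_continuous m N" and sets: "sets N = sets m"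
    and A: "A \<in> sets m" "emeasure m A < \<infinity>" and c: "0 \<le> c"
    and le: "\<And>B. B \<in> sets m \<Longrightarrow> B \<subseteq> A \<Longrightarrow> emeasure N B \<le> ennreal c * emeasure m B"
  shows "AE x in m. x \<in> A \<longrightarrow> RN_deriv m N x \<le> ennreal c"
proof -
  let ?f = "RN_deriv m N"
  define S where "S = {x \<in> space m. x \<in> A \<and> ennreal c < ?f x}"
  have S: "S \<in> sets m" "S \<subseteq> A" unfolding S_def using A(1) by measurable auto
  have dens: "density m ?f = N" by (rule sigma_finite_measure.density_RN_deriv[OF m ac sets])
  have mS: "emeasure m S < \<infinity>" using emeasure_mono[OF S(2) A(1)] A(2) by (simp add: order_le_less_trans)
  have int: "(\<integral>\<^sup>+x. ennreal c * indicator S x \<partial>m) = ennreal c * emeasure m S"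
    using S(1) by (simp add: nn_integral_cmult_indicator)
  have "\<not> (\<integral>\<^sup>+x. ennreal c * indicator S x \<partial>m) < (\<integral>\<^sup>+x. ?f x * indicator S x \<partial>m)"
    using le[OF S] emeasure_density[of ?f m S] S(1) dens int by simp
  moreover have "AE x in m. ennreal c * indicator S x \<le> ?f x * indicator S x"
    by (intro AE_I2) (auto simp: S_def indicator_def)
  moreover have "(\<integral>\<^sup>+x. ennreal c * indicator S x \<partial>m) \<noteq> \<infinity>"
    unfolding int using mS by (simp add: ennreal_mult_eq_top_iff)
  moreover have "(\<lambda>x. ennreal c * indicator S x) \<in> borel_measurable m"
    "(\<lambda>x. ?f x * indicator S x) \<in> borel_measurable m"
    using S(1) by measurable
  ultimately have "AE x in m. ?f x * indicator S x \<le> ennreal c * indicator S x"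
    using nn_integral_less by blast
  with AE_space show ?thesis
  proof eventually_elim
    case (elim x)
    show ?case
    proof (rule impI, rule ccontr)
      assume "x \<in> A" "\<not> ?f x \<le> ennreal c"
      then have "x \<in> S" using elim by (auto simp: S_def)
      then show False using elim \<open>\<not> ?f x \<le> ennreal c\<close> by simp
    qed
  qed
qed

context energy_space
begin

text \<open>Two representatives, given on different neighborhoods of \<open>B\<close>, are compared
  on the intersection of these neighborhoods, which is still open and contains
  \<open>B\<close>.\<close>

lemma energy_loc_eq:
  assumes U: "open U" "relatively_compact U" and w: "w \<in> D" "AE x in m. x \<in> U \<longrightarrow> u x = w x"
    and B: "B \<in> sets borel" "B \<subseteq> U"
  shows "energy_loc m D \<Gamma> u u B = \<Gamma> w w B"
  unfolding energy_loc_def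
proof (rule the_equality)
  show "\<forall>U. \<forall>w1\<in>D. \<forall>w2\<in>D. open U \<longrightarrow> relatively_compact U \<longrightarrow> B \<subseteq> U \<longrightarrow>
      (AE x in m. x \<in> U \<longrightarrow> u x = w1 x) \<longrightarrow> (AE x in m. x \<in> U \<longrightarrow> u x = w2 x) \<longrightarrow> \<Gamma> w1 w2 B = \<Gamma> w w B"
  proof (intro allI ballI impI)
    fix U' w1 w2
    assume w12: "w1 \<in> D" "w2 \<in> D" and U': "open U'" "B \<subseteq> U'"
      and ae: "AE x in m. x \<in> U' \<longrightarrow> u x = w1 x" "AE x in m. x \<in> U' \<longrightarrow> u x = w2 x"
    have O: "open (U \<inter> U')" "B \<subseteq> U \<inter> U'" using U U' B by auto
    have "AE x in m. x \<in> U \<inter> U' \<longrightarrow> w1 x = w2 x" using ae by eventually_elim auto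
    then have "\<Gamma> w1 w2 B = \<Gamma> w1 w1 B" by (rule G_eq_on_open(2)[OF w12 O(1) _ B(1) O(2)])
    moreover have "AE x in m. x \<in> U \<inter> U' \<longrightarrow> w1 x = w x" using ae(1) w(2) by eventually_elim auto
    then have "\<Gamma> w1 w1 B = \<Gamma> w w B" by (rule G_eq_on_open(1)[OF w12(1) w(1) O(1) _ B(1) O(2)])
    ultimately show "\<Gamma> w1 w2 B = \<Gamma> w w B" by simp
  qed
  show "c = \<Gamma> w w B" if "\<forall>U. \<forall>w1\<in>D. \<forall>w2\<in>D. open U \<longrightarrow> relatively_compact U \<longrightarrow> B \<subseteq> U \<longrightarrow>
      (AE x in m. x \<in> U \<longrightarrow> u x = w1 x) \<longrightarrow> (AE x in m. x \<in> U \<longrightarrow> u x = w2 x) \<longrightarrow> \<Gamma> w1 w2 B = c" for c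
    using that[rule_format, of w w U] w U B(2) by simp
qed

lemma D_locE:
  assumes "u \<in> D_loc m D" "relatively_compact K"
  obtains w where "w \<in> D" "AE x in m. x \<in> K \<longrightarrow> u x = w x"
  using assms unfolding D_loc_def by blast

text \<open>The defining predicates of the two descriptions are shown to be equal, so the values
  agree even where no representative exists. This makes the intrinsic distance symmetric.\<close>

lemma energy_loc_minus:
  assumes B: "B \<in> sets borel"
  shows "energy_loc m D \<Gamma> (\<lambda>x. - u x) (\<lambda>x. - u x) B = energy_loc m D \<Gamma> u u B"
proof -
  have eq: "\<Gamma> (\<lambda>x. - w x) (\<lambda>x. - w' x) B = \<Gamma> w w' B" if w: "w \<in> D" "w' \<in> D" for w w'
  proof -
    have "\<Gamma> (\<lambda>x. - w x) (\<lambda>x. - w' x) B = - \<Gamma> w (\<lambda>x. - w' x) B"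
      using form_scale_left[OF G_form[OF B] w(1) D_minus[OF w(2)], of "-1"] by simp
    also have "\<Gamma> w (\<lambda>x. - w' x) B = \<Gamma> (\<lambda>x. - w' x) w B"
      by (rule form_sym[OF G_form[OF B] w(1) D_minus[OF w(2)]])
    also have "\<dots> = - \<Gamma> w' w B"
      using form_scale_left[OF G_form[OF B] w(2,1), of "-1"] by simp
    also have "\<Gamma> w' w B = \<Gamma> w w' B" by (rule form_sym[OF G_form[OF B] w(2,1)])
    finally show ?thesis by simp
  qed
  define P where "P u c \<longleftrightarrow> (\<forall>U. \<forall>w\<in>D. \<forall>w'\<in>D. open U \<longrightarrow> relatively_compact U \<longrightarrow> B \<subseteq> U \<longrightarrow>
        (AE x in m. x \<in> U \<longrightarrow> u x = w x) \<longrightarrow> (AE x in m. x \<in> U \<longrightarrow> u x = w' x) \<longrightarrow>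
        \<Gamma> w w' B = c)" for u c
  have imp: "P (\<lambda>x. - u x) c" if P: "P u c" for u c
    unfolding P_def
  proof (intro allI ballI impI)
    fix U w w'
    assume w: "w \<in> D" "w' \<in> D" and U: "open U" "relatively_compact U" "B \<subseteq> U"
      and ae: "AE x in m. x \<in> U \<longrightarrow> - u x = w x" "AE x in m. x \<in> U \<longrightarrow> - u x = w' x"
    have "AE x in m. x \<in> U \<longrightarrow> u x = - w x" "AE x in m. x \<in> U \<longrightarrow> u x = - w' x"
      using ae by (eventually_elim, force)+
    then have "\<Gamma> (\<lambda>x. - w x) (\<lambda>x. - w' x) B = c"
      using P[unfolded P_def, rule_format, OF D_minus[OF w(1)] D_minus[OF w(2)] U] by simp
    then show "\<Gamma> w w' B = c" using eq[OF w] by simp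
  qed
  have "P (\<lambda>x. - u x) = P u"
    using imp[of u] imp[of "\<lambda>x. - u x"] by (auto simp: fun_eq_iff)
  then show ?thesis unfolding energy_loc_def P_def by simp
qed

lemma energy_loc_measure_minus: "energy_loc_measure m D \<Gamma> (\<lambda>x. - u x) = energy_loc_measure m D \<Gamma> u"
  unfolding energy_loc_measure_def
proof (rule measure_of_eq)
  fix B :: "'a set" assume "B \<in> sigma_sets UNIV (sets borel)"
  then have B: "B \<in> sets borel" using sets.sigma_sets_eq[of "borel :: 'a measure"] by simp
  have "B \<inter> K \<in> sets borel" if "compact K" for K
    using B that by (intro sets.Int) (auto simp: borel_closed compact_imp_closed)
  then show "(SUP K\<in>{K. compact K}. ennreal (energy_loc m D \<Gamma> (\<lambda>x. - u x) (\<lambda>x. - u x) (B \<inter> K))) =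
      (SUP K\<in>{K. compact K}. ennreal (energy_loc m D \<Gamma> u u (B \<inter> K)))"
    by (intro SUP_cong) (auto simp: energy_loc_minus)
qed simp

lemma sets_energy_loc_measure [simp]: "sets (energy_loc_measure m D \<Gamma> u) = sets borel"
  unfolding energy_loc_measure_def using sets.sigma_sets_eq[of "borel :: 'a measure"] by simp

lemma D_loc_minus:
  assumes u: "u \<in> D_loc m D"
  shows "(\<lambda>x. - u x) \<in> D_loc m D"
proof -
  have "u \<in> L2_loc m" using u by (simp add: D_loc_def)
  then have "(\<lambda>x. - u x) \<in> L2_loc m" by (auto simp: L2_loc_def)
  moreover have "\<exists>w\<in>D. AE x in m. x \<in> K \<longrightarrow> - u x = w x" if K: "relatively_compact K" for K
  proof -
    obtain w where w: "w \<in> D" "AE x in m. x \<in> K \<longrightarrow> u x = w x" by (rule D_locE[OF u K])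
    have "AE x in m. x \<in> K \<longrightarrow> - u x = - w x" using w(2) by eventually_elim simp
    then show ?thesis using D_minus[OF w(1)] by (intro bexI[of _ "\<lambda>x. - w x"])
  qed
  ultimately show ?thesis by (simp add: D_loc_def)
qed

end

section \<open>The measure of a function locally in the domain, computed along an exhaustion\<close>

locale exhausted_energy_space = energy_space m D E \<Gamma>
  for m :: "'a::t2_space measure" and D E \<Gamma> +
  fixes V :: "nat \<Rightarrow> 'a set"
  assumes V_open: "\<And>n. open (V n)"
    and V_compact: "\<And>n. compact (closure (V n))"
    and V_inc: "incseq V"
    and V_exhausts: "\<And>K. compact K \<Longrightarrow> \<exists>n. K \<subseteq> V n"
begin

lemma V_relatively_compact: "relatively_compact (V n)"
  by (simp add: relatively_compact_def V_compact)

lemma V_sets: "V n \<in> sets borel"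
  using V_open by simp

lemma UN_V: "(\<Union>n. V n) = UNIV"
  using V_exhausts[of "{_}"] by auto

lemma emeasure_compact: "compact K \<Longrightarrow> emeasure m K < \<infinity>"
  using radon by (simp add: radon_measure_def)

lemma emeasure_relatively_compact: "relatively_compact B \<Longrightarrow> emeasure m B < \<infinity>"
  using emeasure_compact[of "closure B"] emeasure_mono[of B "closure B" m] closure_subset[of B]
  by (simp add: relatively_compact_def order_le_less_trans)

lemma sigma_finite: "sigma_finite_measure m"
proof
  show "\<exists>A. countable A \<and> A \<subseteq> sets m \<and> \<Union>A = space m \<and> (\<forall>a\<in>A. emeasure m a \<noteq> \<infinity>)"
    using UN_V V_sets emeasure_relatively_compact[OF V_relatively_compact]
    by (intro exI[of _ "range V"]) (auto simp: less_top)
qed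

text \<open>The values of \<open>measure_of\<close> are usable only once countable additivity is
  known. The supremum over all compact sets is replaced by one over an increasing sequence, and
  increasing suprema commute with series.\<close>

lemma energy_loc_measure_eq_SUP:
  assumes w: "\<And>n. w n \<in> D" "\<And>n. AE x in m. x \<in> V n \<longrightarrow> u x = w n x"
    and B: "B \<in> sets borel"
  shows "emeasure (energy_loc_measure m D \<Gamma> u) B = (SUP n. ennreal (\<Gamma> (w n) (w n) (B \<inter> V n)))"
proof -
  define \<mu> where "\<mu> B = (SUP K\<in>{K. compact K}. ennreal (energy_loc m D \<Gamma> u u (B \<inter> K)))" for B
  define \<nu> where "\<nu> n B = ennreal (\<Gamma> (w n) (w n) (B \<inter> V n))" for n B
  have loc: "energy_loc m D \<Gamma> u u A = \<Gamma> (w n) (w n) A" if "A \<in> sets borel" "A \<subseteq> V n" for A n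
    by (rule energy_loc_eq[OF V_open V_relatively_compact w that])
  have \<mu>: "\<mu> B = (SUP n. \<nu> n B)" if B: "B \<in> sets borel" for B
  proof (rule antisym)
    show "\<mu> B \<le> (SUP n. \<nu> n B)"
      unfolding \<mu>_def
    proof (rule SUP_least)
      fix K :: "'a set" assume "K \<in> {K. compact K}"
      then have K: "compact K" by simp
      then obtain n where n: "K \<subseteq> V n" using V_exhausts by blast
      have BK: "B \<inter> K \<in> sets borel" using B K by (auto simp: borel_closed compact_imp_closed)
      have "energy_loc m D \<Gamma> u u (B \<inter> K) = \<Gamma> (w n) (w n) (B \<inter> K)" using n by (intro loc BK) auto
      also have "\<dots> \<le> \<Gamma> (w n) (w n) (B \<inter> V n)" using n B V_sets BK by (intro G_mono w) auto
      finally have "ennreal (energy_loc m D \<Gamma> u u (B \<inter> K)) \<le> \<nu> n B"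
        by (simp add: \<nu>_def ennreal_leI)
      then show "ennreal (energy_loc m D \<Gamma> u u (B \<inter> K)) \<le> (SUP n. \<nu> n B)"
        by (rule order_trans) (rule SUP_upper, simp)
    qed
    show "(SUP n. \<nu> n B) \<le> \<mu> B"
    proof (rule SUP_least)
      fix n
      \<comment> \<open>\<open>V n\<close> need not be compact, so it is compared with its closure,
        for which a later \<open>V k\<close> supplies a representative.\<close>
      obtain k where k: "closure (V n) \<subseteq> V k" using V_exhausts[OF V_compact] by blast
      have BV: "B \<inter> V n \<in> sets borel" "B \<inter> closure (V n) \<in> sets borel" using B V_sets by auto
      have "\<Gamma> (w n) (w n) (B \<inter> V n) = energy_loc m D \<Gamma> u u (B \<inter> V n)"
        using loc[OF BV(1), of n] by simp
      also have "\<dots> = \<Gamma> (w k) (w k) (B \<inter> V n)"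
        using k closure_subset[of "V n"] by (intro loc BV) auto
      also have "\<dots> \<le> \<Gamma> (w k) (w k) (B \<inter> closure (V n))"
        using closure_subset[of "V n"] by (intro G_mono w BV) auto
      also have "\<dots> = energy_loc m D \<Gamma> u u (B \<inter> closure (V n))"
        by (rule loc[symmetric]) (use BV k in auto)
      finally have "\<nu> n B \<le> ennreal (energy_loc m D \<Gamma> u u (B \<inter> closure (V n)))"
        by (simp add: \<nu>_def ennreal_leI)
      also have "\<dots> \<le> \<mu> B" unfolding \<mu>_def using V_compact by (intro SUP_upper) auto
      finally show "\<nu> n B \<le> \<mu> B" .
    qed
  qed
  have \<nu>_inc: "incseq (\<lambda>n. \<nu> n B)" if B: "B \<in> sets borel" for B
  proof (rule incseq_SucI)
    fix n
    have sub: "V n \<subseteq> V (Suc n)" using V_inc by (simp add: incseq_SucD)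
    have BV: "B \<inter> V n \<in> sets borel" "B \<inter> V (Suc n) \<in> sets borel" using B V_sets by auto
    have "\<Gamma> (w n) (w n) (B \<inter> V n) = energy_loc m D \<Gamma> u u (B \<inter> V n)"
      using loc[OF BV(1), of n] by simp
    also have "\<dots> = \<Gamma> (w (Suc n)) (w (Suc n)) (B \<inter> V n)" using sub by (intro loc BV) auto
    also have "\<dots> \<le> \<Gamma> (w (Suc n)) (w (Suc n)) (B \<inter> V (Suc n))"
      using sub by (intro G_mono w BV) auto
    finally show "\<nu> n B \<le> \<nu> (Suc n) B" by (simp add: \<nu>_def ennreal_leI)
  qed
  have \<nu>_add: "(\<Sum>i. \<nu> n (A i)) = \<nu> n (\<Union>i. A i)"
    if A: "range A \<subseteq> sets borel" "disjoint_family A" for A n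
  proof -
    have A': "range (\<lambda>i. A i \<inter> V n) \<subseteq> sets borel" "disjoint_family (\<lambda>i. A i \<inter> V n)"
      using A V_sets by (auto simp: disjoint_family_on_def)
    have nonneg: "0 \<le> \<Gamma> (w n) (w n) (A i \<inter> V n)" for i
      using A' by (intro G_nonneg w) auto
    have sums: "(\<lambda>i. \<Gamma> (w n) (w n) (A i \<inter> V n)) sums \<Gamma> (w n) (w n) (\<Union>i. A i \<inter> V n)"
      by (rule G_sums[OF w(1) w(1) A'])
    show ?thesis
      unfolding \<nu>_def using suminf_ennreal_eq[OF nonneg sums] by simp
  qed
  have "emeasure (energy_loc_measure m D \<Gamma> u) B = \<mu> B"
  proof (rule emeasure_measure_of)
    show "energy_loc_measure m D \<Gamma> u = measure_of UNIV (sets borel) \<mu>"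
      by (simp add: energy_loc_measure_def \<mu>_def[abs_def])
    \<comment> \<open>Additivity for two empty sets forces the value to equal its double.\<close>
    have "\<nu> n {} = 0" for n using form_nonneg G_Un[OF w(1), of "{}" "{}" n] by (simp add: \<nu>_def)
    then show "positive (sets (energy_loc_measure m D \<Gamma> u)) \<mu>"
      by (simp add: positive_def \<mu>)
    show "countably_additive (sets (energy_loc_measure m D \<Gamma> u)) \<mu>"
    proof (rule countably_additiveI)
      fix A :: "nat \<Rightarrow> 'a set"
      assume "range A \<subseteq> sets (energy_loc_measure m D \<Gamma> u)" "disjoint_family A"
      then have A: "range A \<subseteq> sets borel" "disjoint_family A" by auto
      have Ai: "A i \<in> sets borel" for i using A(1) by auto
      have "(\<Sum>i. \<mu> (A i)) = (\<Sum>i. SUP n. \<nu> n (A i))" using \<mu>[OF Ai] by simp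
      also have "\<dots> = (SUP n. \<Sum>i. \<nu> n (A i))"
        by (intro ennreal_suminf_SUP_eq \<nu>_inc Ai)
      also have "\<dots> = \<mu> (\<Union>i. A i)"
        using \<nu>_add[OF A] \<mu>[of "\<Union>i. A i"] Ai by (simp add: sets.countable_UN)
      finally show "(\<Sum>i. \<mu> (A i)) = \<mu> (\<Union>i. A i)" .
    qed
  qed (use B in auto)
  then show ?thesis using \<mu>[OF B] by (simp add: \<nu>_def)
qed

lemma energy_loc_measure_eq:
  assumes u: "u \<in> D_loc m D" and U: "open U" "relatively_compact U"
    and w: "w \<in> D" "AE x in m. x \<in> U \<longrightarrow> u x = w x" and B: "B \<in> sets borel" "B \<subseteq> U"
  shows "emeasure (energy_loc_measure m D \<Gamma> u) B = ennreal (\<Gamma> w w B)"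
proof -
  have "\<exists>w. w \<in> D \<and> (AE x in m. x \<in> V n \<longrightarrow> u x = w x)" for n
    using D_locE[OF u V_relatively_compact] by blast
  then obtain w' where w': "\<And>n. w' n \<in> D" "\<And>n. AE x in m. x \<in> V n \<longrightarrow> u x = w' n x" by metis
  have eq: "\<Gamma> (w' n) (w' n) (B \<inter> V n) = \<Gamma> w w (B \<inter> V n)" for n
  proof -
    have "B \<inter> V n \<in> sets borel" using B V_sets by auto
    then show ?thesis
      using energy_loc_eq[OF V_open V_relatively_compact w'(1)[of n] w'(2)[of n], of "B \<inter> V n"]
        energy_loc_eq[OF U w, of "B \<inter> V n"] B(2) by auto
  qed
  obtain k where k: "closure U \<subseteq> V k" using V_exhausts U(2) unfolding relatively_compact_def by blast
  have "(SUP n. ennreal (\<Gamma> w w (B \<inter> V n))) = ennreal (\<Gamma> w w B)"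
  proof (rule antisym)
    show "(SUP n. ennreal (\<Gamma> w w (B \<inter> V n))) \<le> ennreal (\<Gamma> w w B)"
      using B V_sets by (intro SUP_least ennreal_leI G_mono w) auto
    have "B \<inter> V k = B" using k B(2) closure_subset[of U] by blast
    then show "ennreal (\<Gamma> w w B) \<le> (SUP n. ennreal (\<Gamma> w w (B \<inter> V n)))"
      using SUP_upper[of k UNIV "\<lambda>n. ennreal (\<Gamma> w w (B \<inter> V n))"] by simp
  qed
  then show ?thesis
    using energy_loc_measure_eq_SUP[OF w' B(1)] by (simp add: eq)
qed

lemma dominated_by_one_imp:
  assumes u: "u \<in> D_loc m D" "dominated_by m (energy_loc_measure m D \<Gamma> u) (\<lambda>_. 1)"
    and U: "open U" "relatively_compact U"
    and w: "w \<in> D" "AE x in m. x \<in> U \<longrightarrow> u x = w x" and B: "B \<in> sets borel" "B \<subseteq> U"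
  shows "\<Gamma> w w B \<le> measure m B"
proof -
  let ?N = "energy_loc_measure m D \<Gamma> u"
  have ac: "absolutely_continuous m ?N" "AE x in m. RN_deriv m ?N x \<le> 1"
    using u(2) by (auto simp: dominated_by_def)
  have "ennreal (\<Gamma> w w B) = emeasure ?N B"
    by (rule energy_loc_measure_eq[OF u(1) U w B, symmetric])
  also have "\<dots> = emeasure (density m (RN_deriv m ?N)) B"
    using sigma_finite_measure.density_RN_deriv[OF sigma_finite ac(1)] by simp
  also have "\<dots> = (\<integral>\<^sup>+x. RN_deriv m ?N x * indicator B x \<partial>m)"
    using B(1) by (intro emeasure_density) auto
  also have "\<dots> \<le> (\<integral>\<^sup>+x. indicator B x \<partial>m)"
    by (rule nn_integral_mono_AE, use ac(2) in eventually_elim) (auto simp: indicator_def)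
  also have "\<dots> = emeasure m B" using B(1) by simp
  finally have *: "ennreal (\<Gamma> w w B) \<le> emeasure m B" .
  have "emeasure m B \<le> emeasure m U" using B U by (intro emeasure_mono) auto
  then have "emeasure m B < \<infinity>" using emeasure_relatively_compact[OF U(2)] by (rule order_le_less_trans)
  then have "emeasure m B = ennreal (measure m B)"
    by (intro emeasure_eq_ennreal_measure) (simp add: less_top)
  with * show ?thesis by simp
qed

end

section \<open>The intrinsic distance\<close>

lemma finite_inf_closed:
  fixes F :: "('a \<Rightarrow> real) set"
  assumes min: "\<And>f g. f \<in> F \<Longrightarrow> g \<in> F \<Longrightarrow> (\<lambda>x. min (f x) (g x)) \<in> F"
    and S: "finite S" "S \<noteq> {}" "S \<subseteq> F"
  shows "\<exists>h\<in>F. \<forall>z. (\<forall>f\<in>S. h z \<le> f z) \<and> (\<exists>f\<in>S. h z = f z)"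
  using S
proof (induction S rule: finite_ne_induct)
  case (singleton f)
  then show ?case by (intro bexI[of _ f]) auto
next
  case (insert f S)
  then obtain h where h: "h \<in> F" "\<forall>z. (\<forall>f\<in>S. h z \<le> f z) \<and> (\<exists>f\<in>S. h z = f z)" by auto
  show ?case
  proof (rule bexI[of _ "\<lambda>x. min (f x) (h x)"], intro allI conjI ballI)
    show "(\<lambda>x. min (f x) (h x)) \<in> F" using min insert h by auto
    show "min (f z) (h z) \<le> g z" if "g \<in> insert f S" for g z
      using h(2) that by (auto simp: min_le_iff_disj)
    show "\<exists>g\<in>insert f S. min (f z) (h z) = g z" for z
      using h(2) by (auto simp: min_def)
  qed
qed

text \<open>One half of the Kakutani-Stone argument. The clause that every value of \<open>h\<close>
  is a value of some \<open>G y\<close> transports whatever bounds all the \<open>G y\<close> share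
  at a point.\<close>

lemma compact_lattice_bound:
  fixes F :: "('a::topological_space \<Rightarrow> real) set"
  assumes K: "compact K" "K \<noteq> {}"
    and cont: "\<And>f. f \<in> F \<Longrightarrow> continuous_on UNIV f" "continuous_on UNIV u"
    and min: "\<And>f g. f \<in> F \<Longrightarrow> g \<in> F \<Longrightarrow> (\<lambda>x. min (f x) (g x)) \<in> F"
    and G: "\<And>y. y \<in> K \<Longrightarrow> G y \<in> F" "\<And>y. y \<in> K \<Longrightarrow> G y y < u y"
  shows "\<exists>h\<in>F. (\<forall>z\<in>K. h z < u z) \<and> (\<forall>z. \<exists>y\<in>K. h z = G y z)"
proof -
  define N where "N y = {z. G y z < u z}" for y
  have "open (N y)" if "y \<in> K" for y
    unfolding N_def by (intro open_Collect_less cont G that)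
  moreover have "K \<subseteq> (\<Union>y\<in>K. N y)" using G(2) by (auto simp: N_def)
  ultimately obtain C where C: "C \<subseteq> K" "finite C" "K \<subseteq> (\<Union>y\<in>C. N y)"
    by (rule compactE_image[OF K(1)])
  have "C \<noteq> {}" using C(3) K(2) by auto
  then have "finite (G ` C)" "G ` C \<noteq> {}" "G ` C \<subseteq> F" using C G(1) by auto
  then have "\<exists>h\<in>F. \<forall>z. (\<forall>f\<in>G ` C. h z \<le> f z) \<and> (\<exists>f\<in>G ` C. h z = f z)"
    by (intro finite_inf_closed min)
  then obtain h where h: "h \<in> F" "\<forall>z. (\<forall>f\<in>G ` C. h z \<le> f z) \<and> (\<exists>f\<in>G ` C. h z = f z)"
    by blast
  show ?thesis
  proof (intro bexI[OF _ h(1)] conjI ballI allI)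
    fix z assume "z \<in> K"
    then obtain y where y: "y \<in> C" "G y z < u z" using C(3) by (auto simp: N_def)
    have "h z \<le> G y z" using h(2) y(1) by blast
    then show "h z < u z" using y(2) by simp
  next
    fix z show "\<exists>y\<in>K. h z = G y z" using h(2) C(1) by blast
  qed
qed

lemma lattice_approx:
  fixes F :: "('a::topological_space \<Rightarrow> real) set"
  assumes K: "compact K" "K \<noteq> {}"
    and cont: "\<And>f. f \<in> F \<Longrightarrow> continuous_on UNIV f" "continuous_on UNIV u"
    and min: "\<And>f g. f \<in> F \<Longrightarrow> g \<in> F \<Longrightarrow> (\<lambda>x. min (f x) (g x)) \<in> F"
    and max: "\<And>f g. f \<in> F \<Longrightarrow> g \<in> F \<Longrightarrow> (\<lambda>x. max (f x) (g x)) \<in> F"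
    and two: "\<And>x y. x \<in> K \<Longrightarrow> y \<in> K \<Longrightarrow> \<exists>f\<in>F. u x - \<epsilon> < f x \<and> f y < u y + \<epsilon>"
  shows "\<exists>f\<in>F. \<forall>z\<in>K. \<bar>f z - u z\<bar> < \<epsilon>"
proof -
  have "\<exists>g\<in>F. u x - \<epsilon> < g x \<and> (\<forall>z\<in>K. g z < u z + \<epsilon>)" if x: "x \<in> K" for x
  proof -
    have "\<forall>y\<in>K. \<exists>f. f \<in> F \<and> u x - \<epsilon> < f x \<and> f y < u y + \<epsilon>" using two[OF x] by blast
    then obtain G where G: "\<forall>y\<in>K. G y \<in> F \<and> u x - \<epsilon> < G y x \<and> G y y < u y + \<epsilon>"
      by (rule bchoice[THEN exE])
    have c: "continuous_on UNIV (\<lambda>z. u z + \<epsilon>)" by (intro continuous_intros cont)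
    have "\<exists>h\<in>F. (\<forall>z\<in>K. h z < u z + \<epsilon>) \<and> (\<forall>z. \<exists>y\<in>K. h z = G y z)"
      by (rule compact_lattice_bound[OF K cont(1) c min]) (use G in auto)
    then obtain h where h: "h \<in> F" "\<forall>z\<in>K. h z < u z + \<epsilon>" "\<forall>z. \<exists>y\<in>K. h z = G y z" by blast
    obtain y where "y \<in> K" "h x = G y x" using h(3) by blast
    then show ?thesis using h G by (intro bexI[OF _ h(1)]) auto
  qed
  then have "\<forall>x\<in>K. \<exists>g. g \<in> F \<and> u x - \<epsilon> < g x \<and> (\<forall>z\<in>K. g z < u z + \<epsilon>)" by blast
  then obtain G where G: "\<forall>x\<in>K. G x \<in> F \<and> u x - \<epsilon> < G x x \<and> (\<forall>z\<in>K. G x z < u z + \<epsilon>)"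
    by (rule bchoice[THEN exE])
  \<comment> \<open>The second pass uses the same lemma on negated functions, where minima stand for
    maxima; the upper bounds of the first pass survive by the clause on values.\<close>
  define F' where "F' = {f. (\<lambda>x. - f x) \<in> F}"
  have cont': "continuous_on UNIV f" if "f \<in> F'" for f
    using continuous_on_minus[OF cont(1)[of "\<lambda>x. - f x"]] that by (simp add: F'_def)
  have min': "(\<lambda>x. min (f x) (g x)) \<in> F'" if "f \<in> F'" "g \<in> F'" for f g
  proof -
    have "(\<lambda>x. - min (f x) (g x)) = (\<lambda>x. max (- f x) (- g x))" by (auto simp: min_def max_def)
    then show ?thesis using max[of "\<lambda>x. - f x" "\<lambda>x. - g x"] that by (simp add: F'_def)
  qed
  have c: "continuous_on UNIV (\<lambda>z. - u z + \<epsilon>)" by (intro continuous_intros cont)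
  have "\<exists>h\<in>F'. (\<forall>z\<in>K. h z < - u z + \<epsilon>) \<and> (\<forall>z. \<exists>y\<in>K. h z = - G y z)"
    by (rule compact_lattice_bound[OF K cont' c min']) (use G in \<open>auto simp: F'_def\<close>)
  then obtain h where h: "h \<in> F'" "\<forall>z\<in>K. h z < - u z + \<epsilon>" "\<forall>z. \<exists>y\<in>K. h z = - G y z" by blast
  show ?thesis
  proof (intro bexI[of _ "\<lambda>z. - h z"] ballI)
    fix z assume z: "z \<in> K"
    obtain y where y: "y \<in> K" "h z = - G y z" using h(3) by blast
    have "G y z < u z + \<epsilon>" using G y z by blast
    then show "\<bar>- h z - u z\<bar> < \<epsilon>" using h(2) z y by (auto simp: abs_less_iff)
  qed (use h(1) in \<open>simp add: F'_def\<close>)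
qed

context energy_space
begin

definition admissible :: "('a \<Rightarrow> real) set" where
  "admissible = {u \<in> D_loc m D. continuous_on UNIV u \<and>
     dominated_by m (energy_loc_measure m D \<Gamma> u) (\<lambda>_. 1)}"

lemma admissible_minus: "u \<in> admissible \<Longrightarrow> (\<lambda>x. - u x) \<in> admissible"
  by (simp add: admissible_def D_loc_minus energy_loc_measure_minus continuous_on_minus)

end

section \<open>The intrinsic distance as a finite metric, and exhaustion by relatively compact
  sets\<close>

locale intrinsic_space = energy_space m D E \<Gamma>
  for m :: "'a::t2_space measure" and D E \<Gamma> +
  fixes d :: "'a \<Rightarrow> 'a \<Rightarrow> ennreal"
  assumes d_def: "d = intrinsic_dist m D \<Gamma>"
    and topology: "induces_topology d"
    and conn: "connected (UNIV :: 'a set)"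
    and sep: "separable_space (euclidean :: 'a topology)"
begin

lemma d_eq: "d x y = (SUP u\<in>admissible. ennreal (u x - u y))"
  by (simp add: d_def intrinsic_dist_def admissible_def)

lemma d_refl: "d x x = 0"
  unfolding d_eq by (auto intro!: antisym SUP_least)

lemma d_sym_le: "d x y \<le> d y x"
  unfolding d_eq[of x y]
proof (rule SUP_least)
  fix u assume "u \<in> admissible"
  then have "(\<lambda>x. - u x) \<in> admissible" by (rule admissible_minus)
  then have "ennreal (- u y - - u x) \<le> d y x" unfolding d_eq by (rule SUP_upper)
  then show "ennreal (u x - u y) \<le> d y x" by simp
qed

lemma d_sym: "d x y = d y x"
  using d_sym_le[of x y] d_sym_le[of y x] by (rule antisym)

lemma d_triangle: "d x z \<le> d x y + d y z"
  unfolding d_eq[of x z]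
proof (rule SUP_least)
  fix u assume u: "u \<in> admissible"
  have "ennreal (u x - u z) = ennreal ((u x - u y) + (u y - u z))" by simp
  \<comment> \<open>\<open>ennreal\<close> sends negative reals to 0, so the summands are made
    nonnegative before the sum is split.\<close>
  also have "\<dots> \<le> ennreal (max 0 (u x - u y) + max 0 (u y - u z))" by (intro ennreal_leI) auto
  also have "\<dots> = ennreal (u x - u y) + ennreal (u y - u z)"
    by (subst ennreal_plus) (auto simp: max_def ennreal_neg)
  also have "\<dots> \<le> d x y + d y z"
    unfolding d_eq by (intro add_mono SUP_upper u)
  finally show "ennreal (u x - u z) \<le> d x y + d y z" .
qed

lemma open_iff_dball: "open U \<longleftrightarrow> (\<forall>x\<in>U. \<exists>r>0. dball d x r \<subseteq> U)"
  using topology unfolding induces_topology_def by blast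

lemma open_dball: "open (dball d x r)"
  unfolding open_iff_dball
proof
  fix y assume "y \<in> dball d x r"
  then have y: "d x y < ennreal r" by (simp add: dball_def)
  then have fin: "d x y \<noteq> top" using less_top order_less_trans ennreal_less_top by blast
  define s where "s = enn2real (d x y)"
  have s: "d x y = ennreal s" "0 \<le> s" using fin by (auto simp: s_def less_top)
  then have sr: "s < r" using y by (simp add: ennreal_less_iff)
  have "dball d y (r - s) \<subseteq> dball d x r"
  proof
    fix z assume "z \<in> dball d y (r - s)"
    then have "d y z < ennreal (r - s)" by (simp add: dball_def)
    then have "ennreal s + d y z < ennreal s + ennreal (r - s)"
      by (simp add: ennreal_add_left_cancel_less)
    also have "\<dots> = ennreal r" using s sr by (simp flip: ennreal_plus)
    finally have "ennreal s + d y z < ennreal r" .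
    then show "z \<in> dball d x r" using d_triangle[of x z y] s(1) by (simp add: dball_def)
  qed
  then show "\<exists>e>0. dball d y e \<subseteq> dball d x r" using sr by (intro exI[of _ "r - s"]) auto
qed

text \<open>Points at finite distance from \<open>x\<close> form an open set. So do the others,
  since the unit ball around such a point contains only points at infinite distance. Connectedness
  decides.\<close>

lemma d_finite: "d x y < \<infinity>"
proof -
  define A where "A = {y. d x y < \<infinity>}"
  have A: "A = (\<Union>n::nat. dball d x (real n))"
  proof (intro equalityI subsetI)
    fix y assume "y \<in> A"
    then obtain t where t: "d x y = ennreal t" "0 \<le> t" by (auto simp: A_def less_top_ennreal)
    obtain n :: nat where "t < real n" using reals_Archimedean2 by blast
    then show "y \<in> (\<Union>n::nat. dball d x (real n))"
      using t by (intro UN_I[of n]) (auto simp: dball_def ennreal_less_iff simp del: ennreal_of_nat_eq_real_of_nat)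
  next
    fix y assume "y \<in> (\<Union>n::nat. dball d x (real n))"
    then obtain n :: nat where "d x y < ennreal (real n)" by (auto simp: dball_def)
    then show "y \<in> A" using ennreal_less_top order_less_trans unfolding A_def infinity_ennreal_def by blast
  qed
  have "open A" unfolding A using open_dball by auto
  moreover have "open (- A)"
    unfolding open_iff_dball
  proof
    fix y assume y: "y \<in> - A"
    have "dball d y 1 \<subseteq> - A"
    proof
      fix z assume z: "z \<in> dball d y 1"
      have "d y z < ennreal 1" using z unfolding dball_def by (rule CollectD)
      then have "d z y < \<infinity>"
        unfolding d_sym[of y z] infinity_ennreal_def by (rule order_less_trans) (rule ennreal_less_top)
      moreover have "\<not> d x y < \<infinity>" using y by (simp add: A_def)
      ultimately have "\<not> d x z < \<infinity>"
        using d_triangle[of x y z] by (metis ennreal_add_less_top infinity_ennreal_def order_le_less_trans)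
      then show "z \<in> - A" by (simp add: A_def)
    qed
    then show "\<exists>r>0. dball d y r \<subseteq> - A" by (intro exI[of _ 1]) auto
  qed
  moreover have "x \<in> A" by (simp add: A_def d_refl)
  ultimately have "A = UNIV"
    using connectedD[OF conn, of A "- A"] by auto
  then show ?thesis by (auto simp: A_def)
qed

definition \<rho> :: "'a \<Rightarrow> 'a \<Rightarrow> real" where
  "\<rho> x y = enn2real (d x y)"

lemma d_\<rho>: "d x y = ennreal (\<rho> x y)"
  using d_finite[of x y] by (simp add: \<rho>_def)

lemma \<rho>_nonneg: "0 \<le> \<rho> x y"
  by (simp add: \<rho>_def)

lemma \<rho>_sym: "\<rho> x y = \<rho> y x"
  by (simp add: \<rho>_def d_sym)

lemma \<rho>_refl: "\<rho> x x = 0"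
  by (simp add: \<rho>_def d_refl)

lemma \<rho>_triangle: "\<rho> x z \<le> \<rho> x y + \<rho> y z"
  using d_triangle[of x z y] \<rho>_nonneg by (simp add: d_\<rho> flip: ennreal_plus)

lemma dball_eq: "dball d x r = {y. \<rho> x y < r}"
  using \<rho>_nonneg[of x] by (auto simp: dball_def d_\<rho> ennreal_less_iff)

lemma open_iff: "open U \<longleftrightarrow> (\<forall>x\<in>U. \<exists>r>0. {y. \<rho> x y < r} \<subseteq> U)"
  unfolding open_iff_dball dball_eq ..

lemma open_\<rho>_ball: "open {y. \<rho> x y < r}"
  using open_dball[of x r] by (simp add: dball_eq)

text \<open>Separation comes from the topology: the complement of a point is open, hence contains a
  ball.\<close>

lemma \<rho>_pos: assumes "x \<noteq> y" shows "0 < \<rho> x y"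
proof -
  have "open (- {y})" by (simp add: open_Compl)
  then obtain r where "r > 0" "{z. \<rho> x z < r} \<subseteq> - {y}" using assms unfolding open_iff by blast
  then have "\<not> \<rho> x y < r" by blast
  then show ?thesis using \<open>r > 0\<close> by simp
qed

lemma \<rho>_approx:
  assumes "0 \<le> t" "t < \<rho> x y"
  obtains u where "u \<in> admissible" "t < u x - u y"
proof -
  have "ennreal t < d x y" using assms by (simp add: d_\<rho> ennreal_less_iff)
  then obtain u where u: "u \<in> admissible" "ennreal t < ennreal (u x - u y)"
    unfolding d_eq less_SUP_iff by blast
  then have "t < u x - u y" using assms(1) by (simp add: ennreal_less_iff)
  then show ?thesis using that u(1) by blast
qed

lemma Lipschitz_continuous:
  assumes "\<And>x y. \<bar>u x - u y\<bar> \<le> L * \<rho> x y"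
  shows "continuous_on UNIV u"
  unfolding continuous_on_open_vimage[OF open_UNIV]
proof (intro allI impI)
  fix B :: "real set" assume B: "open B"
  show "open (u -` B \<inter> UNIV)"
    unfolding open_iff
  proof
    fix x assume "x \<in> u -` B \<inter> UNIV"
    then obtain e where e: "e > 0" "\<And>t. \<bar>t - u x\<bar> < e \<Longrightarrow> t \<in> B"
      using B unfolding open_dist dist_real_def by auto
    have "{y. \<rho> x y < e / (\<bar>L\<bar> + 1)} \<subseteq> u -` B \<inter> UNIV"
    proof
      fix y assume "y \<in> {y. \<rho> x y < e / (\<bar>L\<bar> + 1)}"
      then have "(\<bar>L\<bar> + 1) * \<rho> x y < e" by (simp add: field_simps)
      moreover have "\<bar>u y - u x\<bar> \<le> (\<bar>L\<bar> + 1) * \<rho> x y"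
        using assms[of x y] mult_right_mono[OF _ \<rho>_nonneg[of x y], of L "\<bar>L\<bar> + 1"] by linarith
      ultimately show "y \<in> u -` B \<inter> UNIV" using e(2)[of "u y"] by simp
    qed
    then show "\<exists>r>0. {y. \<rho> x y < r} \<subseteq> u -` B \<inter> UNIV"
      using e(1) by (intro exI[of _ "e / (\<bar>L\<bar> + 1)"]) auto
  qed
qed

lemma continuous_\<rho>: "continuous_on UNIV (\<lambda>x. \<rho> x y)"
proof (rule Lipschitz_continuous[of _ 1])
  fix x z show "\<bar>\<rho> x y - \<rho> z y\<bar> \<le> 1 * \<rho> x z"
    using \<rho>_triangle[of x y z] \<rho>_triangle[of z y x] \<rho>_sym[of x z] by linarith
qed

lemma countable_dense:
  obtains C :: "'a set" where "countable C" "\<And>x r. r > 0 \<Longrightarrow> \<exists>c\<in>C. \<rho> c x < r"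
proof -
  obtain C :: "'a set" where C: "countable C" "closure C = UNIV"
    using sep unfolding separable_space_def by auto
  have "\<exists>c\<in>C. \<rho> c x < r" if "r > 0" for x r
  proof -
    have "x \<in> {y. \<rho> x y < r} \<inter> closure C" using that C(2) \<rho>_refl[of x] by simp
    then have "{y. \<rho> x y < r} \<inter> closure C \<noteq> {}" by blast
    then have "{y. \<rho> x y < r} \<inter> C \<noteq> {}"
      using open_Int_closure_eq_empty[OF open_\<rho>_ball] by blast
    then show ?thesis using \<rho>_sym[of x] by auto
  qed
  then show ?thesis using that C(1) by blast
qed

text \<open>Small balls around a countable dense set, restricted to those with compact closure, form
  a countable open cover; the exhaustion consists of the finite unions along an enumeration.\<close>

lemma exhaustion:
  obtains V :: "nat \<Rightarrow> 'a set" where "\<And>n. open (V n)" "\<And>n. compact (closure (V n))" "incseq V"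
    "\<And>K. compact K \<Longrightarrow> \<exists>n. K \<subseteq> V n"
proof -
  obtain C :: "'a set" where C: "countable C" "\<And>x r. r > 0 \<Longrightarrow> \<exists>c\<in>C. \<rho> c x < r"
    by (rule countable_dense) (assumption | rule that)+
  define Bs where "Bs = {B. \<exists>c\<in>C. \<exists>k::nat. B = {y. \<rho> c y < 1 / real (Suc k)} \<and> compact (closure B)}"
  have "Bs \<subseteq> (\<lambda>(c, k::nat). {y. \<rho> c y < 1 / real (Suc k)}) ` (C \<times> UNIV)"
    by (auto simp: Bs_def)
  then have "countable Bs"
    by (rule countable_subset) (intro countable_image countable_SIGMA C(1) countableI_type)
  have cover: "\<exists>B\<in>Bs. x \<in> B" for x
  proof -
    have "compact {x}" by simp
    then obtain W where W: "open W" "{x} \<subseteq> W" "compact (closure W)"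
      by (rule locally_compact_compact_nbhd[OF lc])
    then have "\<exists>r>0. {y. \<rho> x y < r} \<subseteq> W"
      using bspec[OF iffD1[OF open_iff W(1)], of x] by simp
    then obtain r where r: "r > 0" "{y. \<rho> x y < r} \<subseteq> W" by blast
    \<comment> \<open>With radius below \<open>r / 2\<close>, a ball around \<open>c\<close> that
      contains \<open>x\<close> lies within distance \<open>r\<close> of \<open>x\<close>.\<close>
    have "r / 2 > 0" using r(1) by simp
    then obtain k :: nat where k: "1 / real (Suc k) < r / 2" by (rule nat_approx_posE)
    have "1 / real (Suc k) > 0" by simp
    then obtain c where c: "c \<in> C" "\<rho> c x < 1 / real (Suc k)" using C(2) by blast
    define B where "B = {y. \<rho> c y < 1 / real (Suc k)}"
    have "B \<subseteq> W"
    proof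
      fix y assume "y \<in> B"
      then have "\<rho> x y < r"
        using \<rho>_triangle[of x y c] \<rho>_sym[of x c] c(2) k by (simp add: B_def)
      then show "y \<in> W" using r(2) by blast
    qed
    then have "closure B \<subseteq> closure W" by (rule closure_mono)
    then have "compact (closure B)"
      using compact_Int_closed[OF W(3) closed_closure, of B] by (simp add: Int_absorb1)
    then have "B \<in> Bs" using c(1) unfolding Bs_def B_def by blast
    moreover have "x \<in> B" using c(2) by (simp add: B_def)
    ultimately show ?thesis by blast
  qed
  then have "Bs \<noteq> {}" by blast
  define b where "b = from_nat_into Bs"
  have range_b: "range b = Bs" unfolding b_def by (rule range_from_nat_into[OF \<open>Bs \<noteq> {}\<close> \<open>countable Bs\<close>])
  have b: "open (b i)" "compact (closure (b i))" for i
  proof -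
    have "b i \<in> Bs" using range_b by blast
    then show "open (b i)" "compact (closure (b i))" using open_\<rho>_ball by (auto simp: Bs_def)
  qed
  define V where "V n = (\<Union>i\<le>n. b i)" for n
  show ?thesis
  proof
    show "open (V n)" for n unfolding V_def using b(1) by auto
    show "compact (closure (V n))" for n
    proof -
      have c: "compact (\<Union>i\<le>n. closure (b i))" using b(2) by (intro compact_UN) auto
      have "V n \<subseteq> (\<Union>i\<le>n. closure (b i))" unfolding V_def using closure_subset by blast
      then have "closure (V n) \<subseteq> (\<Union>i\<le>n. closure (b i))"
        by (rule closure_minimal) (rule compact_imp_closed[OF c])
      then show ?thesis
        using compact_Int_closed[OF c closed_closure, of "V n"] by (simp add: Int_absorb1)
    qed
    show inc: "incseq V" by (auto simp: incseq_def V_def intro: order_trans)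
    fix K :: "'a set" assume K: "compact K"
    have "K \<subseteq> (\<Union>i\<in>UNIV. b i)" using cover range_b by blast
    then obtain I where I: "finite I" "K \<subseteq> (\<Union>i\<in>I. b i)"
      using compactE_image[OF K, of UNIV b] b(1) by metis
    \<comment> \<open>\<open>insert 0\<close> keeps the maximum meaningful for an empty
      subcover.\<close>
    have "K \<subseteq> V (Max (insert 0 I))"
    proof
      fix x assume "x \<in> K"
      then obtain i where i: "i \<in> I" "x \<in> b i" using I by blast
      have "i \<le> Max (insert 0 I)" using I(1) i(1) by (intro Max_ge) auto
      then show "x \<in> V (Max (insert 0 I))" using i(2) by (auto simp: V_def)
    qed
    then show "\<exists>n. K \<subseteq> V n" by blast
  qed
qed

end

section \<open>Lipschitz functions\<close>

lemma ennreal_quotient_le_imp: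
  assumes "0 \<le> a" "0 < b" "ennreal a / ennreal b \<le> ennreal L" "0 \<le> L"
  shows "a \<le> L * b"
proof -
  have "ennreal (a / b) \<le> ennreal L" using assms by (simp add: divide_ennreal)
  then have "a / b \<le> L" using assms(4) by (simp add: ennreal_le_iff)
  then show ?thesis using assms(2) by (simp add: field_simps)
qed

locale exhausted_intrinsic_space = intrinsic_space m D E \<Gamma> d + exhausted_energy_space m D E \<Gamma> V
  for m :: "'a::t2_space measure" and D E \<Gamma> d V
begin

text \<open>The bound \<open>\<Gamma>(f,f) \<le> c m\<close> on \<open>U\<close>, stated for one
  representative in \<open>D\<close> so that it can be used before \<open>f\<close> is known to be
  locally in the domain. By \<open>G_eq_on_open\<close> the choice does not matter when
  \<open>U\<close> is open. Continuity is built in because coincidence sets are taken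
  pointwise.\<close>

definition energy_le_on :: "'a set \<Rightarrow> real \<Rightarrow> ('a \<Rightarrow> real) \<Rightarrow> bool" where
  "energy_le_on U c f \<longleftrightarrow> continuous_on UNIV f \<and>
     (\<exists>w\<in>D. (AE x in m. x \<in> U \<longrightarrow> f x = w x) \<and>
       (\<forall>B\<in>sets borel. B \<subseteq> U \<longrightarrow> \<Gamma> w w B \<le> c * measure m B))"

lemma energy_le_onI:
  assumes "continuous_on UNIV f" "w \<in> D" "AE x in m. x \<in> U \<longrightarrow> f x = w x"
    and "\<And>B. B \<in> sets borel \<Longrightarrow> B \<subseteq> U \<Longrightarrow> \<Gamma> w w B \<le> c * measure m B"
  shows "energy_le_on U c f"
  unfolding energy_le_on_def using assms by blast

lemma energy_le_onE:
  assumes "energy_le_on U c f"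
  obtains w where "continuous_on UNIV f" "w \<in> D" "AE x in m. x \<in> U \<longrightarrow> f x = w x"
    "\<And>B. B \<in> sets borel \<Longrightarrow> B \<subseteq> U \<Longrightarrow> \<Gamma> w w B \<le> c * measure m B"
  using assms unfolding energy_le_on_def by blast

lemma measure_split:
  assumes "relatively_compact U" "A \<in> sets borel" "B \<in> sets borel" "A \<union> B \<subseteq> U" "A \<inter> B = {}"
    and "U \<in> sets borel"
  shows "measure m (A \<union> B) = measure m A + measure m B"
proof (rule measure_Union)
  have "emeasure m C < \<infinity>" if "C \<subseteq> U" for C
    using emeasure_mono[OF that, of m] assms(6) emeasure_relatively_compact[OF assms(1)]
    by (simp add: order_le_less_trans)
  then show "emeasure m A \<noteq> \<infinity>" "emeasure m B \<noteq> \<infinity>" using assms(4) by (auto simp: less_top)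
qed (use assms in auto)

text \<open>On \<open>{x. g x \<le> f x}\<close> the maximum coincides with \<open>f\<close>, off it
  with \<open>g\<close>; each part then inherits the bound of one function, with no loss in
  \<open>c\<close>.\<close>

lemma energy_le_on_max:
  assumes U: "open U" "relatively_compact U"
    and f: "energy_le_on U c f" and g: "energy_le_on U c g"
  shows "energy_le_on U c (\<lambda>x. max (f x) (g x))"
proof -
  obtain v where v: "continuous_on UNIV f" "v \<in> D" "AE x in m. x \<in> U \<longrightarrow> f x = v x"
    "\<And>B. B \<in> sets borel \<Longrightarrow> B \<subseteq> U \<Longrightarrow> \<Gamma> v v B \<le> c * measure m B"
    using energy_le_onE[OF f] by blast
  obtain w where w: "continuous_on UNIV g" "w \<in> D" "AE x in m. x \<in> U \<longrightarrow> g x = w x"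
    "\<And>B. B \<in> sets borel \<Longrightarrow> B \<subseteq> U \<Longrightarrow> \<Gamma> w w B \<le> c * measure m B"
    using energy_le_onE[OF g] by blast
  let ?h = "\<lambda>x. max (f x) (g x)" and ?z = "\<lambda>x. max (v x) (w x)"
  have z: "?z \<in> D" by (rule D_max[OF v(2) w(2)])
  have h: "continuous_on UNIV ?h" by (intro continuous_intros v w)
  have ae: "AE x in m. x \<in> U \<longrightarrow> ?h x = ?z x" using v(3) w(3) by eventually_elim auto
  show ?thesis
  proof (rule energy_le_onI[OF h z ae])
    fix B assume B: "B \<in> sets borel" "B \<subseteq> U"
    define B1 where "B1 = B \<inter> {x. g x \<le> f x}"
    define B2 where "B2 = B - {x. g x \<le> f x}"
    have "closed {x. g x \<le> f x}" by (intro closed_Collect_le v w)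
    then have Bi: "B1 \<in> sets borel" "B2 \<in> sets borel" using B by (auto simp: B1_def B2_def)
    have BU: "B1 \<subseteq> U" "B2 \<subseteq> U" "B1 \<inter> B2 = {}" "B1 \<union> B2 = B" using B by (auto simp: B1_def B2_def)
    have "\<Gamma> ?z ?z B = \<Gamma> ?z ?z B1 + \<Gamma> ?z ?z B2"
      using G_Un[OF z Bi BU(3)] BU(4) by simp
    also have "\<Gamma> ?z ?z B1 = \<Gamma> v v B1"
      by (rule G_eq_on_coincidence_set[OF z v(2) U(1) h v(1) ae v(3) Bi(1) BU(1)])
        (simp add: B1_def)
    also have "\<Gamma> ?z ?z B2 = \<Gamma> w w B2"
      by (rule G_eq_on_coincidence_set[OF z w(2) U(1) h w(1) ae w(3) Bi(2) BU(2)])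
        (simp add: B2_def)
    also have "\<Gamma> v v B1 + \<Gamma> w w B2 \<le> c * measure m B1 + c * measure m B2"
      by (intro add_mono v(4) w(4) Bi BU)
    also have "\<dots> = c * measure m B"
      using measure_split[OF U(2) Bi, of] U(1) BU B by (simp flip: distrib_left)
    finally show "\<Gamma> ?z ?z B \<le> c * measure m B" .
  qed
qed

lemma energy_le_on_minus:
  assumes "energy_le_on U c f"
  shows "energy_le_on U c (\<lambda>x. - f x)"
proof -
  obtain w where w: "continuous_on UNIV f" "w \<in> D" "AE x in m. x \<in> U \<longrightarrow> f x = w x"
    "\<And>B. B \<in> sets borel \<Longrightarrow> B \<subseteq> U \<Longrightarrow> \<Gamma> w w B \<le> c * measure m B"
    using energy_le_onE[OF assms] by blast
  show ?thesis
  proof (rule energy_le_onI)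
    show "AE x in m. x \<in> U \<longrightarrow> - f x = - w x" using w(3) by eventually_elim auto
    show "\<Gamma> (\<lambda>x. - w x) (\<lambda>x. - w x) B \<le> c * measure m B" if "B \<in> sets borel" "B \<subseteq> U" for B
      using w(4)[OF that] form_minus[OF G_form[OF that(1)] w(2)] by simp
  qed (intro continuous_intros D_minus w)+
qed

lemma energy_le_on_min:
  assumes "open U" "relatively_compact U" "energy_le_on U c f" "energy_le_on U c g"
  shows "energy_le_on U c (\<lambda>x. min (f x) (g x))"
proof -
  have "(\<lambda>x. min (f x) (g x)) = (\<lambda>x. - max (- f x) (- g x))" by (auto simp: min_def max_def)
  then show ?thesis
    using energy_le_on_minus[OF energy_le_on_max[OF assms(1,2) energy_le_on_minus energy_le_on_minus]] assms
    by simp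
qed

text \<open>Constants need not be square integrable, so a cutoff function stands in for 1 on
  \<open>U\<close>.\<close>

lemma constant_representative:
  assumes "relatively_compact U"
  obtains e where "e \<in> D" "e \<in> ess_bounded m" "\<And>x. x \<in> U \<Longrightarrow> e x = 1"
proof -
  obtain \<psi> where \<psi>: "\<psi> \<in> D" "\<psi> \<in> C0" "\<And>x. 0 \<le> \<psi> x" "\<And>x. \<psi> x \<le> 1" "\<And>x. x \<in> closure U \<Longrightarrow> \<psi> x = 1"
    using cutoff[of "closure U" UNIV] assms by (metis open_UNIV relatively_compact_def subset_UNIV)
  have "\<psi> \<in> ess_bounded m"
    using D_measurable[OF \<psi>(1)] \<psi>(3,4) unfolding ess_bounded_def by (auto intro!: exI[of _ 1])
  then show ?thesis using that \<psi> closure_subset[of U] by blast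
qed

text \<open>The added term is constant on the open set \<open>U\<close>, so by locality it carries
  no energy there.\<close>

lemma energy_le_on_add_const:
  assumes U: "open U" "relatively_compact U" and f: "energy_le_on U c f"
  shows "energy_le_on U c (\<lambda>x. f x + a)"
proof -
  obtain w where w: "continuous_on UNIV f" "w \<in> D" "AE x in m. x \<in> U \<longrightarrow> f x = w x"
    "\<And>B. B \<in> sets borel \<Longrightarrow> B \<subseteq> U \<Longrightarrow> \<Gamma> w w B \<le> c * measure m B"
    using energy_le_onE[OF f] by blast
  obtain e where e: "e \<in> D" "e \<in> ess_bounded m" "\<And>x. x \<in> U \<Longrightarrow> e x = 1"
    using constant_representative[OF U(2)] by blast
  let ?z = "\<lambda>x. w x + a * e x"
  have z: "?z \<in> D" by (intro D_add D_scale w e)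
  show ?thesis
  proof (rule energy_le_onI[OF _ z])
    show "continuous_on UNIV (\<lambda>x. f x + a)" by (intro continuous_intros w)
    show "AE x in m. x \<in> U \<longrightarrow> f x + a = ?z x" using w(3) by eventually_elim (simp add: e(3))
    fix B assume B: "B \<in> sets borel" "B \<subseteq> U"
    have ae: "AE x in m. x \<in> U \<longrightarrow> a * e x = a" by (simp add: e(3))
    have ae_b: "(\<lambda>x. a * e x) \<in> ess_bounded m" using ess_bounded_lin[OF e(2,2), of a 0] by simp
    have "\<Gamma> (\<lambda>x. a * e x) (\<lambda>x. a * e x) U = 0"
      by (rule G_open_zero_bounded[OF D_scale[OF e(1)] ae_b U(1) ae])
    then have "\<Gamma> (\<lambda>x. a * e x) (\<lambda>x. a * e x) B = 0"
      using U(1) B by (intro G_null_mono[of _ B U] D_scale e) auto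
    then have "\<Gamma> ?z ?z B = \<Gamma> w w B"
      by (intro form_eq_of_null_diff[OF G_form[OF B(1)] z w(2)]) simp
    then show "\<Gamma> ?z ?z B \<le> c * measure m B" using w(4)[OF B] by simp
  qed
qed

lemma energy_le_on_admissible:
  assumes U: "open U" "relatively_compact U" and u: "u \<in> admissible"
  shows "energy_le_on U (L\<^sup>2) (\<lambda>x. L * u x + a)"
proof (rule energy_le_on_add_const[OF U])
  have u': "u \<in> D_loc m D" "continuous_on UNIV u"
    "dominated_by m (energy_loc_measure m D \<Gamma> u) (\<lambda>_. 1)"
    using u by (auto simp: admissible_def)
  obtain w where w: "w \<in> D" "AE x in m. x \<in> U \<longrightarrow> u x = w x" by (rule D_locE[OF u'(1) U(2)])
  show "energy_le_on U (L\<^sup>2) (\<lambda>x. L * u x)"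
  proof (rule energy_le_onI)
    show "continuous_on UNIV (\<lambda>x. L * u x)" by (intro continuous_intros u')
    show "(\<lambda>x. L * w x) \<in> D" by (rule D_scale[OF w(1)])
    show "AE x in m. x \<in> U \<longrightarrow> L * u x = L * w x" using w(2) by eventually_elim auto
    fix B assume B: "B \<in> sets borel" "B \<subseteq> U"
    have "\<Gamma> w w B \<le> measure m B" by (rule dominated_by_one_imp[OF u'(1,3) U w B])
    then show "\<Gamma> (\<lambda>x. L * w x) (\<lambda>x. L * w x) B \<le> L\<^sup>2 * measure m B"
      using form_scale[OF G_form[OF B(1)] w(1), of L] by (simp add: mult_left_mono)
  qed
qed

lemma zero_energy_le_on: "0 \<le> c \<Longrightarrow> energy_le_on U c (\<lambda>x. 0)"
  by (rule energy_le_onI[OF _ D_zero]) (auto simp: form_zero_right[OF G_form D_zero])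

lemma Lipschitz_approx:
  assumes U: "open U" "relatively_compact U" and L: "0 \<le> L"
    and u: "\<And>x y. \<bar>u x - u y\<bar> \<le> L * \<rho> x y" and \<epsilon>: "\<epsilon> > 0"
  shows "\<exists>f. energy_le_on U (L\<^sup>2) f \<and> (\<forall>z\<in>closure U. \<bar>f z - u z\<bar> < \<epsilon>)"
proof (cases "closure U = {}")
  case True
  then show ?thesis using zero_energy_le_on[of "L\<^sup>2" U] by auto
next
  case False
  have const: "energy_le_on U (L\<^sup>2) (\<lambda>x. a)" for a
    using energy_le_on_add_const[OF U zero_energy_le_on, of "L\<^sup>2" a] by simp
  have "\<exists>f\<in>{f. energy_le_on U (L\<^sup>2) f}. \<forall>z\<in>closure U. \<bar>f z - u z\<bar> < \<epsilon>"
  proof (rule lattice_approx)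
    show "compact (closure U)" using U(2) by (simp add: relatively_compact_def)
    show "continuous_on UNIV f" if "f \<in> {f. energy_le_on U (L\<^sup>2) f}" for f
      using that by (simp add: energy_le_on_def)
    show "continuous_on UNIV u" by (rule Lipschitz_continuous[OF u])
    fix x y
    show "\<exists>f\<in>{f. energy_le_on U (L\<^sup>2) f}. u x - \<epsilon> < f x \<and> f y < u y + \<epsilon>"
    proof (cases "u x - u y < \<epsilon>")
      case True
      then show ?thesis using const[of "u x"] \<epsilon> by (intro bexI[of _ "\<lambda>_. u x"]) auto
    next
      case False
      define \<delta> where "\<delta> = u x - u y"
      have \<delta>: "\<epsilon> \<le> \<delta>" "\<delta> \<le> L * \<rho> x y" using False u[of x y] by (auto simp: \<delta>_def)
      have "L \<noteq> 0" using \<delta> \<epsilon> by auto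
      then have L0: "L > 0" using L by simp
      \<comment> \<open>The slack \<open>\<epsilon>\<close> makes the target strictly less than the
        distance, so the supremum defining \<open>d\<close> yields \<open>v\<close>. Shifted to
        agree with \<open>u\<close> at \<open>x\<close>, the function \<open>L * v\<close> takes at
        \<open>y\<close> a value below
        \<open>u x - (\<delta> - \<epsilon>) = u y + \<epsilon>\<close>.\<close>
      have "0 \<le> (\<delta> - \<epsilon>) / L" "(\<delta> - \<epsilon>) / L < \<rho> x y" using \<delta> L0 \<epsilon> by (auto simp: field_simps)
      then obtain v where v: "v \<in> admissible" "(\<delta> - \<epsilon>) / L < v x - v y" by (rule \<rho>_approx)
      have "\<delta> - \<epsilon> < L * (v x - v y)" using v(2) L0 by (simp add: field_simps)
      then show ?thesis
        using energy_le_on_admissible[OF U v(1), of L "u x - L * v x"] \<epsilon>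
        by (intro bexI[of _ "\<lambda>z. L * v z + (u x - L * v x)"]) (auto simp: \<delta>_def algebra_simps)
    qed
  qed (use False energy_le_on_min[OF U] energy_le_on_max[OF U] in auto)
  then show ?thesis by simp
qed

text \<open>The triangle inequality for square roots keeps \<open>b\<close> exact in the limit,
  where the estimate for sums of squares would double it.\<close>

lemma G_le_by_approx:
  assumes w: "w \<in> D" and B: "B \<in> sets borel" and b: "0 \<le> b"
    and approx: "\<And>\<epsilon>. \<epsilon> > 0 \<Longrightarrow> \<exists>v\<in>D. \<Gamma> v v B \<le> b \<and> E (\<lambda>x. v x - w x) (\<lambda>x. v x - w x) < \<epsilon>"
  shows "\<Gamma> w w B \<le> b"
proof -
  have "sqrt (\<Gamma> w w B) \<le> sqrt b + \<epsilon>" if \<epsilon>: "\<epsilon> > 0" for \<epsilon>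
  proof -
    have "\<epsilon>\<^sup>2 > 0" using \<epsilon> by simp
    from approx[OF this] obtain v where v: "v \<in> D" "\<Gamma> v v B \<le> b" "E (\<lambda>x. v x - w x) (\<lambda>x. v x - w x) < \<epsilon>\<^sup>2"
      by blast
    have d: "(\<lambda>x. w x - v x) \<in> D" by (intro D_diff v w)
    have "\<Gamma> (\<lambda>x. w x - v x) (\<lambda>x. w x - v x) B \<le> E (\<lambda>x. w x - v x) (\<lambda>x. w x - v x)"
      by (rule G_le_E[OF d B])
    also have "\<dots> = E (\<lambda>x. v x - w x) (\<lambda>x. v x - w x)"
      using form_minus[OF E_form d] by simp
    finally have "sqrt (\<Gamma> (\<lambda>x. w x - v x) (\<lambda>x. w x - v x) B) \<le> \<epsilon>"
      using v(3) \<epsilon> by (intro real_le_lsqrt) auto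
    moreover have "sqrt (\<Gamma> w w B) \<le> sqrt (\<Gamma> v v B) + sqrt (\<Gamma> (\<lambda>x. w x - v x) (\<lambda>x. w x - v x) B)"
      using form_triangle[OF G_form[OF B] v(1) d] by simp
    moreover have "sqrt (\<Gamma> v v B) \<le> sqrt b" using v(2) by simp
    ultimately show ?thesis by linarith
  qed
  then have "sqrt (\<Gamma> w w B) \<le> sqrt b" by (rule field_le_epsilon)
  then show ?thesis by simp
qed

text \<open>The approximants have representatives on \<open>W\<close> only, with no control of their
  energy elsewhere. Therefore \<open>u\<close> is shifted by \<open>a\<close> and capped by
  \<open>M * \<psi>\<close>: the result \<open>T\<close> vanishes off \<open>W\<close>, equals
  \<open>u + a\<close> on \<open>U\<close>, and the equally capped approximants have uniformly
  bounded total energy. Closedness applies to \<open>T\<close>, and the shift is removed at the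
  end.\<close>

lemma energy_le_on_limit:
  assumes c: "0 \<le> c" and W: "open W" "relatively_compact W" and u: "continuous_on UNIV u"
    and approx: "\<And>\<epsilon>. \<epsilon> > 0 \<Longrightarrow> \<exists>f. energy_le_on W c f \<and> (\<forall>z\<in>closure W. \<bar>f z - u z\<bar> < \<epsilon>)"
    and U: "open U" "relatively_compact U" "closure U \<subseteq> W"
  shows "energy_le_on U c u"
proof -
  have cW: "compact (closure W)" using W(2) by (simp add: relatively_compact_def)
  have "compact (u ` closure W)"
    using continuous_on_subset[OF u] by (intro compact_continuous_image cW) auto
  then obtain M0 where M0: "\<And>z. z \<in> closure W \<Longrightarrow> \<bar>u z\<bar> \<le> M0"
    using compact_imp_bounded[of "u ` closure W"] by (auto simp: bounded_iff)
  \<comment> \<open>On \<open>closure W\<close> the values of \<open>u\<close> are at most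
    \<open>\<bar>M0\<bar>\<close> in size and an approximant is off by less than 1, so after the
    shift it lies between 0 and \<open>2 * a\<close>, and the cap is inactive where
    \<open>\<psi>\<close> is 1.\<close>
  define a where "a = \<bar>M0\<bar> + 1"
  define M where "M = 2 * a"
  have M: "M > 0" by (simp add: M_def a_def)
  obtain \<psi> where \<psi>: "\<psi> \<in> D" "\<psi> \<in> C0" "\<And>x. 0 \<le> \<psi> x" "\<And>x. \<psi> x \<le> 1" "\<And>x. x \<in> closure U \<Longrightarrow> \<psi> x = 1"
    "closure {x. \<psi> x \<noteq> 0} \<subseteq> W"
    using cutoff[of "closure U" W] U(2,3) W(1) unfolding relatively_compact_def by metis
  have \<psi>_cont: "continuous_on UNIV \<psi>" using \<psi>(2) by (simp add: C0_def)
  have \<psi>_out: "\<psi> x = 0" if "x \<notin> W" for x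
    using \<psi>(6) closure_subset[of "{x. \<psi> x \<noteq> 0}"] that by blast
  have M\<psi>: "(\<lambda>x. M * \<psi> x) \<in> D" by (rule D_scale[OF \<psi>(1)])
  have M\<psi>_cont: "continuous_on UNIV (\<lambda>x. M * \<psi> x)" by (intro continuous_intros \<psi>_cont)
  define T where "T x = min (max (u x + a) 0) (M * \<psi> x)" for x
  have T_meas: "T \<in> borel_measurable m"
    unfolding T_def by (intro continuous_measurable continuous_intros u \<psi>_cont)
  have T_int: "integrable m (\<lambda>x. (T x)\<^sup>2)"
  proof (rule Bochner_Integration.integrable_bound[OF D_square_integrable[OF M\<psi>]])
    show "(\<lambda>x. (T x)\<^sup>2) \<in> borel_measurable m" using T_meas by measurable
    have "(T x)\<^sup>2 \<le> (M * \<psi> x)\<^sup>2" for x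
      using M \<psi>(3)[of x] by (intro power_mono) (auto simp: T_def)
    then show "AE x in m. norm ((T x)\<^sup>2) \<le> norm ((M * \<psi> x)\<^sup>2)" by simp
  qed
  define P where "P v \<longleftrightarrow> (\<forall>B\<in>sets borel. B \<subseteq> U \<longrightarrow> \<Gamma> v v B \<le> c * measure m B)" for v
  have mid: "P (\<lambda>x. (v x + w x) / 2)" if "v \<in> D" "w \<in> D" "P v" "P w" for v w
    unfolding P_def
  proof (intro ballI impI)
    fix B assume B: "B \<in> sets borel" "B \<subseteq> U"
    have "\<Gamma> v v B \<le> c * measure m B" "\<Gamma> w w B \<le> c * measure m B" using that(3,4) B unfolding P_def by blast+
    then show "\<Gamma> (\<lambda>x. (v x + w x) / 2) (\<lambda>x. (v x + w x) / 2) B \<le> c * measure m B"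
      using form_mid_le[OF G_form[OF B(1)] that(1,2)] by simp
  qed
  define b where "b = c * measure m W + M\<^sup>2 * E \<psi> \<psi>"
  have ex: "\<exists>v\<in>D. P v \<and> (\<integral>x. (v x - T x)\<^sup>2 \<partial>m) \<le> \<epsilon> \<and> E v v \<le> b" if \<epsilon>: "\<epsilon> > 0" for \<epsilon>
  proof -
    \<comment> \<open>The bound 1 keeps the shifted approximant within the cap; the square root
      yields \<open>\<delta>\<^sup>2 * measure m W \<le> \<epsilon>\<close>, and adding 1 avoids
      division by 0.\<close>
    define \<delta> where "\<delta> = min 1 (sqrt (\<epsilon> / (measure m W + 1)))"
    have \<delta>: "\<delta> > 0" "\<delta> \<le> 1" using \<epsilon> by (auto simp: \<delta>_def intro!: divide_pos_pos add_nonneg_pos)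
    have "\<delta>\<^sup>2 \<le> (sqrt (\<epsilon> / (measure m W + 1)))\<^sup>2" using \<delta>(1) by (intro power_mono) (auto simp: \<delta>_def)
    also have "\<dots> = \<epsilon> / (measure m W + 1)" using \<epsilon> by simp
    finally have \<delta>W: "\<delta>\<^sup>2 * measure m W \<le> \<epsilon>"
    proof -
      assume *: "\<delta>\<^sup>2 \<le> \<epsilon> / (measure m W + 1)"
      have "measure m W + 1 > 0" by (intro add_nonneg_pos) auto
      then have "\<delta>\<^sup>2 * (measure m W + 1) \<le> \<epsilon>" using * by (simp add: pos_le_divide_eq)
      then have "\<delta>\<^sup>2 * measure m W + \<delta>\<^sup>2 \<le> \<epsilon>" by (simp add: distrib_left)
      then show ?thesis using zero_le_power2[of \<delta>] by linarith
    qed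
    obtain f0 where f0: "energy_le_on W c f0" "\<forall>z\<in>closure W. \<bar>f0 z - u z\<bar> < \<delta>"
      using approx[OF \<delta>(1)] by blast
    define f where "f x = f0 x + a" for x
    have f: "energy_le_on W c f" unfolding f_def by (rule energy_le_on_add_const[OF W f0(1)])
    have fW: "0 \<le> f z" "f z \<le> M" "\<bar>f z - (u z + a)\<bar> \<le> \<delta>" if "z \<in> W" for z
    proof -
      have z: "z \<in> closure W" using that closure_subset by blast
      then have close: "\<bar>f0 z - u z\<bar> < \<delta>" using f0(2) by blast
      have "f0 z \<le> u z + 1" "u z - 1 \<le> f0 z" "u z \<le> \<bar>M0\<bar>" "- \<bar>M0\<bar> \<le> u z"
        using close \<delta>(2) M0[OF z] by linarith+
      then show "0 \<le> f z" "f z \<le> M" unfolding f_def a_def M_def by argo+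
      show "\<bar>f z - (u z + a)\<bar> \<le> \<delta>" using close by (simp add: f_def)
    qed
    obtain w where w: "continuous_on UNIV f" "w \<in> D" "AE x in m. x \<in> W \<longrightarrow> f x = w x"
      "\<And>B. B \<in> sets borel \<Longrightarrow> B \<subseteq> W \<Longrightarrow> \<Gamma> w w B \<le> c * measure m B"
      using energy_le_onE[OF f] by blast
    \<comment> \<open>Outside \<open>W\<close> the representative \<open>w\<close> is arbitrary.
      Taking its positive part before capping makes \<open>v\<close> vanish there, since the cap is
      0.\<close>
    define v where "v = (\<lambda>x. min (max (w x) 0) (M * \<psi> x))"
    have v: "v \<in> D" unfolding v_def by (intro D_min truncation_approx(1) w M\<psi>)
    define g where "g = (\<lambda>x. min (f x) (M * \<psi> x))"
    have g: "continuous_on UNIV g" unfolding g_def by (intro continuous_intros w \<psi>_cont)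
    have gv: "AE x in m. x \<in> W \<longrightarrow> g x = v x"
      using w(3)
    proof eventually_elim
      case (elim x)
      show ?case
      proof
        assume "x \<in> W"
        then have "w x = f x" "0 \<le> f x" using elim fW(1)[of x] by auto
        then show "g x = v x" by (simp add: g_def v_def max_absorb1)
      qed
    qed
    have v_out: "v x = 0" if "x \<notin> W" for x using \<psi>_out[OF that] by (simp add: v_def)
    have Pv: "P v"
      unfolding P_def
    proof (intro ballI impI)
      fix B assume B: "B \<in> sets borel" "B \<subseteq> U"
      have UW: "U \<subseteq> W" using U(3) closure_subset by blast
      then have BW: "B \<subseteq> W" using B by blast
      have "\<Gamma> v v B = \<Gamma> w w B"
      proof (rule G_eq_on_coincidence_set[OF v w(2) W(1) g w(1) gv w(3) B(1) BW])
        fix x assume x: "x \<in> B"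
        then have "x \<in> closure U" using B(2) closure_subset by blast
        then have "\<psi> x = 1" by (rule \<psi>(5))
        then show "g x = f x" using fW(2)[of x] x BW by (auto simp: g_def)
      qed
      then show "\<Gamma> v v B \<le> c * measure m B" using w(4)[OF B(1) BW] by simp
    qed
    have Ev: "E v v \<le> b"
    proof -
      have sW: "W \<in> sets borel" using W(1) by simp
      define W1 where "W1 = W \<inter> {x. f x \<le> M * \<psi> x}"
      define W2 where "W2 = W - {x. f x \<le> M * \<psi> x}"
      have "closed {x. f x \<le> M * \<psi> x}" by (intro closed_Collect_le w M\<psi>_cont)
      then have Wi: "W1 \<in> sets borel" "W2 \<in> sets borel" using sW by (auto simp: W1_def W2_def)
      have WW: "W1 \<subseteq> W" "W2 \<subseteq> W" "W1 \<inter> W2 = {}" "W1 \<union> W2 = W" by (auto simp: W1_def W2_def)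
      \<comment> \<open>The complement of \<open>W\<close> is closed, so locality is applied to a
        larger open set on which \<open>v\<close> vanishes; it exists because the closed support of
        \<open>\<psi>\<close> lies in \<open>W\<close>.\<close>
      have S: "open (- closure {x. \<psi> x \<noteq> 0})" by (simp add: open_Compl)
      have "v x = 0" if "x \<in> - closure {x. \<psi> x \<noteq> 0}" for x
      proof -
        have "\<psi> x = 0" using that closure_subset[of "{x. \<psi> x \<noteq> 0}"] by blast
        then show ?thesis by (simp add: v_def)
      qed
      then have "AE x in m. x \<in> - closure {x. \<psi> x \<noteq> 0} \<longrightarrow> v x = 0" by (intro AE_I2 impI)
      then have null: "\<Gamma> v v (- closure {x. \<psi> x \<noteq> 0}) = 0" by (rule G_open_zero[OF v S])
      have cW: "- W \<in> sets borel" using sW by (rule borel_comp)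
      have "- W \<subseteq> - closure {x. \<psi> x \<noteq> 0}" using \<psi>(6) by (simp only: Compl_subset_Compl_iff)
      then have out: "\<Gamma> v v (- W) = 0"
        by (rule G_null_mono[OF v cW borel_open[OF S] _ null])
      have "E v v = \<Gamma> v v (W \<union> - W)" using G_total[OF v v] by simp
      also have "\<dots> = \<Gamma> v v W + \<Gamma> v v (- W)" by (rule G_Un[OF v sW cW Compl_disjoint])
      also have "\<Gamma> v v W = \<Gamma> v v W1 + \<Gamma> v v W2" using G_Un[OF v Wi WW(3)] WW(4) by simp
      also have "\<Gamma> v v W1 = \<Gamma> w w W1"
        by (rule G_eq_on_coincidence_set[OF v w(2) W(1) g w(1) gv w(3) Wi(1) WW(1)])
          (simp add: W1_def g_def)
      also have "\<Gamma> v v W2 = \<Gamma> (\<lambda>x. M * \<psi> x) (\<lambda>x. M * \<psi> x) W2"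
        by (rule G_eq_on_coincidence_set[OF v M\<psi> W(1) g M\<psi>_cont gv _ Wi(2) WW(2)])
          (auto simp: W2_def g_def)
      also have "\<dots> = M\<^sup>2 * \<Gamma> \<psi> \<psi> W2" by (rule form_scale[OF G_form[OF Wi(2)] \<psi>(1)])
      also have "\<Gamma> w w W1 + M\<^sup>2 * \<Gamma> \<psi> \<psi> W2 + \<Gamma> v v (- W) \<le> c * measure m W + M\<^sup>2 * E \<psi> \<psi> + 0"
      proof (intro add_mono mult_left_mono)
        have "measure m W = measure m W1 + measure m W2"
          using measure_split[OF W(2) Wi _ WW(3) sW] WW(4) by simp
        then have "c * measure m W1 \<le> c * measure m W" using c by (intro mult_left_mono) auto
        then show "\<Gamma> w w W1 \<le> c * measure m W" using w(4)[OF Wi(1) WW(1)] by simp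
        show "\<Gamma> \<psi> \<psi> W2 \<le> E \<psi> \<psi>" by (rule G_le_E[OF \<psi>(1) Wi(2)])
      qed (use out in auto)
      finally show ?thesis by (simp add: b_def)
    qed
    have "(\<integral>x. (v x - T x)\<^sup>2 \<partial>m) \<le> (\<integral>x. \<delta>\<^sup>2 * indicator W x \<partial>m)"
    proof (rule integral_mono_AE')
      have "integrable m (indicator W :: 'a \<Rightarrow> real)"
        using W(1) emeasure_relatively_compact[OF W(2)] by (simp add: integrable_indicator_iff)
      then show "integrable m (\<lambda>x. \<delta>\<^sup>2 * indicator W x)" by simp
      show "AE x in m. (v x - T x)\<^sup>2 \<le> \<delta>\<^sup>2 * indicator W x"
        using gv
      proof eventually_elim
        case (elim x)
        show ?case
        proof (cases "x \<in> W")
          case True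
          have lip: "\<bar>min p q - min (max r 0) q\<bar> \<le> \<bar>p - r\<bar>" if "0 \<le> p" for p q r :: real
            using that by (auto simp: min_def max_def)
          have "\<bar>v x - T x\<bar> \<le> \<bar>\<delta>\<bar>"
            using elim True lip[OF fW(1)[OF True], of "M * \<psi> x" "u x + a"] fW(3)[OF True] \<delta>(1)
            by (simp add: g_def T_def)
          then have "(v x - T x)\<^sup>2 \<le> \<delta>\<^sup>2" by (rule abs_le_square_iff[THEN iffD1])
          then show ?thesis using True by simp
        next
          case False
          then show ?thesis using v_out[OF False] \<psi>_out[OF False] by (simp add: T_def)
        qed
      qed
    qed auto
    also have "\<dots> = \<delta>\<^sup>2 * measure m W" using W(1) by simp
    also have "\<dots> \<le> \<epsilon>" by (rule \<delta>W)
    finally show ?thesis using v Pv Ev by blast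
  qed
  have TD: "T \<in> D" by (rule closure_of_bounded(1)[OF T_meas T_int mid ex])
  have T_approx: "\<exists>v\<in>D. P v \<and> E (\<lambda>x. v x - T x) (\<lambda>x. v x - T x) < \<epsilon>" if "\<epsilon> > 0" for \<epsilon>
  proof -
    obtain v where v: "v \<in> D" "P v" "E1 (\<lambda>x. v x - T x) (\<lambda>x. v x - T x) < \<epsilon>"
      using closure_of_bounded(2)[OF T_meas T_int mid ex \<open>\<epsilon> > 0\<close>] by blast
    then show ?thesis using E_le_E1[of "\<lambda>x. v x - T x"] by (intro bexI[of _ v]) auto
  qed
  have "energy_le_on U c (\<lambda>x. u x + a)"
  proof (rule energy_le_onI[OF _ TD])
    show "continuous_on UNIV (\<lambda>x. u x + a)" by (intro continuous_intros u)
    have "u x + a = T x" if "x \<in> U" for x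
    proof -
      have "x \<in> closure U" using that closure_subset by blast
      then have "\<psi> x = 1" "x \<in> closure W" using \<psi>(5) U(3) closure_subset[of W] by auto
      moreover have "u x \<le> \<bar>M0\<bar>" "- \<bar>M0\<bar> \<le> u x" using M0[OF \<open>x \<in> closure W\<close>] by linarith+
      then have "0 \<le> u x + a" "u x + a \<le> M" unfolding a_def M_def by argo+
      ultimately show ?thesis by (simp add: T_def)
    qed
    then show "AE x in m. x \<in> U \<longrightarrow> u x + a = T x" by simp
    fix B assume B: "B \<in> sets borel" "B \<subseteq> U"
    show "\<Gamma> T T B \<le> c * measure m B"
    proof (rule G_le_by_approx[OF TD B(1)])
      show "0 \<le> c * measure m B" using c by simp
      fix \<epsilon> :: real assume "\<epsilon> > 0"
      from T_approx[OF this] show "\<exists>v\<in>D. \<Gamma> v v B \<le> c * measure m B \<and> E (\<lambda>x. v x - T x) (\<lambda>x. v x - T x) < \<epsilon>"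
        using B unfolding P_def by blast
    qed
  qed
  from energy_le_on_add_const[OF U(1,2) this, of "- a"] show ?thesis by simp
qed

lemma energy_le_on_Lipschitz:
  assumes U: "open U" "relatively_compact U" and L: "0 \<le> L"
    and u: "\<And>x y. \<bar>u x - u y\<bar> \<le> L * \<rho> x y"
  shows "energy_le_on U (L\<^sup>2) u"
proof -
  obtain W where W: "open W" "closure U \<subseteq> W" "compact (closure W)"
    using locally_compact_compact_nbhd[OF lc] U(2) unfolding relatively_compact_def by blast
  then have W': "relatively_compact W" by (simp add: relatively_compact_def)
  show ?thesis
    by (rule energy_le_on_limit[OF _ W(1) W' Lipschitz_continuous[OF u] _ U W(2)])
      (use Lipschitz_approx[OF W(1) W' L u] in auto)
qed

section \<open>McShane extension and the bound by the pointwise Lipschitz constant\<close>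

lemma Lipschitz_extension:
  assumes A: "A \<noteq> {}" and L: "0 \<le> L" and u: "\<And>x y. x \<in> A \<Longrightarrow> y \<in> A \<Longrightarrow> \<bar>u x - u y\<bar> \<le> L * \<rho> x y"
  obtains v where "\<And>x y. \<bar>v x - v y\<bar> \<le> L * \<rho> x y" "\<And>x. x \<in> A \<Longrightarrow> v x = u x"
proof -
  define v where "v x = (INF y\<in>A. u y + L * \<rho> x y)" for x
  obtain a where a: "a \<in> A" using A by blast
  have L\<rho>: "L * \<rho> x z \<le> L * \<rho> x y + L * \<rho> y z" for x y z
    using mult_left_mono[OF \<rho>_triangle[of x z y] L] by (simp add: distrib_left)
  have below: "bdd_below ((\<lambda>y. u y + L * \<rho> x y) ` A)" for x
  proof (rule bdd_belowI2)
    fix y assume y: "y \<in> A"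
    show "u a - L * \<rho> x a \<le> u y + L * \<rho> x y"
      using u[OF a y] L\<rho>[of a y x] \<rho>_sym[of a x] by simp
  qed
  have le: "v x \<le> v y + L * \<rho> x y" for x y
  proof -
    have "v x - L * \<rho> x y \<le> v y"
      unfolding v_def[of y]
    proof (rule cINF_greatest[OF A])
      fix z assume z: "z \<in> A"
      have "v x \<le> u z + L * \<rho> x z" unfolding v_def by (rule cINF_lower[OF below z])
      then show "v x - L * \<rho> x y \<le> u z + L * \<rho> y z" using L\<rho>[of x z y] by simp
    qed
    then show ?thesis by simp
  qed
  show ?thesis
  proof
    show "\<bar>v x - v y\<bar> \<le> L * \<rho> x y" for x y
      using le[of x y] le[of y x] \<rho>_sym[of x y] by (simp add: abs_le_iff)
    fix x assume x: "x \<in> A"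
    show "v x = u x"
    proof (rule antisym)
      show "v x \<le> u x" using cINF_lower[OF below x, of x] \<rho>_refl[of x] by (simp add: v_def)
      show "u x \<le> v x"
        unfolding v_def
      proof (rule cINF_greatest[OF A])
        fix y assume "y \<in> A"
        then show "u x \<le> u y + L * \<rho> x y" using u[OF x, of y] by simp
      qed
    qed
  qed
qed

lemma Lip_imp_Lipschitz:
  assumes "u \<in> Lip d"
  obtains L where "0 \<le> L" "\<And>x y. \<bar>u x - u y\<bar> \<le> L * \<rho> x y"
proof -
  define S where "S = (SUP (x, y)\<in>{(x, y). x \<noteq> y}. ennreal \<bar>u x - u y\<bar> / d x y)"
  have "S < \<infinity>" using assms by (simp add: Lip_def S_def)
  then obtain L where L: "S = ennreal L" "0 \<le> L" by (auto simp: less_top_ennreal)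
  have "\<bar>u x - u y\<bar> \<le> L * \<rho> x y" for x y
  proof (cases "x = y")
    case True
    then show ?thesis by (simp add: \<rho>_refl)
  next
    case False
    have "ennreal \<bar>u x - u y\<bar> / d x y \<le> S"
      unfolding S_def using False by (intro SUP_upper2[of "(x, y)"]) auto
    then show ?thesis
      using \<rho>_pos[OF False] L by (intro ennreal_quotient_le_imp) (auto simp: d_\<rho>)
  qed
  then show ?thesis using that L(2) by blast
qed

lemma Lipschitz_in_D_loc:
  assumes L: "0 \<le> L" and u: "\<And>x y. \<bar>u x - u y\<bar> \<le> L * \<rho> x y"
  shows "u \<in> D_loc m D"
proof -
  have cont: "continuous_on UNIV u" by (rule Lipschitz_continuous[OF u])
  have "set_integrable m K (\<lambda>x. (u x)\<^sup>2)" if K: "compact K" for K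
  proof -
    have "compact (u ` K)" using continuous_on_subset[OF cont] by (intro compact_continuous_image K) auto
    then obtain M where M: "\<And>z. z \<in> K \<Longrightarrow> \<bar>u z\<bar> \<le> M"
      using compact_imp_bounded[of "u ` K"] by (auto simp: bounded_iff)
    have sK: "K \<in> sets borel" using K by (simp add: borel_closed compact_imp_closed)
    have "integrable m (indicator K :: 'a \<Rightarrow> real)"
      using sK emeasure_compact[OF K] by (simp add: integrable_indicator_iff)
    then have int: "integrable m (\<lambda>x. M\<^sup>2 * indicator K x)" by simp
    show ?thesis
      unfolding set_integrable_def
    proof (rule Bochner_Integration.integrable_bound[OF int])
      show "(\<lambda>x. indicator K x *\<^sub>R (u x)\<^sup>2) \<in> borel_measurable m"
        using continuous_measurable[OF cont] sK by measurable
      have "(u z)\<^sup>2 \<le> M\<^sup>2" if "z \<in> K" for z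
        using M[OF that] by (intro abs_le_square_iff[THEN iffD1]) auto
      then show "AE x in m. norm (indicator K x *\<^sub>R (u x)\<^sup>2) \<le> norm (M\<^sup>2 * indicator K x)"
        by (intro AE_I2) (auto simp: indicator_def)
    qed
  qed
  then have "u \<in> L2_loc m" using continuous_measurable[OF cont] by (simp add: L2_loc_def)
  moreover have "\<exists>w\<in>D. AE x in m. x \<in> K \<longrightarrow> u x = w x" if K: "relatively_compact K" for K
  proof -
    obtain n where n: "closure K \<subseteq> V n" using V_exhausts K unfolding relatively_compact_def by blast
    obtain w where w: "w \<in> D" "AE x in m. x \<in> V n \<longrightarrow> u x = w x"
      using energy_le_onE[OF energy_le_on_Lipschitz[OF V_open V_relatively_compact L u]] by blast
    have "AE x in m. x \<in> K \<longrightarrow> u x = w x"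
      using w(2) by eventually_elim (use n closure_subset[of K] in blast)
    then show ?thesis using w(1) by blast
  qed
  ultimately show ?thesis by (simp add: D_loc_def)
qed

text \<open>The comparison function \<open>v\<close> has to agree with \<open>u\<close> only on
  \<open>B\<close>. Taking \<open>v = u\<close> gives absolute continuity; taking an extension of
  \<open>u\<close> from a piece gives the sharper constant there.\<close>

lemma energy_loc_measure_le:
  assumes u: "u \<in> D_loc m D" and n: "open U" "relatively_compact U" "energy_le_on U c v"
    and c: "0 \<le> c" and cont: "continuous_on UNIV u"
    and B: "B \<in> sets borel" "B \<subseteq> U" "\<And>x. x \<in> B \<Longrightarrow> u x = v x"
  shows "emeasure (energy_loc_measure m D \<Gamma> u) B \<le> ennreal c * emeasure m B"
proof -
  obtain w where w: "w \<in> D" "AE x in m. x \<in> U \<longrightarrow> u x = w x" by (rule D_locE[OF u n(2)])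
  obtain z where z: "continuous_on UNIV v" "z \<in> D" "AE x in m. x \<in> U \<longrightarrow> v x = z x"
    "\<And>B. B \<in> sets borel \<Longrightarrow> B \<subseteq> U \<Longrightarrow> \<Gamma> z z B \<le> c * measure m B"
    using energy_le_onE[OF n(3)] by blast
  have "\<Gamma> w w B = \<Gamma> z z B"
    by (rule G_eq_on_coincidence_set[OF w(1) z(2) n(1) cont z(1) w(2) z(3) B])
  also have "\<dots> \<le> c * measure m B" by (rule z(4)[OF B(1,2)])
  finally have "ennreal (\<Gamma> w w B) \<le> ennreal c * ennreal (measure m B)"
    using c by (simp add: ennreal_leI flip: ennreal_mult)
  also have "\<dots> \<le> ennreal c * emeasure m B"
    by (intro mult_left_mono) (simp_all add: measure_def ennreal_enn2real_if)
  finally show ?thesis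
    unfolding energy_loc_measure_eq[OF u n(1,2) w B(1,2)] .
qed

lemma absolutely_continuous_energy:
  assumes L: "0 \<le> L" and u: "\<And>x y. \<bar>u x - u y\<bar> \<le> L * \<rho> x y"
  shows "absolutely_continuous m (energy_loc_measure m D \<Gamma> u)"
  unfolding absolutely_continuous_def
proof
  let ?N = "energy_loc_measure m D \<Gamma> u"
  fix B assume "B \<in> null_sets m"
  then have B: "B \<in> sets borel" "emeasure m B = 0" by auto
  have BV: "B \<inter> V n \<in> null_sets ?N" for n
  proof -
    have s: "B \<inter> V n \<in> sets borel" using B V_sets by auto
    have "emeasure ?N (B \<inter> V n) \<le> ennreal (L\<^sup>2) * emeasure m (B \<inter> V n)"
      by (rule energy_loc_measure_le[OF Lipschitz_in_D_loc[OF L u] V_open V_relatively_compact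
            energy_le_on_Lipschitz[OF V_open V_relatively_compact L u] _ Lipschitz_continuous[OF u] s])
        auto
    also have "emeasure m (B \<inter> V n) = 0"
      using emeasure_mono[of "B \<inter> V n" B m] B by simp
    finally show ?thesis using s by auto
  qed
  have "(\<Union>n. B \<inter> V n) = B" using UN_V by auto
  then show "B \<in> null_sets ?N" using null_sets_UN[of "\<lambda>n. B \<inter> V n" ?N] BV by simp
qed

text \<open>For fixed \<open>y\<close> the points violating the condition form an open set, thanks
  to the strict inequality \<open>\<rho> x y < r\<close>. Closedness supplies the measurability of
  the pieces.\<close>

lemma closed_pointwise_Lipschitz:
  assumes u: "continuous_on UNIV u"
  shows "closed {x. \<forall>y. \<rho> x y < r \<longrightarrow> \<bar>u x - u y\<bar> \<le> l * \<rho> x y}"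
proof -
  have "open ({x. \<rho> x y < r} \<inter> {x. l * \<rho> x y < \<bar>u x - u y\<bar>})" for y
    by (intro open_Int open_Collect_less continuous_intros continuous_\<rho> u)
  then have "open (\<Union>y. {x. \<rho> x y < r} \<inter> {x. l * \<rho> x y < \<bar>u x - u y\<bar>})" by blast
  moreover have "- {x. \<forall>y. \<rho> x y < r \<longrightarrow> \<bar>u x - u y\<bar> \<le> l * \<rho> x y}
      = (\<Union>y. {x. \<rho> x y < r} \<inter> {x. l * \<rho> x y < \<bar>u x - u y\<bar>})"
    by (auto simp: not_le)
  ultimately show ?thesis by (simp add: closed_def)
qed

lemma RN_deriv_le_on_piece:
  assumes L: "0 \<le> L" and u: "\<And>x y. \<bar>u x - u y\<bar> \<le> L * \<rho> x y" and l: "0 \<le> l"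
  shows "AE x in m. x \<in> {x. \<forall>y. \<rho> x y < r \<longrightarrow> \<bar>u x - u y\<bar> \<le> l * \<rho> x y} \<inter> {x. \<rho> s x < r / 2} \<inter> V n \<longrightarrow>
    RN_deriv m (energy_loc_measure m D \<Gamma> u) x \<le> ennreal (l\<^sup>2)"
proof -
  let ?N = "energy_loc_measure m D \<Gamma> u"
  define A where "A = {x. \<forall>y. \<rho> x y < r \<longrightarrow> \<bar>u x - u y\<bar> \<le> l * \<rho> x y} \<inter> {x. \<rho> s x < r / 2} \<inter> V n"
  have cont: "continuous_on UNIV u" by (rule Lipschitz_continuous[OF u])
  have A: "A \<in> sets borel"
    unfolding A_def
    by (intro sets.Int borel_closed[OF closed_pointwise_Lipschitz[OF cont]] borel_open[OF open_\<rho>_ball] V_sets)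
  have AV: "A \<subseteq> V n" by (auto simp: A_def)
  \<comment> \<open>Both points lie within \<open>r / 2\<close> of \<open>s\<close>, hence closer
    than \<open>r\<close> to each other, so the condition at one of them applies to the
    other.\<close>
  have lip: "\<bar>u x - u y\<bar> \<le> l * \<rho> x y" if "x \<in> A" "y \<in> A" for x y
  proof -
    have "\<rho> x y < r" using that \<rho>_triangle[of x y s] \<rho>_sym[of x s] by (auto simp: A_def)
    then show ?thesis using that(1) by (simp add: A_def)
  qed
  have "AE x in m. x \<in> A \<longrightarrow> RN_deriv m ?N x \<le> ennreal (l\<^sup>2)"
  proof (cases "A = {}")
    case False
    obtain v where v: "\<And>x y. \<bar>v x - v y\<bar> \<le> l * \<rho> x y" "\<And>x. x \<in> A \<Longrightarrow> v x = u x"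
      using Lipschitz_extension[OF False l lip] by blast
    show ?thesis
    proof (rule AE_RN_deriv_le[OF sigma_finite absolutely_continuous_energy[OF L u]])
      show "emeasure m A < \<infinity>"
        using emeasure_mono[OF AV, of m] V_sets emeasure_relatively_compact[OF V_relatively_compact, of n]
        by (simp add: order_le_less_trans)
      fix B assume B: "B \<in> sets m" "B \<subseteq> A"
      show "emeasure ?N B \<le> ennreal (l\<^sup>2) * emeasure m B"
        by (rule energy_loc_measure_le[OF Lipschitz_in_D_loc[OF L u] V_open V_relatively_compact
            energy_le_on_Lipschitz[OF V_open V_relatively_compact l v(1)] _ cont])
          (use B AV v(2) in auto)
    qed (use A in auto)
  qed simp
  then show ?thesis by (simp add: A_def)
qed

lemma lip_const_less_imp:
  assumes "lip_const d u x < ennreal l"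
  shows "\<exists>r>0. \<forall>y. \<rho> x y < r \<longrightarrow> \<bar>u x - u y\<bar> \<le> l * \<rho> x y"
proof -
  have l: "0 \<le> l" using assms by (metis ennreal_neg linorder_le_cases not_less_zero)
  have "eventually (\<lambda>y. ennreal \<bar>u x - u y\<bar> / d x y < ennreal l) (at x)"
    using assms unfolding lip_const_def by (rule Limsup_lessD)
  then obtain S where S: "open S" "x \<in> S" "\<And>y. y \<in> S \<Longrightarrow> y \<noteq> x \<Longrightarrow> ennreal \<bar>u x - u y\<bar> / d x y < ennreal l"
    unfolding eventually_at_topological by blast
  have "\<exists>r>0. {y. \<rho> x y < r} \<subseteq> S" using bspec[OF iffD1[OF open_iff S(1)] S(2)] .
  then obtain r where r: "r > 0" "{y. \<rho> x y < r} \<subseteq> S" by blast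
  have "\<bar>u x - u y\<bar> \<le> l * \<rho> x y" if y: "\<rho> x y < r" for y
  proof (cases "y = x")
    case True
    then show ?thesis by (simp add: \<rho>_refl)
  next
    case False
    have "ennreal \<bar>u x - u y\<bar> / ennreal (\<rho> x y) \<le> ennreal l"
      using S(3)[of y] r(2) y False by (auto simp: d_\<rho> intro: less_imp_le)
    then show ?thesis using \<rho>_pos[of x y] False l by (intro ennreal_quotient_le_imp) auto
  qed
  then show ?thesis using r(1) by blast
qed

text \<open>Restricting to rational \<open>l\<close> leaves countably many exceptional null sets
  when the bound is applied almost everywhere; density of the rationals recovers the square of
  \<open>t\<close>.\<close>

lemma ennreal_le_square:
  fixes b t :: ennreal
  assumes le: "\<And>l. l \<in> \<rat> \<Longrightarrow> 0 \<le> l \<Longrightarrow> t < ennreal l \<Longrightarrow> b \<le> ennreal (l\<^sup>2)"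
  shows "b \<le> t\<^sup>2"
proof (cases t)
  case (real t0)
  obtain l0 where l0: "l0 \<in> \<rat>" "t0 < l0" using Rats_dense_in_real[of t0 "t0 + 1"] by auto
  have "b \<le> ennreal (l0\<^sup>2)" using le[OF l0(1)] l0(2) real by (simp add: ennreal_less_iff)
  then have "b < top" by (rule order_le_less_trans) simp
  then obtain b0 where b0: "b = ennreal b0" "0 \<le> b0" by (auto simp: less_top_ennreal)
  have "b0 \<le> t0\<^sup>2"
  proof (rule ccontr)
    assume "\<not> b0 \<le> t0\<^sup>2"
    then have "t0 < sqrt b0" using real by (simp add: real_less_rsqrt)
    then obtain l where l: "l \<in> \<rat>" "t0 < l" "l < sqrt b0" using Rats_dense_in_real by blast
    have "b \<le> ennreal (l\<^sup>2)" using le[OF l(1)] l(2) real by (simp add: ennreal_less_iff)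
    then have "b0 \<le> l\<^sup>2" using b0 by (simp add: ennreal_le_iff)
    then have "sqrt b0 \<le> l" using real l(2) by (intro real_le_lsqrt) auto
    then show False using l(3) by simp
  qed
  then have "b \<le> ennreal (t0\<^sup>2)" using b0 by (simp add: ennreal_leI)
  then show ?thesis using real by (simp add: ennreal_power)
next
  case top
  then show ?thesis by (simp add: power2_eq_square)
qed

lemma dominated_by_lip_const:
  assumes L: "0 \<le> L" and u: "\<And>x y. \<bar>u x - u y\<bar> \<le> L * \<rho> x y"
  shows "dominated_by m (energy_loc_measure m D \<Gamma> u) (\<lambda>x. (lip_const d u x)\<^sup>2)"
  unfolding dominated_by_def
proof
  let ?N = "energy_loc_measure m D \<Gamma> u"
  show "absolutely_continuous m ?N" by (rule absolutely_continuous_energy[OF L u])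
  obtain C :: "'a set" where C: "countable C" "\<And>x r. r > 0 \<Longrightarrow> \<exists>c\<in>C. \<rho> c x < r"
    by (rule countable_dense) (assumption | rule that)+
  define A where "A l r = {x. \<forall>y. \<rho> x y < r \<longrightarrow> \<bar>u x - u y\<bar> \<le> l * \<rho> x y}" for l r
  \<comment> \<open>All indices range over countable sets: rational slopes, radii
    \<open>1 / (k + 1)\<close>, dense centers and members of the exhaustion. A single null set
    therefore serves every piece.\<close>
  have "AE x in m. \<forall>l\<in>{l \<in> \<rat>. 0 \<le> l}. \<forall>k::nat. \<forall>s\<in>C. \<forall>n.
      x \<in> A l (1 / real (Suc k)) \<inter> {x. \<rho> s x < 1 / real (Suc k) / 2} \<inter> V n \<longrightarrow> RN_deriv m ?N x \<le> ennreal (l\<^sup>2)"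
    unfolding A_def
    by (intro AE_ball_countable[THEN iffD2] AE_all_countable[THEN iffD2] ballI allI C(1)
        RN_deriv_le_on_piece[OF L u])
      (auto intro: countable_subset[OF _ countable_rat])
  then show "AE x in m. RN_deriv m ?N x \<le> (lip_const d u x)\<^sup>2"
  proof eventually_elim
    case (elim x)
    show ?case
    proof (rule ennreal_le_square)
      fix l :: real assume l: "l \<in> \<rat>" "0 \<le> l" "lip_const d u x < ennreal l"
      obtain r where r: "r > 0" "\<forall>y. \<rho> x y < r \<longrightarrow> \<bar>u x - u y\<bar> \<le> l * \<rho> x y"
        using lip_const_less_imp[OF l(3)] by blast
      obtain k :: nat where k: "1 / real (Suc k) < r" using nat_approx_posE[OF r(1)] by blast
      have "x \<in> A l (1 / real (Suc k))" using r(2) k by (auto simp: A_def)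
      moreover have "1 / real (Suc k) / 2 > 0" by simp
      from C(2)[OF this] obtain s where "s \<in> C" "\<rho> s x < 1 / real (Suc k) / 2" by blast
      moreover obtain n where "x \<in> V n" using UN_V by blast
      ultimately show "RN_deriv m ?N x \<le> ennreal (l\<^sup>2)"
        using elim l(1,2) by blast
    qed
  qed
qed

end

context intrinsic_space
begin

lemma Lip_D_loc_dominated:
  "Lip d \<subseteq> D_loc m D \<and>
    (\<forall>u \<in> Lip d. dominated_by m (energy_loc_measure m D \<Gamma> u) (\<lambda>x. (lip_const d u x)\<^sup>2))"
proof -
  obtain V :: "nat \<Rightarrow> 'a set" where V: "\<And>n. open (V n)" "\<And>n. compact (closure (V n))" "incseq V"
    "\<And>K. compact K \<Longrightarrow> \<exists>n. K \<subseteq> V n"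
    by (rule exhaustion) (assumption | rule that)+
  interpret exhausted_intrinsic_space m D E \<Gamma> d V
    by unfold_locales (fact V)+
  show ?thesis
    using Lip_imp_Lipschitz Lipschitz_in_D_loc dominated_by_lip_const by (metis subsetI)
qed

end

theorem theorem2p1:
  fixes m :: "'a::t2_space measure"
    and D :: "('a \<Rightarrow> real) set"
    and E :: "('a \<Rightarrow> real) \<Rightarrow> ('a \<Rightarrow> real) \<Rightarrow> real"
    and \<Gamma> :: "('a \<Rightarrow> real) \<Rightarrow> ('a \<Rightarrow> real) \<Rightarrow> 'a set \<Rightarrow> real"
    and d :: "'a \<Rightarrow> 'a \<Rightarrow> ennreal"
  assumes "locally_compact_space (euclidean :: 'a topology)"
    and "connected (UNIV :: 'a set)"
    and "separable_space (euclidean :: 'a topology)"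
    and "radon_measure m"
    and "measure_support m = UNIV"
    and "dirichlet_form m D E"
    and "regular_form m D E"
    and "strongly_local m D E"
    and "energy_measure m D E \<Gamma>"
    and d_def: "d = intrinsic_dist m D \<Gamma>"
    and "induces_topology d"
    and "doubling m d"
  shows "Lip d \<subseteq> D_loc m D \<and>
    (\<forall>u \<in> Lip d. dominated_by m (energy_loc_measure m D \<Gamma> u) (\<lambda>x. (lip_const d u x)\<^sup>2))"
proof -
  have dense: "dense_L2_subspace m D" using assms(6) by (simp add: dirichlet_form_def)
  interpret intrinsic_space m D E \<Gamma> d
    by unfold_locales (fact dense assms)+
  show ?thesis by (rule Lip_D_loc_dominated)
qed

end
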